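(* Let $(X_i)_{i\ge 1}$ be i.i.d. real-valued random variables with $\mathbb E(X_1)=0$, $\mathbb E(X_1^2)=\sigma^2>0$, and suppose there exists $\delta>0$ such that $\mathbb E(|X_1|^{2+\delta})<\infty$. Then for any $a\in\operatorname{supp}V$, $$\lim_{n\to\infty}\ \sup_{x\ge a}\ \sup_{u\ge 0}\left|\mathbb P\left(\frac{x+S_n}{\sigma\sqrt n}\le u\ \Big|\ \tau_x>n\right)-\int_0^u\ell_H\left(\frac{x}{\sigma\sqrt n},y\right)dy\right|=0.$$ In particular, since $V(0)>0$, this holds with $a=0$.
   Context: Let $S_n=\sum_{i=1}^n X_i$ for $n\ge1$. For $x\in\mathbb R$, $\tau_x=\inf\{k\ge 1: x+S_k<0\}$ (with $\inf\emptyset=\infty$). Define $V(x)=-\mathbb E(S_{\tau_x})$ for $x\in\mathbb R$; under the stated moment assumptions it is known that $V$ is well defined, non-negative and non-decreasing, and that $V(x)=\lim_{n\to\infty}\mathbb E\big((x+S_n)\mathbf 1_{\{\tau_x>n\}}\big)$. The notation $\operatorname{supp}V$ means the set where $V>0$, and it is known that $\operatorname{supp}V=\{x\in\mathbb R:\mathbb P(x+X_1\ge 0)>0\}$; in particular $V(0)>0$. Let $\Phi$ and $\phi$ be the standard normal distribution function and density, and $H(x)=2\Phi(x)-1$. Define $\psi(x,y)=\phi(x-y)-\phi(x+y)$ for $x,y\in\mathbb R$, and $\ell_H(x,y)=\psi(x,y)/H(x)$ for $x\ne 0$, extended by continuity to $\ell_H(0,y)=y e^{-y^2/2}$. *)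

theory Defs
  imports "HOL-Probability.Probability" "HOL-Library.Extended_Nat"
begin

text \<open>The steps of the walk are \<open>X 1, X 2, \<dots>\<close>; the value \<open>X 0\<close> is never used.\<close>

definition walk :: "(nat \<Rightarrow> 'a \<Rightarrow> real) \<Rightarrow> nat \<Rightarrow> 'a \<Rightarrow> real" where
  "walk X n \<omega> = (\<Sum>i=1..n. X i \<omega>)"

text \<open>The infimum is taken in \<^typ>\<open>enat\<close>, where the infimum of the empty set is \<open>\<infinity>\<close>.\<close>

definition exit_time :: "(nat \<Rightarrow> 'a \<Rightarrow> real) \<Rightarrow> real \<Rightarrow> 'a \<Rightarrow> enat" where
  "exit_time X x \<omega> = Inf {enat k | k. 1 \<le> k \<and> x + walk X k \<omega> < 0}"

text \<open>On the event that the exit time is infinite (a null set for a centred,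
  non-degenerate walk) the stopped value is set to \<open>0\<close>.\<close>

definition walk_at_exit :: "(nat \<Rightarrow> 'a \<Rightarrow> real) \<Rightarrow> real \<Rightarrow> 'a \<Rightarrow> real" where
  "walk_at_exit X x \<omega> =
     (case exit_time X x \<omega> of enat k \<Rightarrow> walk X k \<omega> | \<infinity> \<Rightarrow> 0)"

definition harmonic_V :: "'a measure \<Rightarrow> (nat \<Rightarrow> 'a \<Rightarrow> real) \<Rightarrow> real \<Rightarrow> real" where
  "harmonic_V M X x = - (LINT \<omega>|M. walk_at_exit X x \<omega>)"

text \<open>This is the set where \<open>V\<close> is positive, without taking a closure.\<close>

definition supp_V :: "'a measure \<Rightarrow> (nat \<Rightarrow> 'a \<Rightarrow> real) \<Rightarrow> real set" where
  "supp_V M X = {x. harmonic_V M X x > 0}"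

definition H :: "real \<Rightarrow> real" where
  "H x = 2 * cdf std_normal_distribution x - 1"

definition psi :: "real \<Rightarrow> real \<Rightarrow> real" where
  "psi x y = std_normal_density (x - y) - std_normal_density (x + y)"

text \<open>The value at \<open>x = 0\<close> is the limit of \<open>psi x y / H x\<close> as \<open>x\<close> tends to \<open>0\<close>.\<close>

definition ell_H :: "real \<Rightarrow> real \<Rightarrow> real" where
  "ell_H x y = (if x = 0 then y * exp (- y\<^sup>2 / 2) else psi x y / H x)"

text \<open>The suprema are taken in \<^typ>\<open>ereal\<close>, so that no boundedness is presupposed.\<close>

definition sup_error :: "'a measure \<Rightarrow> (nat \<Rightarrow> 'a \<Rightarrow> real) \<Rightarrow> real \<Rightarrow> real \<Rightarrow> nat \<Rightarrow> ereal" where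
  "sup_error M X \<sigma> a n =
     (SUP x\<in>{a..}. SUP u\<in>{0..}. ereal
        \<bar>\<P>(\<omega> in M. (x + walk X n \<omega>) / (\<sigma> * sqrt (real n)) \<le> u \<bar> exit_time X x \<omega> > enat n)
          - (LBINT y:{0..u}. ell_H (x / (\<sigma> * sqrt (real n))) y)\<bar>)"

end

theory Submission
  imports Defs
begin

text \<open>
  Normalise the steps to variance one. Let \<open>K\<close> be one step of the walk killed on leaving
  \<open>[0, \<infinity>)\<close>, so that \<open>K\<^sup>n f x\<close> is the mean of \<open>f (x + S\<^sub>n)\<close> on the event that the exit time
  exceeds \<open>n\<close>. The theorem is about the ratio of \<open>K\<^sup>n\<close> applied to the indicator of
  \<open>(u * sqrt n, \<infinity>)\<close> and to \<open>1\<close>.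

  The idea is to run Lindeberg's replacement argument directly for the killed walk. By the
  reflection principle the tail of killed Brownian motion is the function
  \<open>E t v = Phi ((t + u) / sqrt v) + Phi ((t - u) / sqrt v) - 1\<close>. It solves the heat equation on the
  whole line and is odd in \<open>t\<close>. So a killed step takes \<open>E (x / sqrt n) v\<close> to
  \<open>E (x / sqrt n) (v + 1 / n)\<close> up to two terms: a Taylor error of order \<open>n\<close> to the power
  \<open>- 1 - \<delta> / 2\<close>, and the mass that has jumped below \<open>0\<close>, which by oddness counts with the value of
  \<open>E\<close> at the mirror image. As \<open>E\<close> is nearly linear at \<open>0\<close>, this mass contributes the mean overshoot
  times the slope of \<open>E\<close>. Summing over \<open>n\<close> steps (\<open>kernel_asymptotics\<close>), the value for the walk is
  that of Brownian motion started at \<open>x / sqrt n\<close>, plus the slope at \<open>0\<close> times \<open>e / sqrt n\<close>, where \<open>e\<close> is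
  the mean overshoot accumulated up to time \<open>n\<close>. The error is \<open>o(V x / sqrt n)\<close>, where
  \<open>V x = x + e\<close> approximates the harmonic function.

  Two a priori estimates keep the errors small, uniformly in the starting point.
  \<open>lyapunov_exists\<close> constructs a superharmonic function that grows more slowly than linearly and
  bounds all moments of overshoots that occur; this uses the moment of order \<open>2 + \<delta>\<close>. In
  particular \<open>e = o(x)\<close> for large \<open>x\<close>. \<open>surv_bound\<close> gives \<open>K\<^sup>n 1 x \<le> C * V x / sqrt n\<close>, because
  survival and the positive part of \<open>S\<^sub>n\<close> are positively correlated. Since Taylor errors only
  accumulate during survival, they sum to \<open>V x * sqrt n\<close> times the error of one step.

  The passage from smoothed to sharp indicators (\<open>smoothing_error\<close>) needs that the walk rarely
  ends in a window of small width; half of the time is used for survival and the other half for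
  spreading. Finally (\<open>conditional_tail_limit\<close>) the ratio of the leading terms is a mediant of two
  tails of the limit law, with starting points \<open>x / sqrt n\<close> and \<open>0\<close>, with weights proportional to
  the two contributions. If \<open>x\<close> is small against \<open>sqrt n\<close> these tails agree; otherwise the weight of
  the second one vanishes, as \<open>e = o(x)\<close>.
\<close>

section \<open>The standard normal distribution function\<close>

abbreviation Phi :: "real \<Rightarrow> real" where "Phi \<equiv> cdf std_normal_distribution"
abbreviation phi :: "real \<Rightarrow> real" where "phi \<equiv> std_normal_density"

interpretation std_normal: real_distribution std_normal_distribution
  by (rule real_dist_normal_dist)

lemma phi_minus [simp]: "phi (- x) = phi x"
  by (simp add: std_normal_density_def)

lemma phi_pos: "0 < phi x"
  by (simp add: normal_density_pos)

lemma continuous_on_phi [continuous_intros]: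
  "continuous_on A f \<Longrightarrow> continuous_on A (\<lambda>x. phi (f x))"
  unfolding std_normal_density_def by (intro continuous_intros) auto

lemma Phi_diff:
  assumes "a \<le> b"
  shows "Phi b - Phi a = integral {a..b} phi"
proof (cases "a = b")
  case False
  with assms have ab: "a < b" by simp
  have "Phi b - Phi a = measure std_normal_distribution {a<..b}"
    using std_normal.cdf_diff_eq[OF ab] by simp
  also have "\<dots> = (LINT x|std_normal_distribution. indicator {a<..b} x)" by simp
  also have "\<dots> = (LBINT x:{a<..b}. phi x)"
    by (subst integral_real_density) (auto simp: set_lebesgue_integral_def mult.commute)
  also have "\<dots> = (LBINT x:{a..b}. phi x)"
  proof (rule set_integral_null_delta)
    have "sym_diff {a<..b} {a..b} = {a}" using ab by auto
    then show "sym_diff {a<..b} {a..b} \<in> null_sets lborel"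
      by (simp add: null_sets_def)
  qed auto
  also have "\<dots> = integral {a..b} phi"
    by (rule set_borel_integral_eq_integral(2), rule borel_integrable_atLeastAtMost')
      (intro continuous_intros)
  finally show ?thesis .
qed simp

lemma DERIV_Phi: "(Phi has_real_derivative phi x) (at x)"
proof -
  have "((\<lambda>y. integral {x - 1..y} phi) has_real_derivative phi x) (at x within {x - 1..x + 1})"
    by (rule integral_has_real_derivative) (auto intro!: continuous_intros)
  then have "((\<lambda>y. integral {x - 1..y} phi) has_real_derivative phi x) (at x)"
    by (subst (asm) at_within_interior) auto
  then have "((\<lambda>y. Phi (x - 1) + integral {x - 1..y} phi) has_real_derivative 0 + phi x) (at x)"
    by (intro DERIV_add) auto
  then show ?thesis
  proof (rule has_field_derivative_transform_within[where d = 1, THEN DERIV_cong])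
    fix y assume "dist y x < 1"
    then show "Phi (x - 1) + integral {x - 1..y} phi = Phi y"
      by (subst Phi_diff[symmetric]) (auto simp: dist_real_def)
  qed auto
qed

lemma DERIV_Phi_chain [derivative_intros]:
  "(f has_real_derivative D) (at x within S) \<Longrightarrow>
   ((\<lambda>x. Phi (f x)) has_real_derivative phi (f x) * D) (at x within S)"
  by (rule DERIV_chain2[OF DERIV_Phi])

lemma DERIV_phi_chain [derivative_intros]:
  assumes "(f has_real_derivative D) (at x within S)"
  shows "((\<lambda>x. phi (f x)) has_real_derivative (- f x * phi (f x)) * D) (at x within S)"
proof -
  have "(phi has_real_derivative - y * phi y) (at y)" for y
    unfolding std_normal_density_def
    by (auto intro!: derivative_eq_intros simp: field_simps)
  from DERIV_chain2[OF this assms] show ?thesis .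
qed

lemma Phi_mono: "x \<le> y \<Longrightarrow> Phi x \<le> Phi y"
  by (rule std_normal.cdf_nondecreasing)

lemma Phi_strict_mono: "x < y \<Longrightarrow> Phi x < Phi y"
  by (rule DERIV_pos_imp_increasing) (use DERIV_Phi phi_pos in blast)+

lemma Phi_bounds: "0 \<le> Phi x" "Phi x \<le> 1"
  by (rule std_normal.cdf_nonneg) (rule std_normal.cdf_bounded_prob)

lemma Phi_minus: "Phi (- x) = 1 - Phi x"
proof -
  have "Phi t + Phi (- t) = Phi 0 + Phi (- 0)" for t
    by (rule DERIV_isconst_all) (auto intro!: derivative_eq_intros allI)
  then have c: "Phi t + Phi (- t) = 2 * Phi 0" for t by simp
  have "((\<lambda>t. Phi t + Phi (- t)) \<longlongrightarrow> 1 + 0) at_top"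
    by (intro tendsto_add std_normal.cdf_lim_at_top_prob
          filterlim_compose[OF std_normal.cdf_lim_at_bot] filterlim_uminus_at_bot_at_top)
  then have "2 * Phi 0 = 1"
    unfolding c by (simp add: tendsto_const_iff)
  with c[of x] show ?thesis by simp
qed

lemma Phi_0: "Phi 0 = 1 / 2"
  using Phi_minus[of 0] by simp

lemma phi_le: "phi x \<le> exp (- x\<^sup>2 / 2) / 2"
proof -
  have "2 \<le> sqrt (2 * pi)"
    using pi_ge_two by (intro real_le_rsqrt) auto
  then show ?thesis
    unfolding std_normal_density_def by (simp add: field_simps)
qed

text \<open>All four bounds come from \<open>exp (x\<^sup>2 / 2) \<ge> 1 + x\<^sup>2 / 2 + x^4 / 8\<close>; they keep every
  derivative of the heat flow below bounded.\<close>

lemma power_phi_le: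
  shows "phi x \<le> 1" "\<bar>x\<bar> * phi x \<le> 1" "x\<^sup>2 * phi x \<le> 1" "\<bar>x\<bar> ^ 3 * phi x \<le> 4"
proof -
  define E where "E = exp (x\<^sup>2 / 2)"
  have E: "E > 0" "1 + x\<^sup>2 / 2 + (x\<^sup>2 / 2)\<^sup>2 / 2 \<le> E"
    using exp_lower_Taylor_quadratic[of "x\<^sup>2 / 2"] by (auto simp: E_def)
  have phiE: "phi x \<le> 1 / (2 * E)"
    using phi_le[of x] by (simp add: E_def exp_minus field_simps)
  have gen: "a * phi x \<le> b" if "0 \<le> a" "a \<le> 2 * b * E" for a b
  proof -
    have "a * phi x \<le> a * (1 / (2 * E))"
      using that phiE by (intro mult_left_mono) auto
    also have "\<dots> \<le> b" using that E(1) by (simp add: field_simps)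
    finally show ?thesis .
  qed
  have sq: "0 \<le> (\<bar>x\<bar> - 1)\<^sup>2" "0 \<le> (x\<^sup>2 - \<bar>x\<bar>)\<^sup>2" by auto
  have x2: "x\<^sup>2 = \<bar>x\<bar>\<^sup>2" by simp
  have "1 \<le> 2 * E"
    using E(2) zero_le_power2[of x] zero_le_power2[of "x\<^sup>2 / 2"] by linarith
  then show "phi x \<le> 1" using gen[of 1 1] by auto
  show "\<bar>x\<bar> * phi x \<le> 1"
  proof (rule gen)
    have "2 * \<bar>x\<bar> \<le> 1 + x\<^sup>2"
      using sq(1) by (simp add: power2_diff)
    then show "\<bar>x\<bar> \<le> 2 * 1 * E"
      using E(2) zero_le_power2[of x] zero_le_power2[of "x\<^sup>2 / 2"] by linarith
  qed auto
  show "x\<^sup>2 * phi x \<le> 1"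
  proof (rule gen)
    show "x\<^sup>2 \<le> 2 * 1 * E"
      using E(2) zero_le_power2[of x] zero_le_power2[of "x\<^sup>2 / 2"] by linarith
  qed auto
  show "\<bar>x\<bar> ^ 3 * phi x \<le> 4"
  proof (rule gen)
    have "2 * \<bar>x\<bar>^3 \<le> \<bar>x\<bar>\<^sup>2 + \<bar>x\<bar>^4"
      using sq(2) by (auto simp: power2_eq_square eval_nat_numeral algebra_simps)
    moreover have "\<bar>x\<bar>^4 = (x\<^sup>2)\<^sup>2" by simp
    moreover have "(x\<^sup>2)\<^sup>2 = 4 * (x\<^sup>2 / 2)\<^sup>2" by (simp add: power_divide)
    ultimately show "\<bar>x\<bar>^3 \<le> 2 * 4 * E"
      using E zero_le_power2[of x] x2 by linarith
  qed auto
qed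

section \<open>The heat flow and killed Brownian motion\<close>

text \<open>The solution of \<open>\<partial>h/\<partial>v = (1/2) \<partial>\<^sup>2h/\<partial>s\<^sup>2\<close> started at time \<open>v = 0\<close> from the step
  function at the origin. Its space derivatives of orders one to three are \<open>heat1\<close>, \<open>heat2\<close>,
  \<open>heat3\<close>, and \<open>heat22\<close> is the one of order four. Writing the flow in closed form avoids
  convolutions with normal densities altogether.\<close>

definition heat :: "real \<Rightarrow> real \<Rightarrow> real" where
  "heat s v = Phi (s / sqrt v)"

definition heat1 :: "real \<Rightarrow> real \<Rightarrow> real" where
  "heat1 s v = phi (s / sqrt v) / sqrt v"

definition heat2 :: "real \<Rightarrow> real \<Rightarrow> real" where
  "heat2 s v = - (s / sqrt v) * phi (s / sqrt v) / v"

definition heat3 :: "real \<Rightarrow> real \<Rightarrow> real" where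
  "heat3 s v = ((s / sqrt v)\<^sup>2 - 1) * phi (s / sqrt v) / (v * sqrt v)"

definition heat22 :: "real \<Rightarrow> real \<Rightarrow> real" where
  "heat22 s v = (3 * (s / sqrt v) - (s / sqrt v) ^ 3) * phi (s / sqrt v) / v\<^sup>2"

lemma heat_DERIV_space:
  assumes "v > 0"
  shows "((\<lambda>s. heat s v) has_real_derivative heat1 s v) (at s)"
    and "((\<lambda>s. heat1 s v) has_real_derivative heat2 s v) (at s)"
    and "((\<lambda>s. heat2 s v) has_real_derivative heat3 s v) (at s)"
proof -
  have d: "((\<lambda>s. s / sqrt v) has_real_derivative 1 / sqrt v) (at s)"
    by (rule DERIV_cdivide[OF DERIV_ident])
  have v: "sqrt v * sqrt v = v" using assms by simp
  show "((\<lambda>s. heat s v) has_real_derivative heat1 s v) (at s)"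
    unfolding heat_def heat1_def
    by (rule DERIV_cong[OF DERIV_Phi_chain[OF d]]) simp
  show "((\<lambda>s. heat1 s v) has_real_derivative heat2 s v) (at s)"
    unfolding heat1_def heat2_def
    by (rule DERIV_cong[OF DERIV_cdivide[OF DERIV_phi_chain[OF d]]]) (use assms in simp)
  show "((\<lambda>s. heat2 s v) has_real_derivative heat3 s v) (at s)"
    unfolding heat2_def heat3_def
    by (rule DERIV_cong[OF DERIV_cdivide[OF DERIV_mult[OF DERIV_minus[OF d] DERIV_phi_chain[OF d]]]])
      (use assms in \<open>simp add: field_simps power2_eq_square\<close>)
qed

lemma heat_DERIV_shift:
  assumes "v > 0"
  shows "((\<lambda>t. heat (s + t) v) has_real_derivative heat1 (s + t) v) (at t)"
    and "((\<lambda>t. heat1 (s + t) v) has_real_derivative heat2 (s + t) v) (at t)"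
    and "((\<lambda>t. heat2 (s + t) v) has_real_derivative heat3 (s + t) v) (at t)"
proof -
  have sh: "((\<lambda>t. s + t) has_real_derivative 1) (at t)" by (auto intro!: derivative_eq_intros)
  note d = DERIV_chain2[OF _ sh, simplified]
  show "((\<lambda>t. heat (s + t) v) has_real_derivative heat1 (s + t) v) (at t)"
    "((\<lambda>t. heat1 (s + t) v) has_real_derivative heat2 (s + t) v) (at t)"
    "((\<lambda>t. heat2 (s + t) v) has_real_derivative heat3 (s + t) v) (at t)"
    by (rule d, rule heat_DERIV_space[OF assms])+
qed

lemma DERIV_div_sqrt:
  assumes "v > 0"
  shows "((\<lambda>v. s / sqrt v) has_real_derivative - (s / sqrt v) / (2 * v)) (at v)"
  using assms by (auto intro!: derivative_eq_intros simp: field_simps)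

lemma heat_DERIV_time:
  assumes "v > 0"
  shows "((\<lambda>v. heat s v) has_real_derivative heat2 s v / 2) (at v)"
    and "((\<lambda>v. heat1 s v) has_real_derivative heat3 s v / 2) (at v)"
    and "((\<lambda>v. heat2 s v) has_real_derivative heat22 s v / 2) (at v)"
proof -
  define x where "x = s / sqrt v"
  define r where "r = sqrt v"
  have r: "r > 0" "v = r * r" "sqrt v = r" using assms by (auto simp: r_def)
  note d = DERIV_div_sqrt[OF assms, of s]
  show "((\<lambda>v. heat s v) has_real_derivative heat2 s v / 2) (at v)"
    unfolding heat_def heat2_def
    by (rule DERIV_cong[OF DERIV_Phi_chain[OF d]]) (use assms in \<open>simp add: field_simps\<close>)
  show "((\<lambda>v. heat1 s v) has_real_derivative heat3 s v / 2) (at v)"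
  proof -
    have "((\<lambda>v. phi (s / sqrt v) / sqrt v) has_real_derivative
       ((- x * phi x * (- x / (2 * v))) * sqrt v - phi x * (inverse (sqrt v) / 2)) / (sqrt v * sqrt v)) (at v)"
      unfolding x_def using assms
      by (intro DERIV_divide DERIV_phi_chain d DERIV_real_sqrt) auto
    then show ?thesis
      unfolding heat1_def heat3_def x_def[symmetric]
      by (rule DERIV_cong) (use r in \<open>simp add: field_simps power2_eq_square\<close>)
  qed
  show "((\<lambda>v. heat2 s v) has_real_derivative heat22 s v / 2) (at v)"
  proof -
    have "((\<lambda>v. - (s / sqrt v) * phi (s / sqrt v) / v) has_real_derivative
       ((- (- x / (2 * v)) * phi x + (- x * phi x * (- x / (2 * v))) * (- x)) * v - (- x * phi x) * 1) / (v * v)) (at v)"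
      unfolding x_def using assms
      by (intro DERIV_divide DERIV_mult DERIV_phi_chain d DERIV_minus DERIV_ident) auto
    then show ?thesis
      unfolding heat2_def heat22_def x_def[symmetric]
      by (rule DERIV_cong) (use assms in \<open>simp add: field_simps power2_eq_square power3_eq_cube\<close>)
  qed
qed

lemma heat_bounds:
  assumes "0 < v0" "v0 \<le> 1" "v0 \<le> v"
  shows "\<bar>heat1 s v\<bar> \<le> 2 / v0\<^sup>2" "\<bar>heat2 s v\<bar> \<le> 2 / v0\<^sup>2" "\<bar>heat3 s v\<bar> \<le> 2 / v0\<^sup>2"
    "\<bar>heat22 s v\<bar> \<le> 7 / v0\<^sup>2"
proof -
  define x where "x = s / sqrt v"
  have v: "v > 0" using assms by simp
  have vv: "v0\<^sup>2 \<le> v\<^sup>2" using assms by (intro power_mono) auto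
  have vm: "v0\<^sup>2 \<le> v0" using assms by (simp add: power2_eq_square mult_left_le_one_le)
  have v1: "v0\<^sup>2 \<le> v" using vm assms by simp
  have sq: "v0 \<le> sqrt v0" using assms by (intro real_le_rsqrt) (simp add: power2_eq_square mult_left_le_one_le)
  have sq': "v0 \<le> sqrt v" using sq assms real_sqrt_le_mono[of v0 v] by linarith
  have v2: "v0\<^sup>2 \<le> sqrt v" using sq' vm by simp
  have v3: "v0\<^sup>2 \<le> v * sqrt v"
    unfolding power2_eq_square using assms sq' by (intro mult_mono) auto
  have frac: "\<bar>a / b\<bar> \<le> c / v0\<^sup>2" if "\<bar>a\<bar> \<le> c" "v0\<^sup>2 \<le> b" for a b c :: real
  proof -
    have pos: "0 < v0\<^sup>2" using assms by simp
    then have "b > 0" using that by linarith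
    then have "\<bar>a / b\<bar> = \<bar>a\<bar> / b" by simp
    also have "\<dots> \<le> c / v0\<^sup>2" using that pos by (intro frac_le) auto
    finally show ?thesis .
  qed
  note p = power_phi_le[of x] and pp = phi_pos[of x]
  have px: "\<bar>phi x\<bar> = phi x" using pp by simp
  show "\<bar>heat1 s v\<bar> \<le> 2 / v0\<^sup>2"
    unfolding heat1_def x_def[symmetric] using p(1) px v2 by (intro frac) auto
  show "\<bar>heat2 s v\<bar> \<le> 2 / v0\<^sup>2"
    unfolding heat2_def x_def[symmetric] using p(2) px v1 by (intro frac) (auto simp: abs_mult)
  have "\<bar>(x\<^sup>2 - 1) * phi x\<bar> \<le> 2"
  proof -
    have "0 \<le> x\<^sup>2 * phi x" using pp by simp
    with p pp show ?thesis unfolding abs_le_iff left_diff_distrib by linarith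
  qed
  then show "\<bar>heat3 s v\<bar> \<le> 2 / v0\<^sup>2"
    unfolding heat3_def x_def[symmetric] using v3 by (rule frac)
  have "\<bar>(3 * x - x ^ 3) * phi x\<bar> = \<bar>3 * (x * phi x) - x ^ 3 * phi x\<bar>" by (simp add: algebra_simps)
  also have "\<dots> \<le> \<bar>3 * (x * phi x)\<bar> + \<bar>x ^ 3 * phi x\<bar>" by (rule abs_triangle_ineq4)
  also have "\<dots> \<le> 3 * 1 + 4"
    using p px by (intro add_mono) (auto simp: abs_mult power_abs)
  finally show "\<bar>heat22 s v\<bar> \<le> 7 / v0\<^sup>2"
    unfolding heat22_def x_def[symmetric] using vv by (intro frac) auto
qed

lemma heat_minus: "heat (- s) v = 1 - heat s v"
  by (simp add: heat_def Phi_minus)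

lemma heat_01: "0 \<le> heat s v" "heat s v \<le> 1"
  by (auto simp: heat_def Phi_bounds)

lemma heat_mono: "s \<le> t \<Longrightarrow> v > 0 \<Longrightarrow> heat s v \<le> heat t v"
  unfolding heat_def by (intro Phi_mono divide_right_mono) auto

lemma heat1_minus [simp]: "heat1 (- s) v = heat1 s v"
  by (simp add: heat1_def)

lemma lipschitz_of_deriv_bound:
  fixes f :: "real \<Rightarrow> real"
  assumes "\<And>t. t \<in> S \<Longrightarrow> (f has_real_derivative f' t) (at t)" "\<And>t. t \<in> S \<Longrightarrow> \<bar>f' t\<bar> \<le> c"
    and "convex S" "x \<in> S" "y \<in> S"
  shows "\<bar>f x - f y\<bar> \<le> c * \<bar>x - y\<bar>"
  using field_differentiable_bound[OF assms(3), of f f' c x y] assms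
  by (auto intro: has_field_derivative_at_within)

lemma heat_taylor1:
  assumes "0 < v0" "v0 \<le> 1" "v0 \<le> v"
  shows "\<bar>heat (s + z) v - heat s v - z * heat1 s v\<bar> \<le> z\<^sup>2 / v0\<^sup>2"
proof -
  define d where "d = (\<lambda>(m::nat) t. if m = 0 then heat (s + t) v else if m = 1 then heat1 (s + t) v else heat2 (s + t) v)"
  have v: "v > 0" using assms by simp
  have "\<exists>t. \<bar>t\<bar> \<le> \<bar>z\<bar> \<and> heat (s + z) v = (\<Sum>m<2. d m 0 / fact m * z ^ m) + d 2 t / fact 2 * z ^ 2"
    by (rule Maclaurin_bi_le)
      (auto simp: d_def less_2_cases_iff heat_DERIV_shift[OF v])
  then obtain t where t: "heat (s + z) v = heat s v + heat1 s v * z + heat2 (s + t) v / 2 * z\<^sup>2"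
    by (auto simp: d_def eval_nat_numeral)
  have "\<bar>heat (s + z) v - heat s v - z * heat1 s v\<bar> = \<bar>heat2 (s + t) v\<bar> / 2 * z\<^sup>2"
    unfolding t by (simp add: abs_mult)
  also have "\<dots> \<le> (2 / v0\<^sup>2) / 2 * z\<^sup>2"
    by (intro mult_right_mono divide_right_mono heat_bounds assms) auto
  finally show ?thesis by simp
qed

text \<open>For \<open>\<bar>z\<bar> \<le> 1\<close> the remainder is cubic, for \<open>\<bar>z\<bar> > 1\<close> it is quadratic, and \<open>\<bar>z\<bar>\<close> to the power
  \<open>2 + \<delta>\<close> dominates both. This is where a moment of order slightly above two suffices.\<close>

lemma heat_taylor2:
  assumes "0 < v0" "v0 \<le> 1" "v0 \<le> v" "0 \<le> \<delta>" "\<delta> \<le> 1"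
  shows "\<bar>heat (s + z) v - heat s v - z * heat1 s v - z\<^sup>2 / 2 * heat2 s v\<bar> \<le> 2 / v0\<^sup>2 * \<bar>z\<bar> powr (2 + \<delta>)"
proof (cases "\<bar>z\<bar> \<le> 1")
  case True
  define d where "d = (\<lambda>(m::nat) t. if m = 0 then heat (s + t) v else if m = 1 then heat1 (s + t) v
     else if m = 2 then heat2 (s + t) v else heat3 (s + t) v)"
  have v: "v > 0" using assms by simp
  have "\<exists>t. \<bar>t\<bar> \<le> \<bar>z\<bar> \<and> heat (s + z) v = (\<Sum>m<3. d m 0 / fact m * z ^ m) + d 3 t / fact 3 * z ^ 3"
    by (rule Maclaurin_bi_le)
      (auto simp: d_def eval_nat_numeral less_Suc_eq heat_DERIV_shift[OF v])
  then obtain t where t: "heat (s + z) v = heat s v + heat1 s v * z + heat2 s v / 2 * z\<^sup>2 + heat3 (s + t) v / 6 * z^3"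
    by (auto simp: d_def eval_nat_numeral)
  have "\<bar>heat (s + z) v - heat s v - z * heat1 s v - z\<^sup>2 / 2 * heat2 s v\<bar> = \<bar>heat3 (s + t) v\<bar> / 6 * \<bar>z\<bar>^3"
    unfolding t by (simp add: abs_mult power_abs algebra_simps)
  also have "\<dots> \<le> (2 / v0\<^sup>2) * \<bar>z\<bar>^3"
    using heat_bounds(3)[OF assms(1-3), of "s + t"] by (intro mult_right_mono) auto
  also have "\<dots> \<le> 2 / v0\<^sup>2 * \<bar>z\<bar> powr (2 + \<delta>)"
  proof (intro mult_left_mono, cases "z = 0")
    case False
    then have "\<bar>z\<bar>^3 = \<bar>z\<bar> powr 3" by (simp add: powr_numeral)
    also have "\<dots> \<le> \<bar>z\<bar> powr (2 + \<delta>)"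
      using True False assms by (intro powr_mono') auto
    finally show "\<bar>z\<bar>^3 \<le> \<bar>z\<bar> powr (2 + \<delta>)" .
  qed simp_all
  finally show ?thesis .
next
  case False
  have "\<bar>heat (s + z) v - heat s v - z * heat1 s v - z\<^sup>2 / 2 * heat2 s v\<bar>
      \<le> \<bar>heat (s + z) v - heat s v - z * heat1 s v\<bar> + z\<^sup>2 / 2 * \<bar>heat2 s v\<bar>"
    using abs_triangle_ineq4[of "heat (s + z) v - heat s v - z * heat1 s v" "z\<^sup>2 / 2 * heat2 s v"]
    by (simp add: abs_mult)
  also have "\<dots> \<le> z\<^sup>2 / v0\<^sup>2 + z\<^sup>2 / 2 * (2 / v0\<^sup>2)"
    by (intro add_mono mult_left_mono heat_taylor1 heat_bounds assms) auto
  also have "\<dots> = 2 / v0\<^sup>2 * z\<^sup>2" by simp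
  also have "2 / v0\<^sup>2 * z\<^sup>2 = 2 / v0\<^sup>2 * \<bar>z\<bar> powr 2" using False by (simp add: powr_numeral)
  also have "\<dots> \<le> 2 / v0\<^sup>2 * \<bar>z\<bar> powr (2 + \<delta>)"
    using False assms by (intro mult_left_mono powr_mono) auto
  finally show ?thesis .
qed

text \<open>The counterpart of \<open>heat_taylor2\<close> in time: averaged over a centred step \<open>z\<close> of
  variance \<open>h\<close>, the two second-order terms coincide, because \<open>heat\<close> solves the heat equation.\<close>

lemma heat_time_step:
  assumes "0 < v0" "v0 \<le> 1" "v0 \<le> v" "0 \<le> h"
  shows "\<bar>heat s (v + h) - heat s v - h / 2 * heat2 s v\<bar> \<le> 2 / v0\<^sup>2 * h\<^sup>2"
proof (cases "h = 0")
  case False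
  with assms have h: "h > 0" by simp
  define d where "d = (\<lambda>(m::nat) t. if m = 0 then heat s (v + t) else if m = 1 then heat2 s (v + t) / 2 else heat22 s (v + t) / 4)"
  have D: "DERIV (d 0) t :> d 1 t" "DERIV (d 1) t :> d 2 t" if "0 \<le> t" for t
  proof -
    have p: "v + t > 0" using assms that by simp
    have sh: "((\<lambda>t. v + t) has_real_derivative 1) (at t)" by (auto intro!: derivative_eq_intros)
    show "DERIV (d 0) t :> d 1 t"
      using DERIV_chain2[OF heat_DERIV_time(1)[OF p, of s] sh] by (simp add: d_def)
    show "DERIV (d 1) t :> d 2 t"
      using DERIV_cdivide[OF DERIV_chain2[OF heat_DERIV_time(3)[OF p, of s] sh], where c = 2] by (simp add: d_def)
  qed
  have "\<exists>t>0. t \<le> h \<and> heat s (v + h) = (\<Sum>m<2. d m 0 / fact m * h ^ m) + d 2 t / fact 2 * h ^ 2"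
  proof (rule Maclaurin2[OF h])
    show "d 0 = (\<lambda>t. heat s (v + t))" by (simp add: d_def)
    show "\<forall>m t. m < 2 \<and> 0 \<le> t \<and> t \<le> h \<longrightarrow> DERIV (d m) t :> d (Suc m) t"
      using D by (auto simp: numeral_2_eq_2 less_Suc_eq)
  qed
  then obtain t where t: "0 < t" "heat s (v + h) = heat s v + heat2 s v / 2 * h + heat22 s (v + t) / 8 * h\<^sup>2"
    by (auto simp: d_def eval_nat_numeral)
  have "\<bar>heat s (v + h) - heat s v - h / 2 * heat2 s v\<bar> = \<bar>heat22 s (v + t)\<bar> / 8 * h\<^sup>2"
    unfolding t by (simp add: abs_mult)
  also have "\<dots> \<le> (7 / v0\<^sup>2) / 8 * h\<^sup>2"
    using assms t by (intro mult_right_mono divide_right_mono heat_bounds) auto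
  also have "\<dots> \<le> 2 / v0\<^sup>2 * h\<^sup>2"
    using assms(1) by (intro mult_right_mono) (auto simp: divide_simps)
  finally show ?thesis .
qed simp

text \<open>For \<open>t, u \<ge> 0\<close> this is the probability that Brownian motion started at \<open>t\<close> has not hit \<open>0\<close>
  by time \<open>v\<close> and is then above \<open>u\<close> (reflection principle). The same formula continues it to an
  odd solution of the heat equation on the whole line.\<close>

definition killed_tail :: "real \<Rightarrow> real \<Rightarrow> real \<Rightarrow> real" where
  "killed_tail u t v = heat (t + u) v + heat (t - u) v - 1"

definition killed_slope :: "real \<Rightarrow> real \<Rightarrow> real" where
  "killed_slope u v = 2 * heat1 u v"

lemma killed_tail_minus: "killed_tail u (- t) v = - killed_tail u t v"
  using heat_minus[of "t - u" v] heat_minus[of "t + u" v]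
  by (simp add: killed_tail_def algebra_simps)

lemma abs_killed_tail_le: "\<bar>killed_tail u t v\<bar> \<le> 1"
  using heat_01[of "t + u" v] heat_01[of "t - u" v] by (simp add: killed_tail_def)

lemma killed_tail_linear_error:
  assumes "0 < v0" "v0 \<le> 1" "v0 \<le> v"
  shows "\<bar>killed_tail u t v - t * killed_slope u v\<bar> \<le> 2 * t\<^sup>2 / v0\<^sup>2"
proof -
  have "killed_tail u t v - t * killed_slope u v
     = (heat (u + t) v - heat u v - t * heat1 u v) + (heat (- u + t) v - heat (- u) v - t * heat1 (- u) v)"
    by (simp add: killed_tail_def killed_slope_def heat_minus add.commute)
  then show ?thesis
    using heat_taylor1[OF assms, of u t] heat_taylor1[OF assms, of "- u" t] by linarith
qed

lemma killed_slope_bounds: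
  assumes "0 < v0" "v0 \<le> 1" "v0 \<le> v"
  shows "0 \<le> killed_slope u v" "killed_slope u v \<le> 4 / v0\<^sup>2"
  using heat_bounds(1)[OF assms, of u] phi_pos[of "u / sqrt v"] assms
  by (auto simp: killed_slope_def heat1_def)

lemma killed_tail_lipschitz:
  assumes "0 < v0" "v0 \<le> 1" "v0 \<le> v"
  shows "\<bar>killed_tail u t v\<bar> \<le> 4 / v0\<^sup>2 * \<bar>t\<bar>"
proof -
  have v: "v > 0" using assms by simp
  have "\<bar>heat a v - heat b v\<bar> \<le> 2 / v0\<^sup>2 * \<bar>a - b\<bar>" for a b
    by (rule lipschitz_of_deriv_bound[where S = UNIV and f' = "\<lambda>s. heat1 s v"])
      (auto simp: heat_DERIV_space[OF v] heat_bounds[OF assms])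
  from this[of "t + u" u] this[of "t - u" "- u"] show ?thesis
    by (simp add: killed_tail_def heat_minus abs_le_iff)
qed

text \<open>The error is quadratic near \<open>0\<close> and at most linear far away, so every power between
  one and two bounds it. The intermediate power is what the overshoot has a moment for.\<close>

lemma killed_tail_linear_error_powr:
  assumes "0 < v0" "v0 \<le> 1" "v0 \<le> v" "1 \<le> q" "q \<le> 2"
  shows "\<bar>killed_tail u t v - t * killed_slope u v\<bar> \<le> 8 / v0\<^sup>2 * \<bar>t\<bar> powr q"
proof (cases "\<bar>t\<bar> \<le> 1")
  case True
  show ?thesis
  proof (cases "t = 0")
    case True
    then show ?thesis by (simp add: killed_tail_def heat_minus)
  next
    case False
    have "\<bar>killed_tail u t v - t * killed_slope u v\<bar> \<le> 2 * t\<^sup>2 / v0\<^sup>2"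
      by (rule killed_tail_linear_error[OF assms(1-3)])
    also have "\<dots> \<le> 8 / v0\<^sup>2 * t\<^sup>2" by (simp add: divide_right_mono)
    also have "8 / v0\<^sup>2 * t\<^sup>2 = 8 / v0\<^sup>2 * \<bar>t\<bar> powr 2" using False by (simp add: powr_numeral)
    also have "\<dots> \<le> 8 / v0\<^sup>2 * \<bar>t\<bar> powr q"
      using True False assms by (intro mult_left_mono powr_mono') auto
    finally show ?thesis .
  qed
next
  case False
  have "\<bar>killed_tail u t v - t * killed_slope u v\<bar> \<le> \<bar>killed_tail u t v\<bar> + \<bar>t\<bar> * killed_slope u v"
    using killed_slope_bounds(1)[OF assms(1-3), of u] by (metis abs_mult abs_of_nonneg abs_triangle_ineq4)
  also have "\<dots> \<le> 4 / v0\<^sup>2 * \<bar>t\<bar> + \<bar>t\<bar> * (4 / v0\<^sup>2)"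
    by (intro add_mono killed_tail_lipschitz mult_left_mono killed_slope_bounds assms) auto
  also have "\<dots> = 8 / v0\<^sup>2 * \<bar>t\<bar> powr 1" using False by simp
  also have "\<dots> \<le> 8 / v0\<^sup>2 * \<bar>t\<bar> powr q"
    using False assms by (intro mult_left_mono powr_mono) auto
  finally show ?thesis .
qed

lemma killed_slope_time:
  assumes "0 < v0" "v0 \<le> 1" "v0 \<le> v" "v0 \<le> v'"
  shows "\<bar>killed_slope u v - killed_slope u v'\<bar> \<le> 2 / v0\<^sup>2 * \<bar>v - v'\<bar>"
proof -
  have "\<bar>heat1 u v - heat1 u v'\<bar> \<le> 1 / v0\<^sup>2 * \<bar>v - v'\<bar>"
    using assms heat_bounds(3)[OF assms(1,2), of _ u]
    by (intro lipschitz_of_deriv_bound[where S = "{v0..}" and f' = "\<lambda>v. heat3 u v / 2"])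
       (auto intro!: heat_DERIV_time)
  then show ?thesis by (simp add: killed_slope_def abs_le_iff)
qed

text \<open>The time derivative is half the second space derivative. The latter is odd in \<open>t\<close>, so it is
  both bounded and at most proportional to \<open>\<bar>t\<bar>\<close>.\<close>

lemma killed_tail_time:
  assumes "0 < v0" "v0 \<le> 1" "v0 \<le> v" "v0 \<le> v'"
  shows "\<bar>killed_tail u t v - killed_tail u t v'\<bar> \<le> 2 / v0\<^sup>2 * \<bar>t\<bar> * \<bar>v - v'\<bar>"
    and "\<bar>killed_tail u t v - killed_tail u t v'\<bar> \<le> 2 / v0\<^sup>2 * \<bar>v - v'\<bar>"
proof -
  have D: "((\<lambda>v. killed_tail u t v) has_real_derivative (heat2 (t + u) v + heat2 (t - u) v) / 2) (at v)"
    if "v \<in> {v0..}" for v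
    unfolding killed_tail_def using that assms
    by (auto intro!: derivative_eq_intros heat_DERIV_time)
  have odd: "heat2 (t - u) v = - heat2 (u - t) v" for v
    using minus_divide_left[of "u - t" "sqrt v"] phi_minus[of "(u - t) / sqrt v"]
    by (simp add: heat2_def)
  have lip: "\<bar>heat2 a v - heat2 b v\<bar> \<le> 2 / v0\<^sup>2 * \<bar>a - b\<bar>" if "v0 \<le> v" for a b v
    using assms that
    by (intro lipschitz_of_deriv_bound[where S = UNIV and f' = "\<lambda>s. heat3 s v"])
      (auto intro!: heat_DERIV_space heat_bounds)
  have "\<bar>(heat2 (t + u) v + heat2 (t - u) v) / 2\<bar> \<le> 2 / v0\<^sup>2 * \<bar>t\<bar>" if "v \<in> {v0..}" for v
    using lip[of v "t + u" "u - t"] that by (simp add: odd abs_mult)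
  then show "\<bar>killed_tail u t v - killed_tail u t v'\<bar> \<le> 2 / v0\<^sup>2 * \<bar>t\<bar> * \<bar>v - v'\<bar>"
    using assms by (intro lipschitz_of_deriv_bound[OF D, where S = "{v0..}"]) auto
  have "\<bar>(heat2 (t + u) v + heat2 (t - u) v) / 2\<bar> \<le> 2 / v0\<^sup>2" if "v \<in> {v0..}" for v
    using heat_bounds(2)[OF assms(1,2), of v "t + u"] heat_bounds(2)[OF assms(1,2), of v "t - u"] that
    by auto
  then show "\<bar>killed_tail u t v - killed_tail u t v'\<bar> \<le> 2 / v0\<^sup>2 * \<bar>v - v'\<bar>"
    using assms by (intro lipschitz_of_deriv_bound[OF D, where S = "{v0..}"]) auto
qed

section \<open>The killed walk as an operator\<close>

text \<open>The class of functions on which the walk operators act. It contains the identity, whose images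
  approximate the harmonic function, and moments of the overshoot of order up to two; finite
  variance of the steps makes it stable.\<close>

definition sq_growth :: "(real \<Rightarrow> real) \<Rightarrow> bool" where
  "sq_growth f \<longleftrightarrow> f \<in> borel_measurable borel \<and> (\<exists>C. \<forall>x. \<bar>f x\<bar> \<le> C * (1 + x\<^sup>2))"

lemma sq_growth_measurable: "sq_growth f \<Longrightarrow> f \<in> borel_measurable borel"
  by (simp add: sq_growth_def)

lemma sq_growthI:
  assumes "f \<in> borel_measurable borel" "\<And>x. \<bar>f x\<bar> \<le> C * (1 + x\<^sup>2)"
  shows "sq_growth f"
  using assms by (auto simp: sq_growth_def)

lemma sq_growthE:
  assumes "sq_growth f"
  obtains C where "C \<ge> 0" "\<And>x. \<bar>f x\<bar> \<le> C * (1 + x\<^sup>2)"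
proof -
  obtain C where C: "\<And>x. \<bar>f x\<bar> \<le> C * (1 + x\<^sup>2)"
    using assms by (auto simp: sq_growth_def)
  have "C \<ge> 0" using C[of 0] by auto
  with C show ?thesis using that by blast
qed

lemma sq_growth_bounded:
  assumes "f \<in> borel_measurable borel" "\<And>x. \<bar>f x\<bar> \<le> C"
  shows "sq_growth f"
proof (rule sq_growthI[OF assms(1)])
  fix x
  have "0 \<le> C" using assms(2)[of 0] by auto
  then have "C * 1 \<le> C * (1 + x\<^sup>2)" by (intro mult_left_mono) auto
  with assms(2)[of x] show "\<bar>f x\<bar> \<le> C * (1 + x\<^sup>2)" by auto
qed

lemma sq_growth_mono:
  assumes "f \<in> borel_measurable borel" "sq_growth g" "\<And>x. \<bar>f x\<bar> \<le> \<bar>g x\<bar>"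
  shows "sq_growth f"
proof -
  obtain C where "\<And>x. \<bar>g x\<bar> \<le> C * (1 + x\<^sup>2)" using assms(2) by (rule sq_growthE) blast
  then show ?thesis using assms(1,3) by (intro sq_growthI[of f C]) (auto intro: order_trans)
qed

lemma sq_growth_add [intro]:
  assumes "sq_growth f" "sq_growth g"
  shows "sq_growth (\<lambda>x. f x + g x)"
proof -
  obtain C D where C: "\<And>x. \<bar>f x\<bar> \<le> C * (1 + x\<^sup>2)" and D: "\<And>x. \<bar>g x\<bar> \<le> D * (1 + x\<^sup>2)"
    using sq_growthE[OF assms(1)] sq_growthE[OF assms(2)] by metis
  have "\<bar>f x + g x\<bar> \<le> (C + D) * (1 + x\<^sup>2)" for x
    using C[of x] D[of x] unfolding distrib_right by linarith
  then show ?thesis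
    using assms[THEN sq_growth_measurable] by (intro sq_growthI[of _ "C + D"]) measurable
qed

lemma sq_growth_cmult [intro]:
  assumes "sq_growth f"
  shows "sq_growth (\<lambda>x. c * f x)"
proof -
  obtain C where "\<And>x. \<bar>f x\<bar> \<le> C * (1 + x\<^sup>2)" using assms by (rule sq_growthE) blast
  then have "\<bar>c * f x\<bar> \<le> (\<bar>c\<bar> * C) * (1 + x\<^sup>2)" for x
    unfolding abs_mult mult.assoc by (intro mult_left_mono) auto
  then show ?thesis
    using assms[THEN sq_growth_measurable] by (intro sq_growthI[of _ "\<bar>c\<bar> * C"]) measurable
qed

lemma sq_growth_diff [intro]:
  assumes "sq_growth f" "sq_growth g"
  shows "sq_growth (\<lambda>x. f x - g x)"
  using sq_growth_add[OF assms(1) sq_growth_cmult[OF assms(2), of "-1"]] by simp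

lemma sq_growth_abs [intro]: "sq_growth f \<Longrightarrow> sq_growth (\<lambda>x. \<bar>f x\<bar>)"
  by (rule sq_growth_mono[of _ f]) (auto dest: sq_growth_measurable)

lemma sq_growth_const [intro, simp]: "sq_growth (\<lambda>x. c)"
  by (rule sq_growth_bounded) auto

lemma sq_growth_ident [intro, simp]: "sq_growth (\<lambda>x. x)"
proof (rule sq_growthI[of _ 1])
  fix x :: real
  have "0 \<le> (\<bar>x\<bar> - 1)\<^sup>2" by simp
  then show "\<bar>x\<bar> \<le> 1 * (1 + x\<^sup>2)" by (simp add: power2_diff)
qed auto

lemma sq_growth_indicator [intro]:
  "A \<in> sets borel \<Longrightarrow> sq_growth f \<Longrightarrow> sq_growth (\<lambda>x. indicator A x * f x)"
  by (rule sq_growth_mono[of _ f]) (auto simp: indicator_def dest: sq_growth_measurable)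

lemma sq_growth_pos [intro]: "sq_growth f \<Longrightarrow> sq_growth (\<lambda>x. max 0 (f x))"
  by (rule sq_growth_mono[of _ f]) (auto dest: sq_growth_measurable)

lemma sq_growth_sum [intro]:
  assumes "\<And>i. i \<in> I \<Longrightarrow> sq_growth (f i)"
  shows "sq_growth (\<lambda>x. \<Sum>i\<in>I. f i x)"
  using assms by (induction I rule: infinite_finite_induct) (simp_all add: sq_growth_add)

lemma square_sum_le: "(x + y)\<^sup>2 \<le> 2 * x\<^sup>2 + 2 * (y::real)\<^sup>2"
  using zero_le_power2[of "x - y"] unfolding power2_sum power2_diff by linarith

locale step_law = prob_space \<mu> for \<mu> :: "real measure" +
  assumes sets_law [measurable_cong, simp]: "sets \<mu> = sets borel"
    and integrable_step: "integrable \<mu> (\<lambda>y. y)"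
    and integrable_step2: "integrable \<mu> (\<lambda>y. y\<^sup>2)"
    and mean_zero: "(\<integral>y. y \<partial>\<mu>) = 0"
begin

lemma space_law [simp]: "space \<mu> = UNIV"
  using sets_eq_imp_space_eq[OF sets_law] by simp

lemma prob_UNIV [simp]: "prob UNIV = 1"
  using prob_space by simp

definition T :: "(real \<Rightarrow> real) \<Rightarrow> real \<Rightarrow> real" where
  "T f x = (\<integral>y. f (x + y) \<partial>\<mu>)"

text \<open>One step of the walk killed on leaving \<open>[0, \<infinity>)\<close>. Only the values of \<open>f\<close> on the half-line matter,
  while the starting point may be negative.\<close>

definition K :: "(real \<Rightarrow> real) \<Rightarrow> real \<Rightarrow> real" where
  "K f = T (\<lambda>z. indicator {0..} z * f z)"

lemma integrable_shift:
  assumes "sq_growth f"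
  shows "integrable \<mu> (\<lambda>y. f (x + y))"
proof -
  obtain C where C: "C \<ge> 0" "\<And>x. \<bar>f x\<bar> \<le> C * (1 + x\<^sup>2)" using assms by (rule sq_growthE) blast
  show ?thesis
  proof (rule Bochner_Integration.integrable_bound)
    show "integrable \<mu> (\<lambda>y. C * (1 + 2 * x\<^sup>2 + 2 * y\<^sup>2))"
      using integrable_step2 by auto
    show "AE y in \<mu>. norm (f (x + y)) \<le> norm (C * (1 + 2 * x\<^sup>2 + 2 * y\<^sup>2))"
    proof (rule AE_I2)
      fix y
      have "\<bar>f (x + y)\<bar> \<le> C * (1 + (x + y)\<^sup>2)" by (rule C)
      also have "\<dots> \<le> C * (1 + 2 * x\<^sup>2 + 2 * y\<^sup>2)" using C(1) by (intro mult_left_mono) (auto simp: square_sum_le)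
      finally show "norm (f (x + y)) \<le> norm (C * (1 + 2 * x\<^sup>2 + 2 * y\<^sup>2))" using C(1) by simp
    qed
    show "(\<lambda>y. f (x + y)) \<in> borel_measurable \<mu>"
      using sq_growth_measurable[OF assms] by measurable
  qed
qed

lemma sq_growth_T [intro]:
  assumes "sq_growth f"
  shows "sq_growth (T f)"
proof -
  obtain C where C: "C \<ge> 0" "\<And>x. \<bar>f x\<bar> \<le> C * (1 + x\<^sup>2)" using assms by (rule sq_growthE) blast
  let ?m = "2 * (\<integral>y. y\<^sup>2 \<partial>\<mu>)"
  have m: "?m \<ge> 0" by simp
  show ?thesis
  proof (rule sq_growthI[of _ "C * (2 + ?m)"])
    show "T f \<in> borel_measurable borel"
    proof -
      have [measurable]: "f \<in> borel_measurable borel" using assms by (rule sq_growth_measurable)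
      show ?thesis unfolding T_def by (rule borel_measurable_lebesgue_integral) measurable
    qed
    fix x
    have "\<bar>T f x\<bar> \<le> (\<integral>y. \<bar>f (x + y)\<bar> \<partial>\<mu>)"
      unfolding T_def using integral_norm_bound[of \<mu> "\<lambda>y. f (x + y)"] by simp
    also have "\<dots> \<le> (\<integral>y. C * (1 + 2 * x\<^sup>2 + 2 * y\<^sup>2) \<partial>\<mu>)"
    proof (rule integral_mono)
      show "integrable \<mu> (\<lambda>y. \<bar>f (x + y)\<bar>)" using integrable_shift[OF assms] by simp
      show "integrable \<mu> (\<lambda>y. C * (1 + 2 * x\<^sup>2 + 2 * y\<^sup>2))" using integrable_step2 by auto
      fix y
      have "\<bar>f (x + y)\<bar> \<le> C * (1 + (x + y)\<^sup>2)" by (rule C)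
      also have "\<dots> \<le> C * (1 + 2 * x\<^sup>2 + 2 * y\<^sup>2)" using C(1) by (intro mult_left_mono) (auto simp: square_sum_le)
      finally show "\<bar>f (x + y)\<bar> \<le> C * (1 + 2 * x\<^sup>2 + 2 * y\<^sup>2)" .
    qed
    also have "\<dots> = C * (1 + 2 * x\<^sup>2 + ?m)"
      using integrable_step2 prob_space by (simp add: integral_add)
    also have "\<dots> \<le> C * ((2 + ?m) * (1 + x\<^sup>2))"
      using C(1) m mult_nonneg_nonneg[OF m zero_le_power2[of x]] by (intro mult_left_mono) (simp_all add: algebra_simps)
    finally show "\<bar>T f x\<bar> \<le> C * (2 + ?m) * (1 + x\<^sup>2)" by (simp add: mult.assoc)
  qed
qed

lemma T_mono:
  assumes "sq_growth f" "sq_growth g" "\<And>z. f z \<le> g z"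
  shows "T f x \<le> T g x"
  unfolding T_def by (intro integral_mono integrable_shift assms)

lemma T_add: "sq_growth f \<Longrightarrow> sq_growth g \<Longrightarrow> T (\<lambda>z. f z + g z) x = T f x + T g x"
  unfolding T_def by (intro Bochner_Integration.integral_add integrable_shift)

lemma T_diff: "sq_growth f \<Longrightarrow> sq_growth g \<Longrightarrow> T (\<lambda>z. f z - g z) x = T f x - T g x"
  unfolding T_def by (intro Bochner_Integration.integral_diff integrable_shift)

lemma T_cmult: "T (\<lambda>z. c * f z) x = c * T f x"
  unfolding T_def by simp

lemma T_const [simp]: "T (\<lambda>z. c) x = c"
  by (simp add: T_def prob_space)

lemma T_ident [simp]: "T (\<lambda>z. z) x = x"
  unfolding T_def using integrable_step mean_zero by (simp add: prob_space)

lemma T_abs: "\<bar>T f x\<bar> \<le> T (\<lambda>z. \<bar>f z\<bar>) x"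
  unfolding T_def using integral_norm_bound[of \<mu> "\<lambda>y. f (x + y)"] by simp

lemma T_nonneg: "(\<And>z. 0 \<le> f z) \<Longrightarrow> 0 \<le> T f x"
  unfolding T_def by simp

lemma T_mono_arg:
  assumes "sq_growth f" "mono f" "x \<le> x'"
  shows "T f x \<le> T f x'"
  unfolding T_def using monoD[OF assms(2)] assms(3)
  by (intro integral_mono integrable_shift assms(1)) auto

lemma sq_growth_K [intro]: "sq_growth f \<Longrightarrow> sq_growth (K f)"
  unfolding K_def by (intro sq_growth_T sq_growth_indicator) auto

lemma K_mono:
  assumes "sq_growth f" "sq_growth g" "\<And>z. 0 \<le> z \<Longrightarrow> f z \<le> g z"
  shows "K f x \<le> K g x"
  unfolding K_def using assms(3)
  by (intro T_mono sq_growth_indicator assms) (auto simp: indicator_def)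

lemma K_add: "sq_growth f \<Longrightarrow> sq_growth g \<Longrightarrow> K (\<lambda>z. f z + g z) x = K f x + K g x"
  unfolding K_def distrib_left by (intro T_add sq_growth_indicator) auto

lemma K_cmult: "K (\<lambda>z. c * f z) x = c * K f x"
  unfolding K_def T_cmult[symmetric] by (simp add: mult.left_commute)

lemma K_nonneg: "(\<And>z. 0 \<le> z \<Longrightarrow> 0 \<le> f z) \<Longrightarrow> 0 \<le> K f x"
  unfolding K_def by (intro T_nonneg) (auto simp: indicator_def)

lemma K_le_T:
  assumes "sq_growth f" "\<And>z. 0 \<le> f z"
  shows "K f x \<le> T f x"
  unfolding K_def using assms(2)
  by (intro T_mono assms sq_growth_indicator) (auto simp: indicator_def)

abbreviation Kn :: "nat \<Rightarrow> (real \<Rightarrow> real) \<Rightarrow> real \<Rightarrow> real" where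
  "Kn n f \<equiv> (K ^^ n) f"

lemma sq_growth_Kn [intro]: "sq_growth f \<Longrightarrow> sq_growth (Kn n f)"
  by (induction n) (simp_all add: sq_growth_K)

lemma Kn_mono:
  assumes "sq_growth f" "sq_growth g" "\<And>z. f z \<le> g z"
  shows "Kn n f x \<le> Kn n g x"
  by (induction n arbitrary: x) (simp_all add: assms(3) K_mono sq_growth_Kn assms(1,2))

lemma Kn_mono_half_line:
  assumes "sq_growth f" "sq_growth g" "\<And>z. 0 \<le> z \<Longrightarrow> f z \<le> g z" "n > 0"
  shows "Kn n f x \<le> Kn n g x"
proof -
  obtain m where n: "n = Suc m" using assms(4) by (cases n) auto
  show ?thesis unfolding n funpow_Suc_right o_def
    by (intro Kn_mono sq_growth_K K_mono assms)
qed

lemma Kn_add: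
  assumes "sq_growth f" "sq_growth g"
  shows "Kn n (\<lambda>z. f z + g z) x = Kn n f x + Kn n g x"
proof (induction n arbitrary: x)
  case (Suc n)
  have "Kn (Suc n) (\<lambda>z. f z + g z) x = K (\<lambda>z. Kn n f z + Kn n g z) x"
    by (simp add: Suc.IH[abs_def])
  then show ?case by (simp add: K_add sq_growth_Kn assms)
qed simp

lemma Kn_cmult: "Kn n (\<lambda>z. c * f z) x = c * Kn n f x"
proof (induction n arbitrary: x)
  case (Suc n)
  have "Kn (Suc n) (\<lambda>z. c * f z) x = K (\<lambda>z. c * Kn n f z) x"
    by (simp add: Suc.IH[abs_def])
  then show ?case by (simp add: K_cmult)
qed simp

lemma Kn_diff:
  assumes "sq_growth f" "sq_growth g"
  shows "Kn n (\<lambda>z. f z - g z) x = Kn n f x - Kn n g x"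
  using Kn_add[OF assms(1) sq_growth_cmult[OF assms(2), of "-1"], of n x] Kn_cmult[of n "-1" g x]
  by simp

lemma Kn_sum:
  assumes "\<And>i. i \<in> I \<Longrightarrow> sq_growth (f i)"
  shows "Kn n (\<lambda>z. \<Sum>i\<in>I. f i z) x = (\<Sum>i\<in>I. Kn n (f i) x)"
proof -
  have zero: "Kn n (\<lambda>z. 0) x = 0" using Kn_cmult[of n 0 "\<lambda>z. 0" x] by simp
  show ?thesis
    using assms
    by (induction I rule: infinite_finite_induct) (simp_all add: zero Kn_add sq_growth_sum)
qed

lemma Kn_nonneg: "(\<And>z. 0 \<le> f z) \<Longrightarrow> 0 \<le> Kn n f x"
  by (induction n arbitrary: x) (simp_all add: K_nonneg)

lemma Kn_abs:
  assumes "sq_growth f"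
  shows "\<bar>Kn n f x\<bar> \<le> Kn n (\<lambda>z. \<bar>f z\<bar>) x"
proof -
  have "Kn n f x \<le> Kn n (\<lambda>z. \<bar>f z\<bar>) x"
    by (intro Kn_mono assms sq_growth_abs) auto
  moreover have "Kn n (\<lambda>z. -1 * f z) x \<le> Kn n (\<lambda>z. \<bar>f z\<bar>) x"
    by (intro Kn_mono assms sq_growth_abs sq_growth_cmult) auto
  ultimately show ?thesis unfolding Kn_cmult by simp
qed

lemma Kn_plus: "Kn (m + n) f = Kn m (Kn n f)"
  by (simp add: funpow_add)

definition surv :: "nat \<Rightarrow> real \<Rightarrow> real" where
  "surv n = Kn n (\<lambda>_. 1)"

definition overshoot :: "real \<Rightarrow> real" where
  "overshoot = T (\<lambda>z. max 0 (- z))"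

definition mean_overshoot :: "nat \<Rightarrow> real \<Rightarrow> real" where
  "mean_overshoot n x = (\<Sum>k<n. Kn k overshoot x)"

text \<open>The mean position on survival up to time \<open>n\<close>. It increases with \<open>n\<close>, and its limit is the
  harmonic function of the killed walk.\<close>

definition V :: "nat \<Rightarrow> real \<Rightarrow> real" where
  "V n = Kn n (\<lambda>z. z)"

lemma sq_growth_neg_part [intro, simp]: "sq_growth (\<lambda>z. max 0 (- z))"
  using sq_growth_pos[OF sq_growth_cmult[OF sq_growth_ident, of "-1"]] by simp

lemma sq_growth_overshoot [intro, simp]: "sq_growth overshoot"
  unfolding overshoot_def by auto

lemma sq_growth_surv [intro, simp]: "sq_growth (surv n)"
  unfolding surv_def by auto

lemma sq_growth_V [intro, simp]: "sq_growth (V n)"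
  unfolding V_def by auto

lemma overshoot_nonneg: "0 \<le> overshoot x"
  unfolding overshoot_def by (rule T_nonneg) auto

lemma K_ident: "K (\<lambda>z. z) x = x + overshoot x"
proof -
  have "K (\<lambda>z. z) x = T (\<lambda>z. z + max 0 (- z)) x"
    unfolding K_def by (rule arg_cong[where f = "\<lambda>f. T f x"]) (auto simp: indicator_def max_def)
  then show ?thesis unfolding overshoot_def by (subst (asm) T_add) auto
qed

text \<open>Optional stopping: a killed step takes the identity to the identity plus the mean overshoot.\<close>

lemma V_eq: "V n x = x + mean_overshoot n x"
proof (induction n)
  case (Suc n)
  have "V (Suc n) x = Kn n (\<lambda>z. z + overshoot z) x"
    unfolding V_def funpow_Suc_right o_def K_ident[abs_def] ..
  also have "\<dots> = V n x + Kn n overshoot x"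
    unfolding V_def by (rule Kn_add) auto
  finally show ?case using Suc by (simp add: mean_overshoot_def)
qed (simp add: V_def mean_overshoot_def)

lemma mean_overshoot_nonneg: "0 \<le> mean_overshoot n x"
  unfolding mean_overshoot_def by (intro sum_nonneg Kn_nonneg overshoot_nonneg)

lemma mean_overshoot_mono: "m \<le> n \<Longrightarrow> mean_overshoot m x \<le> mean_overshoot n x"
  unfolding mean_overshoot_def by (intro sum_mono2 Kn_nonneg overshoot_nonneg) auto

lemma V_mono: "m \<le> n \<Longrightarrow> V m x \<le> V n x"
  by (simp add: V_eq mean_overshoot_mono)

lemma V_ge: "x \<le> V n x"
  by (simp add: V_eq mean_overshoot_nonneg)

lemma mono_K:
  assumes "sq_growth f" "mono f" "\<And>z. 0 \<le> z \<Longrightarrow> 0 \<le> f z"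
  shows "mono (K f)"
proof (rule monoI)
  fix x x' :: real assume "x \<le> x'"
  moreover have "mono (\<lambda>z. indicator {0..} z * f z)"
    using assms(2,3) by (auto simp: mono_def indicator_def)
  ultimately show "K f x \<le> K f x'"
    unfolding K_def by (intro T_mono_arg sq_growth_indicator assms) auto
qed

lemma mono_Kn:
  assumes "sq_growth f" "mono f" "\<And>z. 0 \<le> z \<Longrightarrow> 0 \<le> f z"
  shows "mono (Kn n f)" "0 \<le> z \<Longrightarrow> 0 \<le> Kn n f z"
proof -
  have "mono (Kn n f) \<and> (\<forall>z\<ge>0. 0 \<le> Kn n f z)"
  proof (induction n)
    case (Suc n)
    then show ?case using mono_K[of "Kn n f"] assms(1) K_nonneg[of "Kn n f"] by auto
  qed (use assms in auto)
  then show "mono (Kn n f)" "0 \<le> z \<Longrightarrow> 0 \<le> Kn n f z" by auto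
qed

lemma surv_nonneg: "0 \<le> surv n x"
  unfolding surv_def by (rule Kn_nonneg) auto

lemma surv_mono: "x \<le> x' \<Longrightarrow> surv n x \<le> surv n x'"
  unfolding surv_def by (rule monoD[OF mono_Kn(1)]) (auto simp: mono_def)

lemma surv_0 [simp]: "surv 0 x = 1"
  by (simp add: surv_def)

lemma surv_Suc: "surv (Suc n) x = K (surv n) x"
  by (simp add: surv_def)

lemma surv_decreasing: "surv (Suc n) x \<le> surv n x"
proof -
  have "K (\<lambda>_. 1) z \<le> 1" for z using K_le_T[of "\<lambda>_. 1" z] by simp
  then show ?thesis
    unfolding surv_def funpow_Suc_right o_def by (intro Kn_mono sq_growth_K) auto
qed

lemma surv_antimono: "m \<le> n \<Longrightarrow> surv n x \<le> surv m x"
  by (rule lift_Suc_antimono_le[of "\<lambda>n. surv n x"]) (rule surv_decreasing)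

lemma surv_le_1: "surv n x \<le> 1"
  using surv_antimono[of 0 n x] by simp

lemma V_mono_arg: "x \<le> x' \<Longrightarrow> V n x \<le> V n x'"
  unfolding V_def by (rule monoD[OF mono_Kn(1)]) (auto simp: mono_def)

lemma Kn_const: "Kn n (\<lambda>_. c) x = c * surv n x"
  using Kn_cmult[of n c "\<lambda>_. 1" x] by (simp add: surv_def)

lemma Kn_le_const:
  assumes "sq_growth f" "\<And>z. f z \<le> c"
  shows "Kn n f x \<le> c * surv n x"
  unfolding Kn_const[symmetric] by (intro Kn_mono assms) auto

end

section \<open>A sublinear superharmonic function\<close>

lemma one_plus_powr_le:
  fixes b z :: real
  assumes "0 < b" "b < 1" "0 \<le> z"
  shows "(1 + z) powr b \<le> 1 + b * z"
proof (cases "z = 0")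
  case False
  with assms have z: "0 < z" by simp
  have "\<exists>t>0. t < z \<and> (1 + z) powr b - (1 + 0) powr b = (z - 0) * (b * (1 + t) powr (b - 1))"
    by (rule MVT2[OF z]) (auto intro!: derivative_eq_intros)
  then obtain t where t: "t > 0" "(1 + z) powr b = 1 + z * (b * (1 + t) powr (b - 1))" by auto
  have "(1 + t) powr (b - 1) \<le> (1 + t) powr 0"
    using t(1) assms by (intro powr_mono) auto
  then have "(1 + t) powr (b - 1) \<le> 1" using t(1) by simp
  then have "z * (b * (1 + t) powr (b - 1)) \<le> z * (b * 1)"
    using assms by (intro mult_left_mono) auto
  then show ?thesis using t by (simp add: mult.commute)
qed simp

text \<open>The strict concavity of the power function, quantified; the quadratic term is the drift that
  makes a power superharmonic.\<close>

lemma one_plus_powr_le_quadratic: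
  fixes b z :: real
  assumes "0 < b" "b < 1" "\<bar>z\<bar> \<le> 1 / 2"
  shows "(1 + z) powr b \<le> 1 + b * z - (2 / 9 * b * (1 - b)) * z\<^sup>2"
proof -
  define d where "d = (\<lambda>(m::nat) t. if m = 0 then (1 + t) powr b
    else if m = 1 then b * (1 + t) powr (b - 1) else b * (b - 1) * (1 + t) powr (b - 2))"
  have "\<exists>t. \<bar>t\<bar> \<le> \<bar>z\<bar> \<and> (1 + z) powr b = (\<Sum>m<2. d m 0 / fact m * z ^ m) + d 2 t / fact 2 * z ^ 2"
  proof (rule Maclaurin_bi_le)
    show "d 0 = (\<lambda>t. (1 + t) powr b)" by (simp add: d_def)
    show "\<forall>m t. m < 2 \<and> \<bar>t\<bar> \<le> \<bar>z\<bar> \<longrightarrow> DERIV (d m) t :> d (Suc m) t"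
      using assms(3)
      by (auto simp: d_def less_2_cases_iff intro!: derivative_eq_intros)
  qed
  then obtain t where t: "\<bar>t\<bar> \<le> \<bar>z\<bar>"
    "(1 + z) powr b = 1 + b * z + b * (b - 1) * (1 + t) powr (b - 2) / 2 * z\<^sup>2"
    by (auto simp: d_def eval_nat_numeral)
  have "(3 / 2) powr (-2) \<le> (3 / 2) powr (b - 2)"
    using assms by (intro powr_mono) auto
  also have "\<dots> \<le> (1 + t) powr (b - 2)"
    using t(1) assms by (intro powr_mono2') auto
  finally have "4 / 9 \<le> (1 + t) powr (b - 2)" by (simp add: powr_minus powr_numeral power2_eq_square)
  then have "(b * (1 - b) / 2 * z\<^sup>2) * (4 / 9) \<le> (b * (1 - b) / 2 * z\<^sup>2) * (1 + t) powr (b - 2)"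
    using assms by (intro mult_left_mono) auto
  moreover have "b * (b - 1) * (1 + t) powr (b - 2) / 2 * z\<^sup>2 = - ((b * (1 - b) / 2 * z\<^sup>2) * (1 + t) powr (b - 2))"
    by (simp add: field_simps)
  moreover have "2 / 9 * b * (1 - b) * z\<^sup>2 = (b * (1 - b) / 2 * z\<^sup>2) * (4 / 9)" by simp
  ultimately show ?thesis unfolding t(2) by linarith
qed

locale moment_law = step_law +
  fixes \<delta> :: real
  assumes delta: "0 < \<delta>" "\<delta> \<le> 1"
    and variance_one: "(\<integral>y. y\<^sup>2 \<partial>\<mu>) = 1"
    and moment: "integrable \<mu> (\<lambda>y. \<bar>y\<bar> powr (2 + \<delta>))"
begin

definition q :: real where "q = 1 + \<delta> / 4"

definition abs_moment :: real where "abs_moment = (\<integral>y. \<bar>y\<bar> powr (2 + \<delta>) \<partial>\<mu>)"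

text \<open>The linear term measures the overshoot itself, which enters the harmonic function; the power
  measures how far the killed tail is from being linear at the overshoot. One function controls
  both.\<close>

definition excess :: "real \<Rightarrow> real" where
  "excess z = (if z < 0 then - z + (- z) powr q else 0)"

lemma q_bounds: "1 < q" "q \<le> 2"
  using delta by (auto simp: q_def)

lemma abs_moment_nonneg: "0 \<le> abs_moment"
  unfolding abs_moment_def by simp

lemma excess_nonneg: "0 \<le> excess z"
proof (cases "z < 0")
  case True
  then have "0 \<le> - z + (- z) powr q" by (intro add_nonneg_nonneg) auto
  with True show ?thesis by (simp add: excess_def)
qed (simp add: excess_def)

lemma abs_le_one_plus_square: "\<bar>x\<bar> \<le> 1 + (x::real)\<^sup>2"
proof -
  have "0 \<le> (\<bar>x\<bar> - 1)\<^sup>2" by simp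
  then show ?thesis by (simp add: power2_diff)
qed

lemma powr_le_one_plus_square:
  assumes "0 \<le> (x::real)" "0 \<le> p" "p \<le> 2"
  shows "x powr p \<le> 1 + x\<^sup>2"
proof (cases "x \<le> 1")
  case True
  then have "x powr p \<le> 1" using assms by (intro powr_le1) auto
  then show ?thesis by (smt (verit) zero_le_power2)
next
  case False
  then have "x powr p \<le> x powr 2" using assms by (intro powr_mono) auto
  with False show ?thesis by (simp add: powr_numeral)
qed

lemma sq_growth_excess [intro, simp]: "sq_growth excess"
proof (rule sq_growthI[of _ 2])
  show "excess \<in> borel_measurable borel" unfolding excess_def by measurable
  fix x :: real
  show "\<bar>excess x\<bar> \<le> 2 * (1 + x\<^sup>2)"
    using abs_le_one_plus_square[of x] powr_le_one_plus_square[of "- x" q] q_bounds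
      excess_nonneg[of x]
    by (cases "x < 0") (simp_all add: excess_def)
qed

text \<open>The pointwise inequality behind the superharmonic function \<open>A * s powr b\<close>, with \<open>s\<close> the distance to
  a barrier placed \<open>R\<close> below \<open>0\<close>. A step of size at most \<open>s / 2\<close> profits from concavity; if it ends
  below \<open>0\<close>, the payment \<open>excess\<close> is bounded by a power of \<open>R\<close>, which the large factor \<open>A\<close> covers. A step
  of size above \<open>s / 2\<close> costs at most a power of its size, which is charged to the moment of
  order \<open>2 + \<delta>\<close>.\<close>

lemma excess_step_bound:
  fixes s y :: real
  assumes R: "2 \<le> R" "R \<le> s" and A: "1 \<le> A" "2 * R powr q \<le> A * (R / 2) powr b"
    and b: "0 < b" "b < 1" and c: "c = 2 / 9 * b * (1 - b)"
  shows "indicator {0..} (s - R + y) * (A * (s + y) powr b) + excess (s - R + y)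
    \<le> A * s powr b * (1 + b * (y / s) - c * (y / s)\<^sup>2) + 16 * A * s powr q * \<bar>y / s\<bar> powr (2 + \<delta>)"
    (is "?L \<le> A * s powr b * ?P + ?E")
proof -
  define r where "r = \<bar>y / s\<bar>"
  have s: "s > 0" using R by simp
  have c01: "0 \<le> c" "c \<le> 1"
  proof -
    have "b * (1 - b) \<le> 1 * 1" using b by (intro mult_mono) auto
    then show "c \<le> 1" "0 \<le> c" using b by (auto simp: c mult.assoc)
  qed
  have E0: "0 \<le> ?E" using A by simp
  have rpow: "r powr p \<le> 4 * r powr (2 + \<delta>)" if "1 / 2 \<le> r" "\<delta> \<le> p" "p \<le> 2 + \<delta>" for p
  proof -
    have "(1 / 2) powr 2 \<le> (1 / 2) powr (2 + \<delta> - p)"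
      using that by (intro powr_mono') auto
    also have "\<dots> \<le> r powr (2 + \<delta> - p)"
      using that by (intro powr_mono2) auto
    finally have "1 \<le> 4 * r powr (2 + \<delta> - p)" by (simp add: powr_numeral power2_eq_square)
    then have "r powr p * 1 \<le> r powr p * (4 * r powr (2 + \<delta> - p))"
      by (intro mult_left_mono) auto
    also have "\<dots> = 4 * r powr (2 + \<delta>)" by (simp add: powr_add[symmetric])
    finally show ?thesis by simp
  qed
  have sb: "s powr b \<le> s powr q" using R b q_bounds by (intro powr_mono) auto
  consider (near) "r \<le> 1 / 2" | (right) "1 / 2 < r" "0 < y" | (left) "1 / 2 < r" "y \<le> 0" by linarith
  then show ?thesis
  proof cases
    case near
    then have ys: "\<bar>y / s\<bar> \<le> 1 / 2" by (simp add: r_def)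
    then have y: "\<bar>y\<bar> \<le> s / 2" using s by (simp add: field_simps)
    have "?L \<le> A * (s + y) powr b"
    proof (cases "0 \<le> s - R + y")
      case False
      have le: "- (s - R + y) \<le> R" using y R by linarith
      have "(- (s - R + y)) powr q \<le> R powr q"
        using False q_bounds le by (intro powr_mono2) auto
      with le False have "excess (s - R + y) \<le> R + R powr q"
        by (simp add: excess_def)
      also have "R + R powr q \<le> R powr q + R powr q" using R q_bounds powr_mono[of 1 q R] by simp
      also have "\<dots> \<le> A * (R / 2) powr b" using A by simp
      also have "\<dots> \<le> A * (s + y) powr b"
        using R y A b by (intro mult_left_mono powr_mono2) auto
      finally show ?thesis using False by simp
    qed (simp add: excess_def)
    also have "A * (s + y) powr b = A * (s powr b * (1 + y / s) powr b)"
    proof -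
      have "s + y = s * (1 + y / s)" using s by (simp add: field_simps)
      then show ?thesis using s ys by (simp add: powr_mult abs_le_iff)
    qed
    also have "A * (s powr b * (1 + y / s) powr b) \<le> A * (s powr b * ?P)"
      unfolding c using A s by (intro mult_left_mono one_plus_powr_le_quadratic b ys) auto
    finally have "?L \<le> A * s powr b * ?P" by (simp only: mult.assoc)
    with E0 show ?thesis by linarith
  next
    case right
    then have ys: "y / s = r" "0 \<le> y / s" using s by (auto simp: r_def)
    have "?L = A * (s powr b * (1 + y / s) powr b)"
    proof -
      have "s + y = s * (1 + y / s)" using s by (simp add: field_simps)
      then have "(s + y) powr b = s powr b * (1 + y / s) powr b" using s ys by (simp add: powr_mult)
      then show ?thesis using right R by (simp add: excess_def)
    qed
    also have "\<dots> \<le> A * (s powr b * (1 + b * (y / s)))"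
      using A s by (intro mult_left_mono one_plus_powr_le b ys) auto
    also have "\<dots> = A * s powr b * ?P + A * (c * (s powr b * r powr 2))"
      using right(1) by (simp add: ys algebra_simps)
    also have "A * (c * (s powr b * r powr 2)) \<le> A * (1 * (s powr q * (4 * r powr (2 + \<delta>))))"
      using A c01 right sb delta by (intro mult_left_mono mult_mono rpow) auto
    also have "\<dots> \<le> ?E" using A by (simp add: r_def)
    finally show ?thesis by simp
  next
    case left
    then have ys: "y / s = - r" using s by (simp add: r_def field_simps)
    have y: "- y = s * r" "- y > s / 2" using ys left s by (auto simp: field_simps)
    have "?L \<le> A * s powr b + A * (2 * (- y) powr q)"
    proof (cases "0 \<le> s - R + y")
      case True
      have "(s + y) powr b \<le> s powr b" using left R b True by (intro powr_mono2) auto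
      then have "A * (s + y) powr b \<le> A * s powr b" using A by simp
      moreover have "0 \<le> A * (2 * (- y) powr q)" using A by simp
      ultimately show ?thesis using True by (simp add: excess_def)
    next
      case False
      have le: "- (s - R + y) \<le> - y" using R by simp
      have "(- (s - R + y)) powr q \<le> (- y) powr q"
        using False q_bounds le by (intro powr_mono2) auto
      with le False have "excess (s - R + y) \<le> - y + (- y) powr q"
        by (simp add: excess_def)
      also have "\<dots> \<le> (- y) powr q + (- y) powr q" using y(2) R q_bounds powr_mono[of 1 q "- y"] by simp
      finally have "excess (s - R + y) \<le> 1 * (2 * (- y) powr q)" by simp
      also have "\<dots> \<le> A * (2 * (- y) powr q)" using A by (intro mult_right_mono) auto
      finally show ?thesis using A False by (simp add: add_increasing)
    qed
    also have "(- y) powr q = s powr q * r powr q"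
      unfolding y(1) using s left by (simp add: powr_mult)
    also have "A * s powr b + A * (2 * (s powr q * r powr q))
        = A * s powr b * ?P + A * (s powr q * (2 * r powr q) + s powr b * (b * r powr 1) + s powr b * (c * r powr 2))"
      using left by (simp add: ys algebra_simps)
    also have "A * (s powr q * (2 * r powr q) + s powr b * (b * r powr 1) + s powr b * (c * r powr 2))
        \<le> A * (s powr q * (2 * (4 * r powr (2 + \<delta>))) + s powr q * (1 * (4 * r powr (2 + \<delta>))) + s powr q * (1 * (4 * r powr (2 + \<delta>))))"
      using A c01 b left sb delta q_bounds by (intro mult_left_mono add_mono mult_mono rpow) auto
    also have "\<dots> = ?E" by (simp add: r_def)
    finally show ?thesis by simp
  qed
qed

definition mean_excess :: "real \<Rightarrow> real" where "mean_excess = T excess"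

lemma sq_growth_mean_excess [intro, simp]: "sq_growth mean_excess"
  unfolding mean_excess_def by auto

lemma mean_excess_nonneg: "0 \<le> mean_excess x"
  unfolding mean_excess_def by (rule T_nonneg) (rule excess_nonneg)

lemma overshoot_le_mean_excess: "overshoot x \<le> mean_excess x"
  unfolding overshoot_def mean_excess_def
proof (intro T_mono)
  fix z :: real
  show "max 0 (- z) \<le> excess z"
    using powr_ge_zero[of "- z" q] by (auto simp: excess_def max_def)
qed auto

text \<open>A superharmonic function that pays for all future overshoots and is yet \<open>o(z)\<close>. Take
  \<open>s powr b\<close> with \<open>b = 1 - \<delta> / 2\<close>. Concavity gains order \<open>s\<close> to the power \<open>b - 2 = - 1 - \<delta> / 2\<close> in each
  step; the steps larger than \<open>s / 2\<close> lose order \<open>q - 2 - \<delta> = - 1 - 3 * \<delta> / 4\<close>. The gain wins once \<open>s\<close> is at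
  least some \<open>R\<close>, and shifting the barrier to \<open>- R\<close> guarantees this on the whole half-line.\<close>

lemma lyapunov_exists:
  obtains w where "sq_growth w" "\<And>z. 0 \<le> w z" "\<And>z. K w z + mean_excess z \<le> w z"
    "\<And>\<theta>. 0 < \<theta> \<Longrightarrow> \<exists>C\<ge>0. \<forall>z\<ge>0. w z \<le> \<theta> * z + C"
proof -
  define b where "b = 1 - \<delta> / 2"
  have b: "0 < b" "b < 1" using delta by (auto simp: b_def)
  define c where "c = 2 / 9 * b * (1 - b)"
  have c: "c > 0" using b by (simp add: c_def)
  \<comment> \<open>The threshold makes \<open>16 * abs_moment \<le> c * s powr (\<delta> / 4)\<close> for \<open>s \<ge> R\<close>.\<close>
  define R where "R = max 2 ((16 * abs_moment / c) powr (4 / \<delta>))"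
  have R: "2 \<le> R" by (simp add: R_def)
  define A where "A = max 1 (2 * R powr q / (R / 2) powr b)"
  have A1: "1 \<le> A" by (simp add: A_def)
  have A2: "2 * R powr q \<le> A * (R / 2) powr b"
  proof -
    have "2 * R powr q / (R / 2) powr b \<le> A" by (simp add: A_def)
    then show ?thesis using R by (simp add: pos_divide_le_eq)
  qed
  define w0 where "w0 z = A * (max 0 z + R) powr b" for z
  define w where "w z = (if 0 \<le> z then w0 z else K w0 z + mean_excess z)" for z
  have w0_nonneg: "0 \<le> w0 z" for z using A1 by (simp add: w0_def)
  have w0: "sq_growth w0"
  proof (rule sq_growthI[of _ "A * (1 + R\<^sup>2 * 2 + 2)"])
    show "w0 \<in> borel_measurable borel" unfolding w0_def by measurable
    fix z :: real
    have "(max 0 z + R) powr b \<le> 1 + (max 0 z + R)\<^sup>2"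
      using R b by (intro powr_le_one_plus_square) auto
    also have "\<dots> \<le> 1 + (2 * (max 0 z)\<^sup>2 + 2 * R\<^sup>2)" using square_sum_le[of "max 0 z" R] by simp
    also have "\<dots> \<le> (1 + R\<^sup>2 * 2 + 2) * (1 + z\<^sup>2)"
      by (simp add: algebra_simps max_def)
    finally have "A * (max 0 z + R) powr b \<le> A * ((1 + R\<^sup>2 * 2 + 2) * (1 + z\<^sup>2))"
      using A1 by (intro mult_left_mono) auto
    then show "\<bar>w0 z\<bar> \<le> A * (1 + R\<^sup>2 * 2 + 2) * (1 + z\<^sup>2)"
      using w0_nonneg[of z] by (simp add: w0_def mult.assoc)
  qed
  have w: "sq_growth w"
  proof (rule sq_growth_mono[of _ "\<lambda>z. w0 z + (K w0 z + mean_excess z)"])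
    have [measurable]: "w0 \<in> borel_measurable borel" "K w0 \<in> borel_measurable borel" "mean_excess \<in> borel_measurable borel"
      by (auto intro!: sq_growth_measurable w0)
    show "w \<in> borel_measurable borel" unfolding w_def by measurable
    show "sq_growth (\<lambda>z. w0 z + (K w0 z + mean_excess z))"
      by (intro sq_growth_add sq_growth_K w0) auto
    fix z show "\<bar>w z\<bar> \<le> \<bar>w0 z + (K w0 z + mean_excess z)\<bar>"
      using w0_nonneg[of z] K_nonneg[of w0 z] w0_nonneg mean_excess_nonneg[of z] by (auto simp: w_def)
  qed
  have Kw: "K w z = K w0 z" for z
    by (intro antisym K_mono w w0) (auto simp: w_def)
  have main: "K w0 x + mean_excess x \<le> w0 x" if x: "0 \<le> x" for x
  proof -
    define s where "s = x + R"
    have s: "R \<le> s" "s > 0" "s - R = x" using x R by (auto simp: s_def)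
    let ?B = "\<lambda>y. A * s powr b * (1 + b * (y / s) - c * (y / s)\<^sup>2) + 16 * A * s powr q * \<bar>y / s\<bar> powr (2 + \<delta>)"
    have B_eq: "?B = (\<lambda>y. A * s powr b + A * s powr b * (b / s) * y - A * s powr b * (c / s\<^sup>2) * y\<^sup>2
        + 16 * A * s powr q / s powr (2 + \<delta>) * \<bar>y\<bar> powr (2 + \<delta>))"
      using s by (auto simp: fun_eq_iff algebra_simps powr_divide power_divide)
    have intB: "integrable \<mu> ?B"
      unfolding B_eq using integrable_step integrable_step2 moment by auto
    have "K w0 x + mean_excess x = T (\<lambda>z. indicator {0..} z * w0 z + excess z) x"
      unfolding K_def mean_excess_def using w0 by (subst T_add) auto
    also have "\<dots> \<le> (\<integral>y. ?B y \<partial>\<mu>)"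
      unfolding T_def
    proof (rule integral_mono[OF _ intB])
      show "integrable \<mu> (\<lambda>y. indicator {0..} (x + y) * w0 (x + y) + excess (x + y))"
        by (intro integrable_shift[of "\<lambda>z. indicator {0..} z * w0 z + excess z"]
              sq_growth_add sq_growth_indicator w0 sq_growth_excess) auto
      fix y
      have "indicator {0..} (x + y) * w0 (x + y) = indicator {0..} (s - R + y) * (A * (s + y) powr b)"
        using s by (auto simp: w0_def indicator_def s_def add_ac)
      then show "indicator {0..} (x + y) * w0 (x + y) + excess (x + y) \<le> ?B y"
        using excess_step_bound[OF R s(1) A1 A2 b c_def, of y] unfolding s(3) by linarith
    qed
    also have "(\<integral>y. ?B y \<partial>\<mu>) = A * s powr b - A * s powr b * (c / s\<^sup>2)
        + 16 * A * s powr q / s powr (2 + \<delta>) * abs_moment"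
      unfolding B_eq abs_moment_def using integrable_step integrable_step2 moment
      by (simp add: mean_zero variance_one)
    also have "\<dots> \<le> A * s powr b"
    proof -
      have "16 * abs_moment / c = ((16 * abs_moment / c) powr (4 / \<delta>)) powr (\<delta> / 4)"
        using delta abs_moment_nonneg c by (simp add: powr_powr powr_one)
      also have "\<dots> \<le> s powr (\<delta> / 4)"
        using s(1) delta by (intro powr_mono2) (auto simp: R_def)
      finally have "16 * abs_moment \<le> c * s powr (\<delta> / 4)"
        using c by (simp add: pos_divide_le_eq mult.commute)
      then have "A * s powr (q - (2 + \<delta>)) * (16 * abs_moment) \<le> A * s powr (q - (2 + \<delta>)) * (c * s powr (\<delta> / 4))"
        using A1 by (intro mult_left_mono) auto
      also have "\<dots> = A * c * s powr (b - 2)"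
        using s by (simp add: powr_add[symmetric] q_def b_def algebra_simps)
      also have "\<dots> = A * s powr b * (c / s\<^sup>2)"
        using s by (simp add: powr_diff powr_numeral)
      finally show ?thesis using s by (simp add: powr_diff algebra_simps)
    qed
    finally show ?thesis using x by (simp add: w0_def s_def)
  qed
  show ?thesis
  proof (rule that[of w])
    show "sq_growth w" by (rule w)
    show "0 \<le> w z" for z
      using w0_nonneg[of z] K_nonneg[of w0 z] w0_nonneg mean_excess_nonneg[of z] by (auto simp: w_def)
    show "K w z + mean_excess z \<le> w z" for z
      using main[of z] by (auto simp: Kw w_def)
    fix \<theta> :: real assume th: "0 < \<theta>"
    \<comment> \<open>At \<open>t0\<close> the power \<open>A * t powr b\<close> meets the line \<open>\<theta> * t\<close>.\<close>
    define t0 where "t0 = (A / \<theta>) powr (1 / (1 - b))"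
    have t0: "0 < t0" "t0 powr (b - 1) = \<theta> / A"
    proof -
      have "A / \<theta> > 0" using A1 th by simp
      then show "0 < t0" using A1 th by (simp add: t0_def)
      have "1 / (1 - b) * (b - 1) = - 1" using b by (simp add: field_simps)
      then have "t0 powr (b - 1) = (A / \<theta>) powr (- 1)" by (simp add: t0_def powr_powr)
      then show "t0 powr (b - 1) = \<theta> / A" using A1 th by (simp add: powr_minus)
    qed
    have bound: "A * t powr b \<le> \<theta> * t + A * t0 powr b" if t: "t > 0" for t
    proof (cases "t0 \<le> t")
      case True
      have "t powr (b - 1) \<le> t0 powr (b - 1)" using True t0 b by (intro powr_mono2') auto
      then have "t powr (b - 1) * (A * t) \<le> \<theta> / A * (A * t)"
        unfolding t0 using A1 t by (intro mult_right_mono) auto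
      then have "A * t powr b \<le> \<theta> * t" using t A1 by (simp add: powr_diff mult.commute)
      then show ?thesis using A1 by (simp add: add_increasing2)
    next
      case False
      have "A * t powr b \<le> A * t0 powr b" using A1 t False b by (intro mult_left_mono powr_mono2) auto
      then show ?thesis using th t by (simp add: add_increasing)
    qed
    show "\<exists>C\<ge>0. \<forall>z\<ge>0. w z \<le> \<theta> * z + C"
    proof (intro exI[of _ "\<theta> * R + A * t0 powr b"] conjI allI impI)
      show "0 \<le> \<theta> * R + A * t0 powr b" using th R A1 by simp
      fix z :: real assume "0 \<le> z"
      then show "w z \<le> \<theta> * z + (\<theta> * R + A * t0 powr b)"
        using bound[of "z + R"] R by (simp add: w_def w0_def algebra_simps)
    qed
  qed
qed

definition lyap :: "real \<Rightarrow> real" where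
  "lyap = (SOME w. sq_growth w \<and> (\<forall>z. 0 \<le> w z) \<and> (\<forall>z. K w z + mean_excess z \<le> w z)
    \<and> (\<forall>\<theta>>0. \<exists>C\<ge>0. \<forall>z\<ge>0. w z \<le> \<theta> * z + C))"

lemma
  shows sq_growth_lyap [intro, simp]: "sq_growth lyap"
    and lyap_nonneg: "0 \<le> lyap z"
    and K_lyap: "K lyap z + mean_excess z \<le> lyap z"
    and lyap_sublinear: "0 < \<theta> \<Longrightarrow> \<exists>C\<ge>0. \<forall>z\<ge>0. lyap z \<le> \<theta> * z + C"
proof -
  have "\<exists>w. sq_growth w \<and> (\<forall>z. 0 \<le> w z) \<and> (\<forall>z. K w z + mean_excess z \<le> w z)
    \<and> (\<forall>\<theta>>0. \<exists>C\<ge>0. \<forall>z\<ge>0. w z \<le> \<theta> * z + C)"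
    by (rule lyapunov_exists) blast
  from someI_ex[OF this, folded lyap_def]
  show "sq_growth lyap" "0 \<le> lyap z" "K lyap z + mean_excess z \<le> lyap z"
    "0 < \<theta> \<Longrightarrow> \<exists>C\<ge>0. \<forall>z\<ge>0. lyap z \<le> \<theta> * z + C" by blast+
qed

text \<open>Iterating superharmonicity; the sum is the expected total payment up to time \<open>n\<close>.\<close>

lemma sum_mean_excess_le_lyap: "(\<Sum>k<n. Kn k mean_excess x) + Kn n lyap x \<le> lyap x"
proof (induction n)
  case (Suc n)
  have "Kn (Suc n) lyap x + Kn n mean_excess x = Kn n (\<lambda>z. K lyap z + mean_excess z) x"
    unfolding funpow_Suc_right o_def by (subst Kn_add) auto
  also have "\<dots> \<le> Kn n lyap x"
    by (intro Kn_mono) (auto intro: K_lyap)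
  finally show ?case using Suc by simp
qed simp

lemma sum_mean_excess_le: "(\<Sum>k<n. Kn k mean_excess x) \<le> lyap x"
  using sum_mean_excess_le_lyap[where n = n and x = x] Kn_nonneg[of lyap, OF lyap_nonneg, where n = n and x = x] by simp

lemma mean_overshoot_le_lyap: "mean_overshoot n x \<le> lyap x"
proof -
  have "mean_overshoot n x \<le> (\<Sum>k<n. Kn k mean_excess x)"
    unfolding mean_overshoot_def by (intro sum_mono Kn_mono) (auto intro: overshoot_le_mean_excess)
  also have "\<dots> \<le> lyap x" by (rule sum_mean_excess_le)
  finally show ?thesis .
qed

end

section \<open>Association, the Lindeberg step and the survival probability\<close>

text \<open>With \<open>m\<close> the mean of \<open>f\<close>, monotonicity provides a level \<open>g0\<close> such that \<open>f - m\<close> and \<open>g - g0\<close>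
  have the same sign everywhere.\<close>

lemma (in prob_space) chebyshev_association:
  fixes f g :: "real \<Rightarrow> real"
  assumes "mono f" "mono g" "integrable M (\<lambda>\<omega>. f (Y \<omega>))" "integrable M (\<lambda>\<omega>. g (Y \<omega>))"
    and "integrable M (\<lambda>\<omega>. f (Y \<omega>) * g (Y \<omega>))" and g: "\<And>y. 0 \<le> g y" "\<And>y. g y \<le> c"
  shows "expectation (\<lambda>\<omega>. f (Y \<omega>)) * expectation (\<lambda>\<omega>. g (Y \<omega>)) \<le> expectation (\<lambda>\<omega>. f (Y \<omega>) * g (Y \<omega>))"
proof -
  define m where "m = expectation (\<lambda>\<omega>. f (Y \<omega>))"
  define g0 where "g0 = (if \<exists>y. f y < m then (SUP y\<in>{y. f y < m}. g y) else 0)"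
  have bdd: "bdd_above (g ` {y. f y < m})" using g by (intro bdd_aboveI[of _ c]) auto
  have pos: "0 \<le> (f y - m) * (g y - g0)" for y
  proof (cases "f y < m")
    case True
    then have "g y \<le> g0" using bdd by (auto simp: g0_def intro: cSUP_upper)
    with True show ?thesis by (intro mult_nonpos_nonpos) auto
  next
    case False
    have "g0 \<le> g y"
    proof (cases "\<exists>y. f y < m")
      case ex: True
      have "g z \<le> g y" if "f z < m" for z
        using that False assms(1,2) by (meson le_cases monoD not_le order_trans)
      with ex show ?thesis by (auto simp: g0_def intro!: cSUP_least)
    qed (use g in \<open>simp add: g0_def\<close>)
    with False show ?thesis by simp
  qed
  have "0 \<le> expectation (\<lambda>\<omega>. (f (Y \<omega>) - m) * (g (Y \<omega>) - g0))"
    by (rule Bochner_Integration.integral_nonneg) (rule pos)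
  also have "\<dots> = expectation (\<lambda>\<omega>. f (Y \<omega>) * g (Y \<omega>) - g0 * f (Y \<omega>) - m * g (Y \<omega>) + m * g0)"
    by (simp add: algebra_simps)
  also have "\<dots> = expectation (\<lambda>\<omega>. f (Y \<omega>) * g (Y \<omega>)) - m * expectation (\<lambda>\<omega>. g (Y \<omega>))"
    using assms(3-5) by (simp add: m_def[symmetric] prob_space)
  finally show ?thesis by (simp add: m_def)
qed

context step_law
begin

abbreviation Tn :: "nat \<Rightarrow> (real \<Rightarrow> real) \<Rightarrow> real \<Rightarrow> real" where
  "Tn n f \<equiv> (T ^^ n) f"

lemma sq_growth_Tn [intro]: "sq_growth f \<Longrightarrow> sq_growth (Tn n f)"
  by (induction n) (simp_all add: sq_growth_T)

lemma Tn_mono: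
  assumes "sq_growth f" "sq_growth g" "\<And>z. f z \<le> g z"
  shows "Tn n f x \<le> Tn n g x"
  by (induction n arbitrary: x) (simp_all add: assms(3) T_mono sq_growth_Tn assms(1,2))

lemma Tn_affine:
  assumes "sq_growth f"
  shows "Tn n (\<lambda>z. c * f z - d) x = c * Tn n f x - d"
proof (induction n arbitrary: x)
  case (Suc n)
  have "Tn (Suc n) (\<lambda>z. c * f z - d) x = T (\<lambda>z. c * Tn n f z - d) x"
    by (simp add: Suc.IH[abs_def])
  also have "\<dots> = c * T (Tn n f) x - d"
    by (subst T_diff) (auto simp: T_cmult intro: sq_growth_Tn assms)
  finally show ?case by simp
qed simp

lemma mono_Tn: "sq_growth f \<Longrightarrow> mono f \<Longrightarrow> mono (Tn n f)"
  by (induction n) (auto intro!: monoI T_mono_arg sq_growth_Tn)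

lemma Kn_le_Tn:
  assumes "sq_growth f" "\<And>z. 0 \<le> f z"
  shows "Kn n f x \<le> Tn n f x"
proof (induction n arbitrary: x)
  case (Suc n)
  have "K (Kn n f) x \<le> T (Kn n f) x"
    using assms by (intro K_le_T Kn_nonneg sq_growth_Kn) auto
  also have "\<dots> \<le> T (Tn n f) x"
    using Suc.IH assms by (intro T_mono sq_growth_Kn sq_growth_Tn) auto
  finally show ?case by simp
qed simp

definition mean_pos_part :: "nat \<Rightarrow> real \<Rightarrow> real" where
  "mean_pos_part n = Tn n (\<lambda>z. max 0 z)"

lemma sq_growth_mean_pos_part [intro, simp]: "sq_growth (mean_pos_part n)"
  unfolding mean_pos_part_def by (intro sq_growth_Tn sq_growth_pos) auto

lemma mono_mean_pos_part: "mono (mean_pos_part n)"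
  unfolding mean_pos_part_def by (intro mono_Tn sq_growth_pos) (auto simp: mono_def)

lemma mean_pos_part_shift: "mean_pos_part n 0 - \<bar>x\<bar> \<le> mean_pos_part n x"
proof -
  have "mean_pos_part n y - \<bar>x\<bar> \<le> mean_pos_part n (y + x)" for y
  proof (induction n arbitrary: y)
    case (Suc n)
    have "mean_pos_part (Suc n) y - \<bar>x\<bar> = (\<integral>z. mean_pos_part n (y + z) - \<bar>x\<bar> \<partial>\<mu>)"
      by (simp add: mean_pos_part_def T_def[of "Tn n (max 0)"] prob_space
            integrable_shift sq_growth_mean_pos_part[unfolded mean_pos_part_def])
    also have "\<dots> \<le> (\<integral>z. mean_pos_part n ((y + x) + z) \<partial>\<mu>)"
      using Suc.IH[of "y + _"]
      by (intro integral_mono integrable_shift Bochner_Integration.integrable_diff sq_growth_mean_pos_part)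
        (auto simp: add_ac)
    also have "\<dots> = mean_pos_part (Suc n) (y + x)" by (simp add: mean_pos_part_def T_def)
    finally show ?case .
  qed (auto simp: mean_pos_part_def)
  from this[of 0] show ?thesis by simp
qed

text \<open>Survival and the positive part of the position are both increasing in the steps, hence
  positively correlated. The induction peels off the first step, so association is only used for
  functions of one variable.\<close>

lemma surv_le_V:
  assumes "0 \<le> x \<or> 0 < n"
  shows "mean_pos_part n x * surv n x \<le> V n x"
  using assms
proof (induction n arbitrary: x)
  case 0
  then show ?case by (simp add: mean_pos_part_def V_def)
next
  case (Suc n)
  let ?g = "\<lambda>z. indicator {0..} z * surv n z"
  have g: "sq_growth ?g" by (intro sq_growth_indicator) auto
  have mono_g: "mono ?g"
    using surv_mono surv_nonneg by (auto simp: mono_def indicator_def)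
  have fg: "sq_growth (\<lambda>z. mean_pos_part n z * ?g z)"
  proof (rule sq_growth_mono[of _ "mean_pos_part n"])
    show "(\<lambda>z. mean_pos_part n z * ?g z) \<in> borel_measurable borel"
      using sq_growth_measurable[OF g] sq_growth_measurable[OF sq_growth_mean_pos_part]
      by (rule borel_measurable_times[rotated])
    fix z
    have "\<bar>?g z\<bar> \<le> 1" using surv_nonneg[of n z] surv_le_1[of n z] by (simp add: indicator_def)
    then show "\<bar>mean_pos_part n z * ?g z\<bar> \<le> \<bar>mean_pos_part n z\<bar>"
      unfolding abs_mult by (rule mult_left_le) simp
  qed simp
  have "mean_pos_part (Suc n) x * surv (Suc n) x = T (mean_pos_part n) x * T ?g x"
    by (simp add: mean_pos_part_def surv_Suc K_def)
  also have "\<dots> \<le> T (\<lambda>z. mean_pos_part n z * ?g z) x"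
    unfolding T_def
  proof (rule chebyshev_association[where c = 1 and f = "mean_pos_part n" and g = ?g and Y = "\<lambda>y. x + y"])
    show "integrable \<mu> (\<lambda>y. mean_pos_part n (x + y) * ?g (x + y))"
      by (rule integrable_shift[OF fg])
    show "0 \<le> ?g y" "?g y \<le> 1" for y
      using surv_nonneg[of n y] surv_le_1[of n y] by (auto simp: indicator_def)
  qed (rule mono_g mono_mean_pos_part integrable_shift[OF g] integrable_shift[OF sq_growth_mean_pos_part])+
  also have "\<dots> \<le> T (\<lambda>z. indicator {0..} z * V n z) x"
    using Suc.IH by (intro T_mono fg sq_growth_indicator) (auto simp: indicator_def)
  also have "\<dots> = V (Suc n) x" by (simp add: V_def K_def)
  finally show ?case .
qed

end

context moment_law
begin

definition lindeberg_const :: "real \<Rightarrow> real" where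
  "lindeberg_const v0 = 2 / v0\<^sup>2 * (abs_moment + 1)"

definition lindeberg_rate :: "nat \<Rightarrow> real" where
  "lindeberg_rate n = real n powr (- 1 - \<delta> / 2)"

lemma lindeberg_const_nonneg: "0 \<le> lindeberg_const v0"
  using abs_moment_nonneg by (simp add: lindeberg_const_def)

lemma lindeberg_rate_tendsto: "(\<lambda>n. real n * lindeberg_rate n) \<longlonglongrightarrow> 0"
proof -
  have "(\<lambda>n. real n powr (- (\<delta> / 2))) \<longlonglongrightarrow> 0"
    using delta by (intro tendsto_neg_powr filterlim_real_sequentially) auto
  moreover have "\<forall>\<^sub>F n in sequentially. real n powr (- (\<delta> / 2)) = real n * lindeberg_rate n"
    using eventually_gt_at_top[of 0]
  proof eventually_elim
    case (elim n)
    have "real n * lindeberg_rate n = real n powr 1 * real n powr (- 1 - \<delta> / 2)"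
      using elim by (simp add: lindeberg_rate_def)
    then show ?case by (simp only: powr_add[symmetric]) simp
  qed
  ultimately show ?thesis by (rule Lim_transform_eventually)
qed

lemma sq_growth_heat [intro]: "sq_growth (\<lambda>z. heat ((z + b) / r) v)"
proof (rule sq_growth_bounded[of _ 1])
  have "mono Phi" by (auto simp: mono_def Phi_mono)
  then have [measurable]: "Phi \<in> borel_measurable borel" by (rule borel_measurable_mono)
  show "(\<lambda>z. heat ((z + b) / r) v) \<in> borel_measurable borel"
    unfolding heat_def by measurable
qed (use heat_01 in auto)

text \<open>Lindeberg's replacement of one step by a normal step of the same variance. The normal step is
  exact: it advances the heat flow by \<open>1 / n\<close>.\<close>

lemma heat_T_step:
  assumes v0: "0 < v0" "v0 \<le> 1" "v0 \<le> v" and n: "n > 0"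
  shows "\<bar>T (\<lambda>z. heat ((z + b) / sqrt n) v) x - heat ((x + b) / sqrt n) (v + 1 / n)\<bar>
    \<le> lindeberg_const v0 * lindeberg_rate n"
proof -
  define s where "s = (x + b) / sqrt n"
  have rn: "sqrt (real n) > 0" using n by simp
  have r2: "real n powr (- ((2 + \<delta>) / 2)) = lindeberg_rate n"
    by (simp add: lindeberg_rate_def add_divide_distrib)
  have sn: "sqrt (real n) powr (2 + \<delta>) * lindeberg_rate n = 1"
  proof -
    have "sqrt (real n) powr (2 + \<delta>) = real n powr ((2 + \<delta>) / 2)"
      using powr_powr[of "real n" "1 / 2" "2 + \<delta>"] by (simp add: powr_half_sqrt)
    then show ?thesis
      using n by (simp add: r2[symmetric] powr_add[symmetric] del: r2)
  qed
  define c1 where "c1 = heat1 s v / sqrt n"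
  define c2 where "c2 = heat2 s v / (2 * n)"
  define R where "R y = heat (s + y / sqrt n) v - heat s v - c1 * y - c2 * y\<^sup>2" for y
  have R_eq: "R y = heat (s + y / sqrt n) v - heat s v - y / sqrt n * heat1 s v - (y / sqrt n)\<^sup>2 / 2 * heat2 s v" for y
    using n by (simp add: R_def c1_def c2_def power_divide mult_ac)
  have int: "integrable \<mu> (\<lambda>y. heat (s + y / sqrt n) v)"
    using integrable_shift[OF sq_growth_heat[of b "sqrt n" v], of x]
    by (simp add: s_def add_divide_distrib add_ac)
  have intR: "integrable \<mu> R"
    unfolding R_def using int integrable_step integrable_step2 by auto
  have "(\<integral>y. R y \<partial>\<mu>) = (\<integral>y. heat (s + y / sqrt n) v \<partial>\<mu>) - heat s v - c2"
    unfolding R_def using int integrable_step integrable_step2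
    by (simp add: mean_zero variance_one)
  moreover have "T (\<lambda>z. heat ((z + b) / sqrt n) v) x = (\<integral>y. heat (s + y / sqrt n) v \<partial>\<mu>)"
    unfolding T_def s_def by (simp add: add_divide_distrib add_ac)
  ultimately have T_eq: "T (\<lambda>z. heat ((z + b) / sqrt n) v) x = (\<integral>y. R y \<partial>\<mu>) + heat s v + c2"
    by simp
  have R_le: "\<bar>R y\<bar> \<le> 2 / v0\<^sup>2 * lindeberg_rate n * \<bar>y\<bar> powr (2 + \<delta>)" for y
  proof -
    have "\<bar>R y\<bar> \<le> 2 / v0\<^sup>2 * \<bar>y / sqrt n\<bar> powr (2 + \<delta>)"
      unfolding R_eq using delta by (intro heat_taylor2 v0) auto
    also have "\<bar>y / sqrt n\<bar> powr (2 + \<delta>) = \<bar>y\<bar> powr (2 + \<delta>) / sqrt n powr (2 + \<delta>)"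
      using rn by (simp add: powr_divide)
    also have "\<dots> = \<bar>y\<bar> powr (2 + \<delta>) * lindeberg_rate n"
      using sn rn by (simp add: field_simps)
    finally show ?thesis by (simp add: mult_ac)
  qed
  have "\<bar>\<integral>y. R y \<partial>\<mu>\<bar> \<le> (\<integral>y. \<bar>R y\<bar> \<partial>\<mu>)"
    using integral_norm_bound[of \<mu> R] by simp
  also have "\<dots> \<le> (\<integral>y. 2 / v0\<^sup>2 * lindeberg_rate n * \<bar>y\<bar> powr (2 + \<delta>) \<partial>\<mu>)"
    using moment by (intro integral_mono R_le integrable_abs intR integrable_mult_right) auto
  also have "\<dots> = 2 / v0\<^sup>2 * lindeberg_rate n * abs_moment" by (simp add: abs_moment_def)
  finally have space: "\<bar>\<integral>y. R y \<partial>\<mu>\<bar> \<le> 2 / v0\<^sup>2 * lindeberg_rate n * abs_moment" .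
  have "\<bar>heat s (v + 1 / n) - heat s v - 1 / n / 2 * heat2 s v\<bar> \<le> 2 / v0\<^sup>2 * (1 / n)\<^sup>2"
    by (intro heat_time_step v0) auto
  also have "(1 / real n)\<^sup>2 = real n powr (- 2)"
    using n by (simp add: powr_minus powr_numeral power_one_over inverse_eq_divide)
  also have "2 / v0\<^sup>2 * real n powr (- 2) \<le> 2 / v0\<^sup>2 * lindeberg_rate n"
    unfolding lindeberg_rate_def using n delta by (intro mult_left_mono powr_mono) auto
  finally have time: "\<bar>heat s (v + 1 / n) - heat s v - c2\<bar> \<le> 2 / v0\<^sup>2 * lindeberg_rate n"
    by (simp add: c2_def)
  have "lindeberg_const v0 * lindeberg_rate n
      = 2 / v0\<^sup>2 * lindeberg_rate n * abs_moment + 2 / v0\<^sup>2 * lindeberg_rate n"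
    unfolding lindeberg_const_def by (simp only: distrib_left distrib_right mult_1_right) (simp add: mult_ac)
  then show ?thesis
    using space time unfolding T_eq s_def[symmetric] by linarith
qed

lemma heat_Tn:
  assumes v0: "0 < v0" "v0 \<le> 1" "v0 \<le> v" and n: "n > 0"
  shows "\<bar>Tn k (\<lambda>z. heat ((z + b) / sqrt n) v) x - heat ((x + b) / sqrt n) (v + k / n)\<bar>
    \<le> k * (lindeberg_const v0 * lindeberg_rate n)"
proof (induction k arbitrary: x)
  case (Suc k)
  let ?f = "\<lambda>z. heat ((z + b) / sqrt n) v" and ?g = "\<lambda>z. heat ((z + b) / sqrt n) (v + k / n)"
  let ?e = "lindeberg_const v0 * lindeberg_rate n"
  have "\<bar>T (Tn k ?f) x - T ?g x\<bar> = \<bar>T (\<lambda>z. Tn k ?f z - ?g z) x\<bar>"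
    by (subst T_diff) auto
  also have "\<dots> \<le> T (\<lambda>z. \<bar>Tn k ?f z - ?g z\<bar>) x" by (rule T_abs)
  also have "\<dots> \<le> T (\<lambda>z. k * ?e) x"
    using Suc.IH by (intro T_mono sq_growth_abs sq_growth_diff sq_growth_Tn sq_growth_heat) auto
  finally have "\<bar>T (Tn k ?f) x - T ?g x\<bar> \<le> k * ?e" by simp
  moreover have "\<bar>T ?g x - heat ((x + b) / sqrt n) (v + k / n + 1 / n)\<bar> \<le> ?e"
    using v0 by (intro heat_T_step n) (auto intro: add_increasing2)
  ultimately show ?case
    by (simp add: add_divide_distrib algebra_simps)
qed simp

text \<open>The positive part is at least \<open>sqrt n\<close> times a smoothed step function at \<open>2 * sqrt n\<close>, up to a small
  constant that corrects the smoothing; Lindeberg's method evaluates the mean of the former.\<close>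

lemma mean_pos_part_lower:
  obtains c N where "c > 0" "\<And>n. N \<le> n \<Longrightarrow> c * sqrt (real n) \<le> mean_pos_part n 0"
proof -
  define d where "d = Phi (- 2) - Phi (- 4)"
  have d: "d > 0" using Phi_strict_mono[of "- 4" "- 2"] by (simp add: d_def)
  let ?C = "lindeberg_const (1 / 16)"
  have "(\<lambda>n. ?C * (real n * lindeberg_rate n)) \<longlonglongrightarrow> ?C * 0"
    by (intro tendsto_mult lindeberg_rate_tendsto tendsto_const)
  then have "\<forall>\<^sub>F n in sequentially. ?C * (real n * lindeberg_rate n) < d / 2"
    using d by (intro order_tendstoD(2)) auto
  then obtain N where N: "\<And>n. N \<le> n \<Longrightarrow> ?C * (real n * lindeberg_rate n) < d / 2"
    by (auto simp: eventually_sequentially)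
  show ?thesis
  proof (rule that[of "d / 2" "max 1 N"])
    fix n assume n: "max 1 N \<le> n"
    then have rn: "sqrt (real n) > 0" and n0: "n > 0" by auto
    let ?f = "\<lambda>z. heat ((z + (- 2 * sqrt n)) / sqrt n) (1 / 16)"
    have le: "?f z * sqrt n - Phi (- 4) * sqrt n \<le> max 0 z" for z
    proof (cases "sqrt n \<le> z")
      case True
      have "?f z * sqrt n \<le> 1 * sqrt n" using heat_01 rn by (intro mult_right_mono) auto
      moreover have "0 \<le> Phi (- 4) * sqrt n" using Phi_bounds rn by (intro mult_nonneg_nonneg) auto
      ultimately show ?thesis using True by linarith
    next
      case False
      then have "(z + - 2 * sqrt n) / sqrt n \<le> - 1" using rn by (simp add: field_simps)
      then have "?f z \<le> heat (- 1) (1 / 16)" by (rule heat_mono) simp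
      also have "\<dots> = Phi (- 4)" by (simp add: heat_def real_sqrt_divide)
      finally have "?f z * sqrt n \<le> Phi (- 4) * sqrt n" using rn by (intro mult_right_mono) auto
      then show ?thesis by simp
    qed
    have h1: "Phi (- 2) \<le> heat (- 2) (1 / 16 + real n / real n)"
    proof -
      define r where "r = sqrt (1 / 16 + real n / real n)"
      have "1 \<le> 1 / 16 + real n / real n" using n0 by simp
      then have r: "1 \<le> r" unfolding r_def by (simp only: real_sqrt_ge_1_iff)
      then have "2 / r \<le> 2 / 1" by (intro divide_left_mono) auto
      then have "- 2 \<le> - 2 / r" by linarith
      then show ?thesis unfolding heat_def r_def by (rule Phi_mono)
    qed
    have "(0 + (- 2 * sqrt n)) / sqrt n = - 2" using rn by simp
    then have h2: "\<bar>Tn n ?f 0 - heat (- 2) (1 / 16 + real n / real n)\<bar> \<le> n * (?C * lindeberg_rate n)"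
      using heat_Tn[of "1 / 16" "1 / 16" n n "- 2 * sqrt n" 0] n0 by (simp only:)
    have h3: "n * (?C * lindeberg_rate n) < d / 2" using N[of n] n by (simp add: mult.left_commute)
    have "d / 2 \<le> Tn n ?f 0 - Phi (- 4)" 
    proof -
      have "(r - s) / 2 \<le> t - s" if "r \<le> h" "\<bar>t - h\<bar> \<le> e" "e < (r - s) / 2" for r s t h e :: real
      proof -
        have "h - t \<le> e" using that(2) by linarith
        then have "r - t < (r - s) / 2" using that(1,3) by linarith
        then show ?thesis by (simp add: field_simps)
      qed
      from this[OF h1 h2 h3[unfolded d_def]] show ?thesis unfolding d_def .
    qed
    then have "d / 2 * sqrt n \<le> Tn n ?f 0 * sqrt n - Phi (- 4) * sqrt n"
      using mult_right_mono[of "d / 2" "Tn n ?f 0 - Phi (- 4)" "sqrt n"] rn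
      unfolding left_diff_distrib by simp
    also have "\<dots> = Tn n (\<lambda>z. ?f z * sqrt n - Phi (- 4) * sqrt n) 0"
      using Tn_affine[OF sq_growth_heat, of n "sqrt n" "- 2 * sqrt n" "sqrt n" "1 / 16" "Phi (- 4) * sqrt n" 0]
      by (simp only: mult.commute)
    also have "\<dots> \<le> mean_pos_part n 0"
      unfolding mean_pos_part_def
    proof (rule Tn_mono)
      have "sq_growth (\<lambda>z. sqrt n * ?f z - Phi (- 4) * sqrt n)"
        by (intro sq_growth_diff sq_growth_cmult sq_growth_heat sq_growth_const)
      then show "sq_growth (\<lambda>z. ?f z * sqrt n - Phi (- 4) * sqrt n)" by (simp only: mult.commute)
      show "sq_growth (\<lambda>z. max 0 z)" by (intro sq_growth_pos sq_growth_ident)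
    qed (rule le)
    finally show "d / 2 * sqrt n \<le> mean_pos_part n 0" .
  qed (use d in auto)
qed

lemma overshoot_0_pos: "0 < overshoot 0"
proof (rule ccontr)
  assume "\<not> 0 < overshoot 0"
  then have zero: "overshoot 0 = 0" using overshoot_nonneg[of 0] by simp
  have int: "integrable \<mu> (\<lambda>y. max 0 (- y))"
    using integrable_shift[OF sq_growth_neg_part, of 0] by simp
  have "AE y in \<mu>. max 0 (- y) = 0"
    using zero integral_nonneg_eq_0_iff_AE[OF int] by (simp add: overshoot_def T_def)
  then have ge: "AE y in \<mu>. 0 \<le> y" by eventually_elim (auto simp: max_def split: if_splits)
  then have "AE y in \<mu>. y = 0"
    using integral_nonneg_eq_0_iff_AE[OF integrable_step] mean_zero by simp
  then have "(\<integral>y. y\<^sup>2 \<partial>\<mu>) = 0" by (intro integral_eq_zero_AE) auto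
  then show False using variance_one by simp
qed

end

text \<open>Starting points are bounded below by an \<open>a\<close> from which the walk can survive its first step. This
  is what keeps the harmonic function away from \<open>0\<close>, uniformly on \<open>[a, \<infinity>)\<close>.\<close>

locale started_law = moment_law +
  fixes a :: real
  assumes start: "0 < prob {y. 0 \<le> a + y}"
begin

text \<open>Two steps are needed: \<open>V 1 a\<close> vanishes if the only surviving first step leads exactly to \<open>0\<close>. From
  there on the second step has a nontrivial positive part.\<close>

lemma V2_pos: "0 < V 2 a"
proof -
  have V1: "0 < V 1 0" using overshoot_0_pos by (simp add: V_def K_ident)
  have "0 < V 1 0 * prob {y. 0 \<le> a + y}" using V1 start by simp
  also have "\<dots> = K (\<lambda>_. V 1 0) a"
  proof -
    have [measurable]: "{y. 0 \<le> a + y} \<in> sets borel" by measurable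
    have "K (\<lambda>_. V 1 0) a = (\<integral>y. V 1 0 * indicator {y. 0 \<le> a + y} y \<partial>\<mu>)"
      unfolding K_def T_def by (intro Bochner_Integration.integral_cong) (auto simp: indicator_def)
    then show ?thesis by simp
  qed
  also have "\<dots> \<le> K (V 1) a" by (intro K_mono V_mono_arg) auto
  also have "\<dots> = V 2 a" by (simp add: V_def numeral_2_eq_2)
  finally show ?thesis .
qed

lemma V_lower: "a \<le> x \<Longrightarrow> 2 \<le> n \<Longrightarrow> V 2 a \<le> V n x"
  using V_mono_arg[of a x 2] V_mono[of 2 n x] by linarith

lemma V_pos: "a \<le> x \<Longrightarrow> 2 \<le> n \<Longrightarrow> 0 < V n x"
  using V_lower[of x n] V2_pos by linarith

lemma const_le_V:
  assumes "0 \<le> c" "a \<le> x" "2 \<le> n"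
  shows "c \<le> c / V 2 a * V n x"
proof -
  have "c / V 2 a * V 2 a \<le> c / V 2 a * V n x"
    using assms V2_pos V_lower by (intro mult_left_mono) auto
  then show ?thesis using V2_pos by simp
qed

definition start_const :: real where "start_const = 1 + \<bar>a\<bar> / V 2 a"

lemma start_const_ge_1: "1 \<le> start_const"
  using V2_pos by (simp add: start_const_def)

lemma abs_le_V:
  assumes "a \<le> x" "2 \<le> n"
  shows "\<bar>x\<bar> \<le> start_const * V n x"
proof -
  have "\<bar>x\<bar> \<le> V n x + \<bar>a\<bar>" using V_ge[of x n] V_pos[OF assms] assms by auto
  also have "\<dots> \<le> V n x + \<bar>a\<bar> / V 2 a * V n x"
    using const_le_V[OF _ assms, of "\<bar>a\<bar>"] by simp
  finally show ?thesis by (simp add: start_const_def algebra_simps)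
qed

lemma mean_overshoot_le_V:
  assumes "a \<le> x" "2 \<le> n"
  shows "mean_overshoot n x \<le> 2 * start_const * V n x"
proof -
  have "mean_overshoot n x \<le> V n x + \<bar>x\<bar>" by (simp add: V_eq)
  also have "\<dots> \<le> start_const * V n x + start_const * V n x"
    using abs_le_V[OF assms] start_const_ge_1 V_pos[OF assms] by (intro add_mono) auto
  finally show ?thesis by simp
qed

text \<open>Below \<open>0\<close> only the compact part \<open>[a, 0]\<close> is visited, where any bound will do.\<close>

lemma lyap_sublinear_start:
  assumes "0 < \<theta>"
  obtains C where "0 \<le> C" "\<And>z. a \<le> z \<Longrightarrow> lyap z \<le> \<theta> * \<bar>z\<bar> + C"
proof -
  obtain C1 where C1: "C1 \<ge> 0" "\<And>z. 0 \<le> z \<Longrightarrow> lyap z \<le> \<theta> * z + C1"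
    using lyap_sublinear[OF assms] by blast
  obtain C2 where C2: "C2 \<ge> 0" "\<And>z. \<bar>lyap z\<bar> \<le> C2 * (1 + z\<^sup>2)"
    using sq_growth_lyap by (rule sq_growthE) blast
  show ?thesis
  proof (rule that[of "C1 + C2 * (1 + a\<^sup>2)"])
    fix z assume z: "a \<le> z"
    show "lyap z \<le> \<theta> * \<bar>z\<bar> + (C1 + C2 * (1 + a\<^sup>2))"
    proof (cases "0 \<le> z")
      case True
      moreover have "0 \<le> C2 * (1 + a\<^sup>2)" using C2(1) by simp
      ultimately show ?thesis using C1(2)[of z] by simp
    next
      case False
      have "z\<^sup>2 \<le> a\<^sup>2" using z False by (simp add: abs_le_square_iff[symmetric])
      have "lyap z \<le> C2 * (1 + z\<^sup>2)" using C2(2)[of z] by simp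
      also have "\<dots> \<le> C2 * (1 + a\<^sup>2)" using C2(1) \<open>z\<^sup>2 \<le> a\<^sup>2\<close> by (intro mult_left_mono) auto
      also have "\<dots> \<le> \<theta> * \<bar>z\<bar> + (C1 + C2 * (1 + a\<^sup>2))" using assms C1(1) by simp
      finally show ?thesis .
    qed
  qed (use C1 C2 in simp)
qed

lemma lyap_le_V:
  obtains C where "0 \<le> C" "\<And>x n. a \<le> x \<Longrightarrow> 2 \<le> n \<Longrightarrow> lyap x \<le> C * V n x"
proof -
  obtain C where C: "0 \<le> C" "\<And>z. a \<le> z \<Longrightarrow> lyap z \<le> 1 * \<bar>z\<bar> + C"
    using lyap_sublinear_start[of 1] by auto
  show ?thesis
  proof (rule that[of "start_const + C / V 2 a"])
    fix x :: real and n :: nat assume xn: "a \<le> x" "2 \<le> n"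
    have "lyap x \<le> \<bar>x\<bar> + C" using C(2)[OF xn(1)] by simp
    also have "\<dots> \<le> start_const * V n x + C / V 2 a * V n x"
      by (intro add_mono abs_le_V const_le_V xn C)
    finally show "lyap x \<le> (start_const + C / V 2 a) * V n x" by (simp add: algebra_simps)
  qed (use C start_const_ge_1 V2_pos in auto)
qed

text \<open>For large \<open>j\<close> this is association, as the mean positive part has order \<open>sqrt j\<close>; for the finitely
  many remaining \<open>j\<close> the positive lower bound of \<open>V\<close> suffices.\<close>

lemma surv_bound:
  obtains C where "0 \<le> C"
    "\<And>x j n. a \<le> x \<Longrightarrow> 2 \<le> n \<Longrightarrow> j \<le> n \<Longrightarrow> surv j x \<le> C * V n x / sqrt (real (Suc j))"
proof -
  obtain c N where c: "c > 0" "\<And>n. N \<le> n \<Longrightarrow> c * sqrt (real n) \<le> mean_pos_part n 0"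
    by (rule mean_pos_part_lower) blast
  \<comment> \<open>From \<open>N1\<close> on, the loss \<open>\<bar>a\<bar>\<close> through the starting point is at most half of \<open>c * sqrt j\<close>.\<close>
  define N1 where "N1 = max (max 1 N) (nat \<lceil>(2 * \<bar>a\<bar> / c)\<^sup>2\<rceil>)"
  define C where "C = max (4 / c) (sqrt (real (Suc N1)) / V 2 a)"
  have C: "0 \<le> C" "4 / c \<le> C" "sqrt (real (Suc N1)) / V 2 a \<le> C" using c by (auto simp: C_def le_max_iff_disj)
  show ?thesis
  proof (rule that[of C])
    fix x :: real and j n :: nat assume xn: "a \<le> x" "2 \<le> n" "j \<le> n"
    note Vp = V_pos[OF xn(1,2)]
    show "surv j x \<le> C * V n x / sqrt (real (Suc j))"
    proof (cases "N1 \<le> j")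
      case True
      have j: "j > 0" "N \<le> j" using True by (auto simp: N1_def)
      have "(2 * \<bar>a\<bar> / c)\<^sup>2 \<le> real N1" unfolding N1_def by linarith
      also have "\<dots> \<le> real j" using True by simp
      finally have "2 * \<bar>a\<bar> / c \<le> sqrt j" by (rule real_le_rsqrt)
      then have "\<bar>a\<bar> \<le> c * sqrt j / 2" using c by (simp add: field_simps)
      moreover have "mean_pos_part j a \<le> mean_pos_part j x" by (rule monoD[OF mono_mean_pos_part xn(1)])
      ultimately have "c / 2 * sqrt j \<le> mean_pos_part j x"
        using c(2)[OF j(2)] mean_pos_part_shift[of j a] by linarith
      then have "c / 2 * sqrt j * surv j x \<le> mean_pos_part j x * surv j x"
        by (intro mult_right_mono surv_nonneg)
      also have "\<dots> \<le> V j x" using j by (intro surv_le_V) auto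
      also have "\<dots> \<le> V n x" using xn by (intro V_mono)
      finally have le: "surv j x \<le> 2 / c * V n x / sqrt j" using c j by (simp add: field_simps)
      have "sqrt (real (Suc j)) \<le> sqrt (4 * real j)" using j by (intro real_sqrt_le_mono) auto
      then have "sqrt (real (Suc j)) \<le> 2 * sqrt j" by (simp add: real_sqrt_mult)
      then have "1 / sqrt j \<le> 2 / sqrt (real (Suc j))" using j by (simp add: field_simps)
      then have "2 / c * V n x * (1 / sqrt j) \<le> 2 / c * V n x * (2 / sqrt (real (Suc j)))"
        using c Vp by (intro mult_left_mono) auto
      also have "\<dots> = 4 / c * (V n x / sqrt (real (Suc j)))" by simp
      also have "\<dots> \<le> C * (V n x / sqrt (real (Suc j)))"
        using C Vp by (intro mult_right_mono) auto
      finally show ?thesis using le by simp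
    next
      case False
      have "surv j x \<le> 1" by (rule surv_le_1)
      also have "1 = sqrt (real (Suc j)) / sqrt (real (Suc j))" by simp
      also have "\<dots> \<le> (sqrt (real (Suc N1)) / V 2 a * V n x) / sqrt (real (Suc j))"
      proof (rule divide_right_mono)
        have "sqrt (real (Suc j)) \<le> sqrt (real (Suc N1))" using False by simp
        also have "\<dots> \<le> sqrt (real (Suc N1)) / V 2 a * V n x"
          by (intro const_le_V xn) simp
        finally show "sqrt (real (Suc j)) \<le> sqrt (real (Suc N1)) / V 2 a * V n x" .
      qed simp
      also have "\<dots> \<le> C * V n x / sqrt (real (Suc j))"
        using C Vp by (intro divide_right_mono mult_right_mono) auto
      finally show ?thesis .
    qed
  qed (rule C)
qed

end

section \<open>Lindeberg replacement for the killed walk\<close>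

lemma sum_inverse_sqrt_le: "(\<Sum>j<n. 1 / sqrt (real (Suc j))) \<le> 2 * sqrt (real n)"
proof (induction n)
  case (Suc n)
  define r t where "r = sqrt (real n)" and "t = sqrt (real (Suc n))"
  have t: "t > 0" "r \<ge> 0" "r \<le> t" "t * t - r * r = 1" by (auto simp: r_def t_def)
  have "1 = (t - r) * (t + r)" using t(4) by (simp add: algebra_simps)
  also have "\<dots> \<le> (t - r) * (2 * t)" using t by (intro mult_left_mono) auto
  finally have "1 / t \<le> 2 * (t - r)" using t by (simp add: field_simps)
  then show ?case using Suc by (simp add: r_def t_def)
qed simp

context moment_law
begin

text \<open>The killed tail at diffusive scale after \<open>j\<close> of \<open>n\<close> steps, started from a tail smoothed with
  variance \<open>v\<close>.\<close>

definition killed_kernel :: "real \<Rightarrow> nat \<Rightarrow> real \<Rightarrow> nat \<Rightarrow> real \<Rightarrow> real" where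
  "killed_kernel u n v j z = killed_tail u (z / sqrt n) (v + j / n)"

lemma kernel_eq_heat:
  assumes "n > 0"
  shows "killed_kernel u n v j = (\<lambda>z. heat ((z + u * sqrt n) / sqrt n) (v + j / n) + heat ((z + (- u * sqrt n)) / sqrt n) (v + j / n) - 1)"
  using assms by (simp add: killed_kernel_def killed_tail_def add_divide_distrib diff_divide_distrib fun_eq_iff)

lemma sq_growth_kernel [intro]:
  assumes "n > 0"
  shows "sq_growth (killed_kernel u n v j)"
  unfolding kernel_eq_heat[OF assms] by (intro sq_growth_diff sq_growth_add sq_growth_heat) auto

lemma kernel_minus: "killed_kernel u n v j (- z) = - killed_kernel u n v j z"
  by (simp add: killed_kernel_def killed_tail_minus)

lemma abs_kernel_le: "\<bar>killed_kernel u n v j z\<bar> \<le> 1"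
  by (simp add: killed_kernel_def abs_killed_tail_le)

lemma kernel_T_step:
  assumes v: "0 < v" "v \<le> 1" and n: "n > 0"
  shows "\<bar>T (killed_kernel u n v j) z - killed_kernel u n v (Suc j) z\<bar> \<le> 2 * (lindeberg_const v * lindeberg_rate n)"
proof -
  let ?f = "\<lambda>b z. heat ((z + b) / sqrt n) (v + j / n)"
  let ?g = "\<lambda>b z. heat ((z + b) / sqrt n) (v + j / n + 1 / n)"
  have st: "\<bar>T (?f b) z - ?g b z\<bar> \<le> lindeberg_const v * lindeberg_rate n" for b
    using v by (intro heat_T_step n) auto
  have "T (killed_kernel u n v j) z = T (?f (u * sqrt n)) z + T (?f (- u * sqrt n)) z - 1"
    unfolding kernel_eq_heat[OF n]
    by (subst T_diff T_add; (intro sq_growth_add sq_growth_heat sq_growth_const)?)+ simp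
  moreover have "killed_kernel u n v (Suc j) z = ?g (u * sqrt n) z + ?g (- u * sqrt n) z - 1"
    unfolding kernel_eq_heat[OF n] by (simp add: add_divide_distrib add_ac)
  ultimately show ?thesis
    using st[of "u * sqrt n"] st[of "- u * sqrt n"] by linarith
qed

text \<open>The mass that steps below \<open>0\<close>, evaluated at the mirror image of the point reached.\<close>

definition reflected :: "(real \<Rightarrow> real) \<Rightarrow> real \<Rightarrow> real" where
  "reflected f = T (\<lambda>y. indicator {..<0} y * f (- y))"

lemma sq_growth_reflect:
  assumes "sq_growth f"
  shows "sq_growth (\<lambda>y. indicator {..<0} y * f (- y))"
proof -
  obtain C where C: "\<And>x. \<bar>f x\<bar> \<le> C * (1 + x\<^sup>2)" using assms by (rule sq_growthE) blast
  have [measurable]: "f \<in> borel_measurable borel" using assms by (rule sq_growth_measurable)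
  have "sq_growth (\<lambda>y. f (- y))"
    using C[of "- _"] by (intro sq_growthI[of _ C]) auto
  then show ?thesis by (intro sq_growth_indicator) auto
qed

text \<open>For an odd function, discarding the mass below \<open>0\<close> is the same as adding its mirror image.\<close>

lemma kernel_K_step:
  assumes n: "n > 0"
  shows "K (killed_kernel u n v j) z = T (killed_kernel u n v j) z + reflected (killed_kernel u n v j) z"
proof -
  have "K (killed_kernel u n v j) z = T (\<lambda>y. killed_kernel u n v j y + indicator {..<0} y * killed_kernel u n v j (- y)) z"
    unfolding K_def
    by (rule arg_cong[where f = "\<lambda>f. T f z"]) (auto simp: indicator_def kernel_minus)
  then show ?thesis
    unfolding reflected_def using n by (simp add: T_add sq_growth_reflect sq_growth_kernel)
qed

text \<open>The kernel is nearly linear at the overshoot, and its slope at step \<open>j\<close> is nearly the final slope.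
  So the reflected mass is the mean overshoot times a constant that depends neither on \<open>j\<close> nor
  on \<open>z\<close>.\<close>

lemma reflected_kernel_near:
  assumes v: "0 < v" "v \<le> 1" and n: "n > 0" and j: "j \<le> n"
  shows "\<bar>reflected (killed_kernel u n v j) z - killed_slope u (v + 1) / sqrt n * overshoot z\<bar>
    \<le> (8 / v\<^sup>2 * real n powr (- q / 2) + 2 / v\<^sup>2 / sqrt n * (1 - j / n)) * mean_excess z"
proof -
  let ?d = "killed_slope u (v + 1) / sqrt n"
  let ?c = "8 / v\<^sup>2 * real n powr (- q / 2) + 2 / v\<^sup>2 / sqrt n * (1 - j / n)"
  let ?r = "\<lambda>y. indicator {..<0} y * killed_kernel u n v j (- y)"
  have rn: "sqrt (real n) > 0" using n by simp
  have jn: "0 \<le> 1 - j / n" using j n by simp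
  have r: "sq_growth ?r" by (intro sq_growth_reflect sq_growth_kernel n)
  have p: "sq_growth (\<lambda>y. ?d * max 0 (- y))" by (rule sq_growth_cmult) simp
  have pw: "\<bar>?r y - ?d * max 0 (- y)\<bar> \<le> ?c * excess y" for y
  proof (cases "y < 0")
    case True
    define Z where "Z = - y"
    have Z: "Z > 0" using True by (simp add: Z_def)
    have e: "Z \<le> excess y" "Z powr q \<le> excess y" using True by (auto simp: excess_def Z_def)
    have "\<bar>killed_kernel u n v j Z - Z / sqrt n * killed_slope u (v + j / n)\<bar> \<le> 8 / v\<^sup>2 * \<bar>Z / sqrt n\<bar> powr q"
      unfolding killed_kernel_def using v q_bounds by (intro killed_tail_linear_error_powr) auto
    also have "\<bar>Z / sqrt n\<bar> powr q = real n powr (- q / 2) * Z powr q"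
    proof -
      have "sqrt (real n) powr q = real n powr (q / 2)"
        using powr_powr[of "real n" "1 / 2" q] by (simp add: powr_half_sqrt)
      then show ?thesis using rn Z by (simp add: powr_divide powr_minus field_simps)
    qed
    also have "8 / v\<^sup>2 * (real n powr (- q / 2) * Z powr q) \<le> 8 / v\<^sup>2 * (real n powr (- q / 2) * excess y)"
      using e by (intro mult_left_mono) auto
    finally have 1: "\<bar>killed_kernel u n v j Z - Z / sqrt n * killed_slope u (v + j / n)\<bar>
        \<le> 8 / v\<^sup>2 * (real n powr (- q / 2) * excess y)" .
    have "\<bar>Z / sqrt n * killed_slope u (v + j / n) - ?d * Z\<bar>
        = Z / sqrt n * \<bar>killed_slope u (v + j / n) - killed_slope u (v + 1)\<bar>"
    proof -
      have "Z / sqrt n * killed_slope u (v + j / n) - ?d * Z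
          = Z / sqrt n * (killed_slope u (v + j / n) - killed_slope u (v + 1))"
        by (simp add: algebra_simps)
      then show ?thesis using Z rn by (simp add: abs_mult)
    qed
    also have "\<dots> \<le> Z / sqrt n * (2 / v\<^sup>2 * \<bar>(v + j / n) - (v + 1)\<bar>)"
      using Z v by (intro mult_left_mono killed_slope_time) auto
    also have "\<dots> = 2 / v\<^sup>2 / sqrt n * (1 - j / n) * Z"
    proof -
      have "\<bar>(v + j / n) - (v + 1)\<bar> = 1 - j / n" using jn by linarith
      then show ?thesis by (simp only:) (simp add: mult_ac)
    qed
    also have "\<dots> \<le> 2 / v\<^sup>2 / sqrt n * (1 - j / n) * excess y"
      using e jn by (intro mult_left_mono) auto
    finally have 2: "\<bar>Z / sqrt n * killed_slope u (v + j / n) - ?d * Z\<bar> \<le> 2 / v\<^sup>2 / sqrt n * (1 - j / n) * excess y" .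
    have "\<bar>?r y - ?d * max 0 (- y)\<bar> = \<bar>killed_kernel u n v j Z - ?d * Z\<bar>"
      using True by (simp add: Z_def)
    also have "\<dots> \<le> \<bar>killed_kernel u n v j Z - Z / sqrt n * killed_slope u (v + j / n)\<bar>
        + \<bar>Z / sqrt n * killed_slope u (v + j / n) - ?d * Z\<bar>"
      using abs_triangle_ineq[of "killed_kernel u n v j Z - Z / sqrt n * killed_slope u (v + j / n)"
          "Z / sqrt n * killed_slope u (v + j / n) - ?d * Z"] by simp
    also have "\<dots> \<le> 8 / v\<^sup>2 * (real n powr (- q / 2) * excess y) + 2 / v\<^sup>2 / sqrt n * (1 - j / n) * excess y"
      by (intro add_mono 1 2)
    also have "\<dots> = ?c * excess y" by (simp only: distrib_right mult.assoc)
    finally show ?thesis .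
  next
    case False
    then show ?thesis by (simp add: excess_def)
  qed
  have "T (\<lambda>y. ?r y - ?d * max 0 (- y)) z = reflected (killed_kernel u n v j) z - ?d * overshoot z"
    unfolding reflected_def overshoot_def by (simp only: T_diff[OF r p] T_cmult)
  then have "\<bar>reflected (killed_kernel u n v j) z - ?d * overshoot z\<bar> \<le> T (\<lambda>y. \<bar>?r y - ?d * max 0 (- y)\<bar>) z"
    using T_abs[of "\<lambda>y. ?r y - ?d * max 0 (- y)" z] by (simp only:)
  also have "\<dots> \<le> T (\<lambda>y. ?c * excess y) z"
    by (rule T_mono[OF sq_growth_abs[OF sq_growth_diff[OF r p]] sq_growth_cmult[OF sq_growth_excess] pw])
  also have "\<dots> = ?c * mean_excess z" unfolding mean_excess_def by (rule T_cmult)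
  finally show ?thesis .
qed

text \<open>A cruder bound, useful far from the boundary, where killing is rare.\<close>

lemma reflected_kernel_le:
  assumes n: "n > 0"
  shows "\<bar>reflected (killed_kernel u n v j) z\<bar> \<le> 1 - K (\<lambda>_. 1) z"
proof -
  let ?r = "\<lambda>y. indicator {..<0} y * killed_kernel u n v j (- y)"
  have one: "sq_growth (\<lambda>z. indicator {0..} z * (1::real))" by (rule sq_growth_indicator) auto
  have pw: "\<bar>?r y\<bar> \<le> 1 - indicator {0..} y * 1" for y
    using abs_kernel_le[of u n v j "- y"] by (simp add: indicator_def)
  have "\<bar>reflected (killed_kernel u n v j) z\<bar> \<le> T (\<lambda>y. \<bar>?r y\<bar>) z"
    unfolding reflected_def by (rule T_abs)
  also have "\<dots> \<le> T (\<lambda>y. 1 - indicator {0..} y * 1) z"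
    by (intro T_mono sq_growth_abs sq_growth_reflect sq_growth_kernel n sq_growth_diff sq_growth_const one pw)
  also have "\<dots> = T (\<lambda>_. 1) z - K (\<lambda>_. 1) z"
    unfolding K_def by (rule T_diff[OF sq_growth_const one])
  finally show ?thesis by simp
qed

lemma Kn_telescope:
  assumes "\<And>j. sq_growth (G j)"
  shows "Kn n (G 0) x - G n x = (\<Sum>k<n. Kn k (\<lambda>z. K (G (n - Suc k)) z - G (n - k) z) x)"
proof -
  have "(\<Sum>k<n. Kn k (\<lambda>z. K (G (n - Suc k)) z - G (n - k) z) x)
      = (\<Sum>k<n. Kn (Suc k) (G (n - Suc k)) x - Kn k (G (n - k)) x)"
    unfolding funpow_Suc_right o_def
    by (intro sum.cong refl Kn_diff sq_growth_K assms)
  also have "\<dots> = Kn n (G 0) x - G n x"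
    using sum_lessThan_telescope[of "\<lambda>k. Kn k (G (n - k)) x" n] by (simp only: diff_self_eq_0 diff_zero funpow_0)
  finally show ?thesis by (rule sym)
qed

text \<open>An overshoot after \<open>k\<close> steps meets a slope belonging to another time horizon. The resulting error
  is proportional to \<open>(k + 1) / n\<close>, hence the weights.\<close>

definition weighted_excess :: "nat \<Rightarrow> real \<Rightarrow> real" where
  "weighted_excess n x = (\<Sum>k<n. real (Suc k) * Kn k mean_excess x)"

text \<open>The weight \<open>k + 1\<close> counts the times \<open>j \<le> k\<close>, and the excess still to come at time \<open>j\<close> is at
  most \<open>lyap\<close> of the position.\<close>

lemma weighted_excess_le: "weighted_excess n x \<le> (\<Sum>j<n. Kn j lyap x)"
proof (induction n arbitrary: x)
  case (Suc n)
  have K_sum: "K (\<lambda>z. \<Sum>k<n. f k z) x = (\<Sum>k<n. K (f k) x)" if "\<And>k. sq_growth (f k)" for f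
    using Kn_sum[of "{..<n}" f 1 x] that by simp
  have "weighted_excess (Suc n) x = (\<Sum>k<Suc n. Kn k mean_excess x) + (\<Sum>k<Suc n. real k * Kn k mean_excess x)"
    unfolding weighted_excess_def sum.distrib[symmetric]
    by (intro sum.cong refl) (simp only: of_nat_Suc distrib_right mult_1_left)
  also have "(\<Sum>k<Suc n. real k * Kn k mean_excess x) = (\<Sum>k<n. real (Suc k) * K (Kn k mean_excess) x)"
    by (subst sum.lessThan_Suc_shift) simp
  also have "\<dots> = K (weighted_excess n) x"
    unfolding weighted_excess_def[abs_def] K_cmult[symmetric]
    by (rule K_sum[symmetric]) (intro sq_growth_cmult sq_growth_Kn sq_growth_mean_excess)
  also have "\<dots> \<le> K (\<lambda>z. \<Sum>j<n. Kn j lyap z) x"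
    using Suc.IH unfolding weighted_excess_def[abs_def]
    by (intro K_mono sq_growth_sum sq_growth_cmult sq_growth_Kn sq_growth_mean_excess sq_growth_lyap)
  also have "\<dots> = (\<Sum>j<n. Kn (Suc j) lyap x)"
    by (subst K_sum) (auto intro: sq_growth_Kn)
  also have "(\<Sum>k<Suc n. Kn k mean_excess x) + \<dots> \<le> lyap x + \<dots>"
    using sum_mean_excess_le[where n = "Suc n" and x = x] by simp
  also have "\<dots> = (\<Sum>j<Suc n. Kn j lyap x)"
    by (subst sum.lessThan_Suc_shift) simp
  finally show ?case by simp
qed (simp add: weighted_excess_def)

lemma kernel_Kn_far:
  assumes v: "0 < v" "v \<le> 1" and n: "n > 0"
  shows "\<bar>Kn n (killed_kernel u n v 0) x - killed_kernel u n v n x\<bar>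
    \<le> 2 * lindeberg_const v * (real n * lindeberg_rate n) + (1 - surv n x)"
proof -
  let ?e = "2 * (lindeberg_const v * lindeberg_rate n)"
  let ?D = "\<lambda>k z. K (killed_kernel u n v (n - Suc k)) z - killed_kernel u n v (n - k) z"
  have D: "sq_growth (?D k)" for k
    using n by (intro sq_growth_diff sq_growth_K sq_growth_kernel)
  have e0: "0 \<le> ?e" using lindeberg_const_nonneg by (simp add: lindeberg_rate_def)
  have loss: "sq_growth (\<lambda>z. 1 - K (\<lambda>_. 1) z)" by (intro sq_growth_diff sq_growth_K) auto
  note tel = Kn_telescope[where G = "killed_kernel u n v", OF sq_growth_kernel[OF n]]
  have "\<bar>Kn n (killed_kernel u n v 0) x - killed_kernel u n v n x\<bar> = \<bar>\<Sum>k<n. Kn k (?D k) x\<bar>"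
    by (simp only: tel)
  also have "\<dots> \<le> (\<Sum>k<n. \<bar>Kn k (?D k) x\<bar>)" by (rule sum_abs)
  also have "\<dots> \<le> (\<Sum>k<n. Kn k (\<lambda>z. ?e + (1 - K (\<lambda>_. 1) z)) x)"
  proof (rule sum_mono)
    fix k assume k: "k \<in> {..<n}"
    have "\<bar>Kn k (?D k) x\<bar> \<le> Kn k (\<lambda>z. \<bar>?D k z\<bar>) x" by (rule Kn_abs[OF D])
    also have "\<dots> \<le> Kn k (\<lambda>z. ?e + (1 - K (\<lambda>_. 1) z)) x"
    proof (rule Kn_mono)
      show "sq_growth (\<lambda>z. ?e + (1 - K (\<lambda>_. 1) z))" by (intro sq_growth_add loss) auto
      fix z
      have "Suc (n - Suc k) = n - k" using k by auto
      then show "\<bar>?D k z\<bar> \<le> ?e + (1 - K (\<lambda>_. 1) z)"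
        using kernel_T_step[OF v n, of u "n - Suc k" z] reflected_kernel_le[OF n, of u v "n - Suc k" z]
        unfolding kernel_K_step[OF n] by (simp only:) linarith
    qed (rule sq_growth_abs[OF D])
    finally show "\<bar>Kn k (?D k) x\<bar> \<le> Kn k (\<lambda>z. ?e + (1 - K (\<lambda>_. 1) z)) x" .
  qed
  also have "\<dots> \<le> (\<Sum>k<n. ?e + (surv k x - surv (Suc k) x))"
  proof (rule sum_mono)
    fix k
    have "Kn k (\<lambda>z. ?e + (1 - K (\<lambda>_. 1) z)) x = ?e * surv k x + (surv k x - surv (Suc k) x)"
      by (simp only: Kn_add[OF sq_growth_const loss] Kn_diff[OF sq_growth_const sq_growth_K[OF sq_growth_const]] Kn_const)
        (simp add: surv_def funpow_swap1)
    also have "\<dots> \<le> ?e * 1 + (surv k x - surv (Suc k) x)"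
      by (intro add_right_mono mult_left_mono surv_le_1 e0)
    finally show "Kn k (\<lambda>z. ?e + (1 - K (\<lambda>_. 1) z)) x \<le> ?e + (surv k x - surv (Suc k) x)" by simp
  qed
  also have "\<dots> = real n * ?e + (1 - surv n x)"
    by (simp add: sum.distrib sum_lessThan_telescope'[of "\<lambda>k. surv k x" n])
  finally show ?thesis by (simp add: mult_ac)
qed

text \<open>Lindeberg errors are collected only while the walk is alive, so they are weighted by the survival
  probabilities instead of being summed \<open>n\<close> times.\<close>

lemma kernel_Kn_near:
  assumes v: "0 < v" "v \<le> 1" and n: "n > 0"
  shows "\<bar>Kn n (killed_kernel u n v 0) x - killed_kernel u n v n x - killed_slope u (v + 1) / sqrt n * mean_overshoot n x\<bar>
    \<le> 2 * lindeberg_const v * lindeberg_rate n * (\<Sum>k<n. surv k x)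
      + 8 / v\<^sup>2 * real n powr (- q / 2) * lyap x + 2 / v\<^sup>2 / sqrt n / n * weighted_excess n x"
proof -
  let ?e = "2 * (lindeberg_const v * lindeberg_rate n)"
  let ?d = "killed_slope u (v + 1) / sqrt n"
  let ?b = "8 / v\<^sup>2 * real n powr (- q / 2)" and ?c = "2 / v\<^sup>2 / sqrt n"
  let ?D = "\<lambda>k z. K (killed_kernel u n v (n - Suc k)) z - killed_kernel u n v (n - k) z"
  let ?D' = "\<lambda>k z. ?D k z - ?d * overshoot z"
  have D: "sq_growth (?D k)" for k
    using n by (intro sq_growth_diff sq_growth_K sq_growth_kernel)
  have D': "sq_growth (?D' k)" for k
    by (intro sq_growth_diff[OF D] sq_growth_cmult sq_growth_overshoot)
  note tel = Kn_telescope[where G = "killed_kernel u n v", OF sq_growth_kernel[OF n]]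
  have "Kn n (killed_kernel u n v 0) x - killed_kernel u n v n x - ?d * mean_overshoot n x
      = (\<Sum>k<n. Kn k (?D k) x - Kn k (\<lambda>z. ?d * overshoot z) x)"
  proof -
    have "?d * mean_overshoot n x = (\<Sum>k<n. Kn k (\<lambda>z. ?d * overshoot z) x)"
      unfolding mean_overshoot_def sum_distrib_left by (intro sum.cong refl Kn_cmult[symmetric])
    then show ?thesis unfolding tel sum_subtractf by (rule arg_cong)
  qed
  also have "\<dots> = (\<Sum>k<n. Kn k (?D' k) x)"
    by (rule sum.cong[OF refl]) (rule Kn_diff[OF D sq_growth_cmult[OF sq_growth_overshoot], symmetric])
  finally have "\<bar>Kn n (killed_kernel u n v 0) x - killed_kernel u n v n x - ?d * mean_overshoot n x\<bar>
      = \<bar>\<Sum>k<n. Kn k (?D' k) x\<bar>"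
    by (rule arg_cong)
  also have "\<dots> \<le> (\<Sum>k<n. \<bar>Kn k (?D' k) x\<bar>)" by (rule sum_abs)
  also have "\<dots> \<le> (\<Sum>k<n. Kn k (\<lambda>z. ?e + (?b + ?c * (Suc k / n)) * mean_excess z) x)"
  proof (rule sum_mono)
    fix k assume k: "k \<in> {..<n}"
    have "\<bar>Kn k (?D' k) x\<bar> \<le> Kn k (\<lambda>z. \<bar>?D' k z\<bar>) x" by (rule Kn_abs[OF D'])
    also have "\<dots> \<le> Kn k (\<lambda>z. ?e + (?b + ?c * (Suc k / n)) * mean_excess z) x"
    proof (rule Kn_mono)
      show "sq_growth (\<lambda>z. ?e + (?b + ?c * (Suc k / n)) * mean_excess z)"
        by (rule sq_growth_add[OF sq_growth_const sq_growth_cmult[OF sq_growth_mean_excess]])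
      fix z
      have sk: "Suc (n - Suc k) = n - k" using k by auto
      have "real n / n - real (n - Suc k) / n = Suc k / n"
        using k unfolding diff_divide_distrib[symmetric] by (simp add: of_nat_diff)
      then have "1 - real (n - Suc k) / n = Suc k / n" using n by simp
      then have "\<bar>reflected (killed_kernel u n v (n - Suc k)) z - ?d * overshoot z\<bar> \<le> (?b + ?c * (Suc k / n)) * mean_excess z"
        using reflected_kernel_near[OF v n, of "n - Suc k" u z] by (simp only: diff_le_self)
      then show "\<bar>?D' k z\<bar> \<le> ?e + (?b + ?c * (Suc k / n)) * mean_excess z"
        using kernel_T_step[OF v n, of u "n - Suc k" z]
        unfolding kernel_K_step[OF n] sk by linarith
    qed (rule sq_growth_abs[OF D'])
    finally show "\<bar>Kn k (?D' k) x\<bar> \<le> Kn k (\<lambda>z. ?e + (?b + ?c * (Suc k / n)) * mean_excess z) x" .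
  qed
  also have "\<dots> = (\<Sum>k<n. ?e * surv k x + ?b * Kn k mean_excess x + ?c / n * (Suc k * Kn k mean_excess x))"
  proof (rule sum.cong[OF refl])
    fix k
    have "Kn k (\<lambda>z. ?e + (?b + ?c * (Suc k / n)) * mean_excess z) x
        = ?e * surv k x + (?b + ?c * (Suc k / n)) * Kn k mean_excess x"
      by (simp only: Kn_add[OF sq_growth_const sq_growth_cmult[OF sq_growth_mean_excess]] Kn_const Kn_cmult)
    then show "Kn k (\<lambda>z. ?e + (?b + ?c * (Suc k / n)) * mean_excess z) x
        = ?e * surv k x + ?b * Kn k mean_excess x + ?c / n * (Suc k * Kn k mean_excess x)"
      by (simp only: distrib_right) (simp add: mult_ac)
  qed
  also have "\<dots> = ?e * (\<Sum>k<n. surv k x) + ?b * (\<Sum>k<n. Kn k mean_excess x) + ?c / n * weighted_excess n x"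
    by (simp only: sum.distrib sum_distrib_left weighted_excess_def)
  also have "\<dots> \<le> ?e * (\<Sum>k<n. surv k x) + ?b * lyap x + ?c / n * weighted_excess n x"
    by (intro add_mono mult_left_mono sum_mean_excess_le order_refl) auto
  finally show ?thesis by (simp add: mult.assoc)
qed

end

context started_law
begin

lemma sum_surv_le:
  obtains C where "0 \<le> C" "\<And>x n. a \<le> x \<Longrightarrow> 2 \<le> n \<Longrightarrow> (\<Sum>k<n. surv k x) \<le> C * sqrt n * V n x"
proof -
  obtain C where C: "0 \<le> C"
    "\<And>x j n. a \<le> x \<Longrightarrow> 2 \<le> n \<Longrightarrow> j \<le> n \<Longrightarrow> surv j x \<le> C * V n x / sqrt (real (Suc j))"
    by (rule surv_bound) blast
  show ?thesis
  proof (rule that[of "2 * C"])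
    fix x :: real and n :: nat assume xn: "a \<le> x" "2 \<le> n"
    have "(\<Sum>k<n. surv k x) \<le> (\<Sum>k<n. C * V n x * (1 / sqrt (real (Suc k))))"
      using C(2)[OF xn] by (intro sum_mono) auto
    also have "\<dots> = C * V n x * (\<Sum>k<n. 1 / sqrt (real (Suc k)))" by (simp only: sum_distrib_left)
    also have "\<dots> \<le> C * V n x * (2 * sqrt n)"
      using C V_pos[OF xn] by (intro mult_left_mono sum_inverse_sqrt_le) auto
    finally show "(\<Sum>k<n. surv k x) \<le> 2 * C * sqrt n * V n x" by (simp add: mult_ac)
  qed (use C in auto)
qed

text \<open>Since \<open>lyap\<close> is sublinear, its mean on survival is at most a small multiple of \<open>V\<close>, plus a multiple of
  the survival probability, which is summable to order \<open>sqrt n\<close>. So the time average is \<open>o(V)\<close>.\<close>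

lemma weighted_excess_small:
  fixes \<theta> :: real
  assumes "0 < \<theta>"
  shows "\<forall>\<^sub>F n in sequentially. \<forall>x\<ge>a. weighted_excess n x \<le> \<theta> * n * V n x"
proof -
  obtain C1 where C1: "0 \<le> C1" "\<And>z. 0 \<le> z \<Longrightarrow> lyap z \<le> \<theta> / 2 * z + C1"
    using lyap_sublinear[of "\<theta> / 2"] assms by auto
  obtain C2 where C2: "0 \<le> C2" "\<And>x n. a \<le> x \<Longrightarrow> 2 \<le> n \<Longrightarrow> lyap x \<le> C2 * V n x"
    by (rule lyap_le_V) blast
  obtain C3 where C3: "0 \<le> C3" "\<And>x n. a \<le> x \<Longrightarrow> 2 \<le> n \<Longrightarrow> (\<Sum>k<n. surv k x) \<le> C3 * sqrt n * V n x"
    by (rule sum_surv_le) blast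
  have "(\<lambda>n. C2 * (1 / real n) + C1 * C3 * (1 / sqrt (real n))) \<longlonglongrightarrow> C2 * 0 + C1 * C3 * 0"
    by (intro tendsto_intros lim_1_over_n tendsto_divide_0[OF tendsto_const]
        filterlim_compose[OF filterlim_at_top_imp_at_infinity[OF sqrt_at_top]] filterlim_real_sequentially)
  then have "\<forall>\<^sub>F n in sequentially. C2 * (1 / real n) + C1 * C3 * (1 / sqrt (real n)) < \<theta> / 2"
    using assms by (intro order_tendstoD(2)) auto
  then show ?thesis
    using eventually_ge_at_top[of 2]
  proof eventually_elim
    case (elim n)
    show ?case
    proof (intro allI impI)
      fix x assume x: "a \<le> x"
      note Vp = V_pos[OF x elim(2)]
      have step: "Kn j lyap x \<le> (if j = 0 then C2 * V n x else 0) + (\<theta> / 2 * V n x + C1 * surv j x)"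
        if "j < n" for j
      proof (cases "j = 0")
        case True
        then show ?thesis
          using C2(2)[OF x elim(2)] C1(1) mult_pos_pos[OF assms Vp] by simp
      next
        case False
        have "Kn j lyap x \<le> Kn j (\<lambda>z. \<theta> / 2 * z + C1) x"
          using False C1(2) by (intro Kn_mono_half_line sq_growth_add sq_growth_cmult) auto
        also have "\<dots> = \<theta> / 2 * V j x + C1 * surv j x"
          by (simp only: Kn_add[OF sq_growth_cmult[OF sq_growth_ident] sq_growth_const] Kn_cmult Kn_const V_def)
        also have "\<dots> \<le> \<theta> / 2 * V n x + C1 * surv j x"
          using that assms by (intro add_right_mono mult_left_mono V_mono) auto
        finally show ?thesis using False by simp
      qed
      have "weighted_excess n x \<le> (\<Sum>j<n. Kn j lyap x)" by (rule weighted_excess_le)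
      also have "\<dots> \<le> (\<Sum>j<n. (if j = 0 then C2 * V n x else 0) + (\<theta> / 2 * V n x + C1 * surv j x))"
        using step by (intro sum_mono) auto
      also have "\<dots> = C2 * V n x + (\<theta> / 2 * n * V n x + C1 * (\<Sum>j<n. surv j x))"
        using elim(2) by (simp add: sum.distrib sum_distrib_left sum.delta)
      also have "\<dots> \<le> C2 * V n x + (\<theta> / 2 * n * V n x + C1 * (C3 * sqrt n * V n x))"
        by (intro add_left_mono mult_left_mono C3 C1 x elim)
      also have "\<dots> = (C2 * (1 / real n) + C1 * C3 * (1 / sqrt (real n)) + \<theta> / 2) * (n * V n x)"
      proof -
        have q1: "1 / sqrt (real n) * (n * V n x) = sqrt n * V n x"
        proof -
          have "1 / sqrt (real n) * (n * V n x) = real n / sqrt n * V n x" by (simp only: times_divide_eq_left mult_1_left)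
          then show ?thesis by (simp add: real_div_sqrt)
        qed
        have q2: "1 / real n * (n * V n x) = V n x" using elim(2) by simp
        have "(C2 * (1 / real n) + C1 * C3 * (1 / sqrt (real n)) + \<theta> / 2) * (n * V n x)
            = C2 * (1 / real n * (n * V n x)) + C1 * C3 * (1 / sqrt (real n) * (n * V n x)) + \<theta> / 2 * (n * V n x)"
          by (simp only: distrib_right mult.assoc)
        then show ?thesis unfolding q1 q2 by (simp only: mult.assoc add_ac)
      qed
      also have "\<dots> \<le> \<theta> * (n * V n x)"
      proof (rule mult_right_mono)
        show "C2 * (1 / real n) + C1 * C3 * (1 / sqrt (real n)) + \<theta> / 2 \<le> \<theta>" using elim(1) by linarith
      qed (use Vp in simp)
      finally show "weighted_excess n x \<le> \<theta> * n * V n x" by (simp add: mult.assoc)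
    qed
  qed
qed

text \<open>The value of the killed walk is that of Brownian motion plus a boundary term proportional to the
  accumulated overshoot. The error is small relative to \<open>V n x / sqrt n\<close>, which is the order of the
  survival probability as long as \<open>x\<close> is at most of order \<open>sqrt n\<close>.\<close>

theorem kernel_asymptotics:
  assumes v: "0 < v" "v \<le> 1" and eps: "0 < \<epsilon>"
  shows "\<forall>\<^sub>F n in sequentially. \<forall>x\<ge>a. \<forall>u.
    \<bar>Kn n (\<lambda>z. killed_tail u (z / sqrt n) v) x - killed_tail u (x / sqrt n) (v + 1)
       - killed_slope u (v + 1) * mean_overshoot n x / sqrt n\<bar> \<le> \<epsilon> * V n x / sqrt n"
proof -
  obtain C2 where C2: "0 \<le> C2" "\<And>x n. a \<le> x \<Longrightarrow> 2 \<le> n \<Longrightarrow> lyap x \<le> C2 * V n x"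
    by (rule lyap_le_V) blast
  obtain C3 where C3: "0 \<le> C3" "\<And>x n. a \<le> x \<Longrightarrow> 2 \<le> n \<Longrightarrow> (\<Sum>k<n. surv k x) \<le> C3 * sqrt n * V n x"
    by (rule sum_surv_le) blast
  let ?L = "lindeberg_const v"
  have "(\<lambda>n. 2 * ?L * C3 * (real n * lindeberg_rate n) + 8 / v\<^sup>2 * C2 * real n powr (- ((q - 1) / 2)))
      \<longlonglongrightarrow> 2 * ?L * C3 * 0 + 8 / v\<^sup>2 * C2 * 0"
    using q_bounds
    by (intro tendsto_add tendsto_mult tendsto_const lindeberg_rate_tendsto tendsto_neg_powr filterlim_real_sequentially) auto
  then have "\<forall>\<^sub>F n in sequentially.
      2 * ?L * C3 * (real n * lindeberg_rate n) + 8 / v\<^sup>2 * C2 * real n powr (- ((q - 1) / 2)) < \<epsilon> / 2"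
    using eps by (intro order_tendstoD(2)) auto
  moreover have "\<forall>\<^sub>F n in sequentially. \<forall>x\<ge>a. weighted_excess n x \<le> \<epsilon> * v\<^sup>2 / 4 * n * V n x"
    using eps v by (intro weighted_excess_small) auto
  ultimately show ?thesis
    using eventually_ge_at_top[of 2]
  proof eventually_elim
    case (elim n)
    show ?case
    proof (intro allI impI)
      fix x u assume x: "a \<le> x"
      note Vp = V_pos[OF x elim(3)]
      have n: "n > 0" using elim(3) by simp
      have ss: "sqrt (real n) * sqrt (real n) = n" by simp
      have L0: "0 \<le> ?L * lindeberg_rate n" using lindeberg_const_nonneg by (simp add: lindeberg_rate_def)
      have "2 * ?L * lindeberg_rate n * (\<Sum>k<n. surv k x) \<le> 2 * ?L * lindeberg_rate n * (C3 * sqrt n * V n x)"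
        using L0 by (intro mult_left_mono C3 x elim) (auto simp: mult_ac)
      also have "\<dots> = 2 * ?L * lindeberg_rate n * C3 * (sqrt n * V n x)" by (simp only: mult_ac)
      also have "sqrt n * V n x = real n * (V n x / sqrt n)"
        using real_div_sqrt[of "real n"] by (simp only: times_divide_eq_right times_divide_eq_left[symmetric])
      also have "2 * ?L * lindeberg_rate n * C3 * (real n * (V n x / sqrt n))
          = 2 * ?L * C3 * (real n * lindeberg_rate n) * (V n x / sqrt n)" by (simp only: mult_ac)
      finally have 1: "2 * ?L * lindeberg_rate n * (\<Sum>k<n. surv k x)
          \<le> 2 * ?L * C3 * (real n * lindeberg_rate n) * (V n x / sqrt n)" .
      have pw: "real n powr (- q / 2) = real n powr (- ((q - 1) / 2)) / sqrt n"
      proof -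
        have "- q / 2 = - ((q - 1) / 2) - 1 / 2" by (simp add: field_simps)
        then have "real n powr (- q / 2) = real n powr (- ((q - 1) / 2)) / real n powr (1 / 2)"
          by (simp only: powr_diff)
        then show ?thesis by (simp add: powr_half_sqrt)
      qed
      have "8 / v\<^sup>2 * real n powr (- q / 2) * lyap x \<le> 8 / v\<^sup>2 * real n powr (- q / 2) * (C2 * V n x)"
        by (intro mult_left_mono C2 x elim) auto
      also have "\<dots> = 8 / v\<^sup>2 * C2 * real n powr (- ((q - 1) / 2)) * (V n x / sqrt n)"
        unfolding pw by (simp add: mult_ac)
      finally have 2: "8 / v\<^sup>2 * real n powr (- q / 2) * lyap x
          \<le> 8 / v\<^sup>2 * C2 * real n powr (- ((q - 1) / 2)) * (V n x / sqrt n)" .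
      have "2 / v\<^sup>2 / sqrt n / n * weighted_excess n x \<le> 2 / v\<^sup>2 / sqrt n / n * (\<epsilon> * v\<^sup>2 / 4 * n * V n x)"
        using elim(2) x by (intro mult_left_mono) auto
      also have "\<dots> = \<epsilon> / 2 * (V n x / sqrt n)" using n v by simp
      finally have 3: "2 / v\<^sup>2 / sqrt n / n * weighted_excess n x \<le> \<epsilon> / 2 * (V n x / sqrt n)" .
      have "(2 * ?L * C3 * (real n * lindeberg_rate n) + 8 / v\<^sup>2 * C2 * real n powr (- ((q - 1) / 2))) * (V n x / sqrt n)
          \<le> \<epsilon> / 2 * (V n x / sqrt n)"
        using elim(1) Vp by (intro mult_right_mono) auto
      then have "2 * ?L * lindeberg_rate n * (\<Sum>k<n. surv k x) + 8 / v\<^sup>2 * real n powr (- q / 2) * lyap x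
          + 2 / v\<^sup>2 / sqrt n / n * weighted_excess n x \<le> \<epsilon> / 2 * (V n x / sqrt n) + \<epsilon> / 2 * (V n x / sqrt n)"
        using 1 2 3 unfolding distrib_right by linarith
      then show "\<bar>Kn n (\<lambda>z. killed_tail u (z / sqrt n) v) x - killed_tail u (x / sqrt n) (v + 1)
       - killed_slope u (v + 1) * mean_overshoot n x / sqrt n\<bar> \<le> \<epsilon> * V n x / sqrt n"
        using kernel_Kn_near[OF v n, of u x] n by (simp add: killed_kernel_def[abs_def])
    qed
  qed
qed

end

section \<open>From smooth to sharp tails\<close>

text \<open>Indicators of the tail above \<open>u * sqrt n\<close>, seen from the half-line. The value at \<open>u * sqrt n\<close> is
  left open so that for \<open>u = 0\<close> the constant \<open>1\<close>, that is survival itself, is included.\<close>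

definition tail_test :: "real \<Rightarrow> nat \<Rightarrow> (real \<Rightarrow> real) \<Rightarrow> bool" where
  "tail_test u n f \<longleftrightarrow> f \<in> borel_measurable borel \<and> (\<forall>z. 0 \<le> f z \<and> f z \<le> 1)
     \<and> (\<forall>z. u * sqrt n < z \<longrightarrow> f z = 1) \<and> (\<forall>z. 0 \<le> z \<longrightarrow> z < u * sqrt n \<longrightarrow> f z = 0)"

lemma tail_test_growth: "tail_test u n f \<Longrightarrow> sq_growth f"
  by (rule sq_growth_bounded[of f 1]) (auto simp: tail_test_def abs_le_iff intro: order_trans[of _ 0])

lemma tail_test_one: "tail_test 0 n (\<lambda>_. 1)"
  by (auto simp: tail_test_def)

lemma heat_increment_le:
  assumes "1 / 4 \<le> v" "s \<le> s'"
  shows "heat s' v - heat s v \<le> 2 * (s' - s)"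
proof -
  have v: "v > 0" using assms by simp
  have "sqrt (1 / 4) \<le> sqrt v" using assms by (intro real_sqrt_le_mono)
  then have r: "1 / 2 \<le> sqrt v" by (simp add: real_sqrt_divide)
  have "\<bar>heat1 t v\<bar> \<le> 2" for t
  proof -
    have "\<bar>heat1 t v\<bar> = phi (t / sqrt v) / sqrt v"
      using phi_pos[of "t / sqrt v"] v by (simp add: heat1_def)
    also have "\<dots> \<le> 1 / (1 / 2)" using r power_phi_le(1) phi_pos by (intro frac_le) auto
    finally show ?thesis by simp
  qed
  then have "\<bar>heat s' v - heat s v\<bar> \<le> 2 * \<bar>s' - s\<bar>"
    by (intro lipschitz_of_deriv_bound[where S = UNIV and f' = "\<lambda>t. heat1 t v"])
      (auto intro: heat_DERIV_space v)
  then show ?thesis using assms by simp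
qed

text \<open>Inside the window the right-hand side is \<open>Phi (t + 1) - Phi (t - 1)\<close> with \<open>\<bar>t\<bar> \<le> 1\<close>, the normal mass
  of an interval that contains \<open>[0, 1]\<close> or \<open>[- 1, 0]\<close>.\<close>

lemma window_le_heat:
  assumes "0 < \<rho>"
  shows "(Phi 1 - 1 / 2) * indicator {u - \<rho>..u + \<rho>} s \<le> heat (s - u + \<rho>) (\<rho>\<^sup>2) - heat (s - u - \<rho>) (\<rho>\<^sup>2)"
proof (cases "s \<in> {u - \<rho>..u + \<rho>}")
  case True
  define t where "t = (s - u) / \<rho>"
  have t: "- 1 \<le> t" "t \<le> 1" using True assms by (auto simp: t_def field_simps)
  have "Phi 1 - 1 / 2 \<le> Phi (t + 1) - Phi (t - 1)"
  proof (cases "0 \<le> t")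
    case True
    then show ?thesis using Phi_mono[of 1 "t + 1"] Phi_mono[of "t - 1" 0] t Phi_0 by simp
  next
    case False
    then show ?thesis using Phi_mono[of 0 "t + 1"] Phi_mono[of "t - 1" "- 1"] t Phi_0 Phi_minus[of 1] by simp
  qed
  moreover have "heat (s - u + \<rho>) (\<rho>\<^sup>2) = Phi (t + 1)" "heat (s - u - \<rho>) (\<rho>\<^sup>2) = Phi (t - 1)"
    using assms by (simp_all add: heat_def t_def add_divide_distrib diff_divide_distrib)
  ultimately show ?thesis using True by simp
next
  case False
  then show ?thesis using heat_mono[of "s - u - \<rho>" "s - u + \<rho>" "\<rho>\<^sup>2"] assms by simp
qed

text \<open>With variance \<open>\<rho> ^ 4\<close> the smoothing has width \<open>\<rho>\<^sup>2\<close>, much less than \<open>\<rho>\<close>. So a tail differs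
  from its smoothing only in the window of radius \<open>\<rho>\<close> around \<open>u\<close>, up to a normal tail at \<open>1 / \<rho>\<close>.\<close>

lemma tail_test_killed_tail:
  assumes f: "tail_test u n f" and n: "n > 0" and u: "0 \<le> u" and z: "0 \<le> z" and \<rho>: "0 < \<rho>"
  shows "\<bar>f z - killed_tail u (z / sqrt n) (\<rho> ^ 4)\<bar>
    \<le> 2 * indicator {u - \<rho>..u + \<rho>} (z / sqrt n) + 2 * (1 - Phi (1 / \<rho>))"
proof -
  define s where "s = z / sqrt n"
  have rn: "sqrt (real n) > 0" using n by simp
  have s: "0 \<le> s" "z = s * sqrt n" using z rn by (auto simp: s_def)
  have f01: "0 \<le> f z" "f z \<le> 1" using f by (auto simp: tail_test_def)
  have r4: "sqrt (\<rho> ^ 4) = \<rho>\<^sup>2" using real_sqrt_abs[of "\<rho>\<^sup>2"] by simp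
  have Phi1: "Phi (1 / \<rho>) \<le> 1" by (rule Phi_bounds)
  have far: "1 - heat y (\<rho> ^ 4) \<le> 1 - Phi (1 / \<rho>)" if "\<rho> \<le> y" for y
  proof -
    have "1 / \<rho> = \<rho> / \<rho>\<^sup>2" using \<rho> by (simp add: power2_eq_square)
    also have "\<dots> \<le> y / \<rho>\<^sup>2" using that \<rho> by (intro divide_right_mono) auto
    finally have "Phi (1 / \<rho>) \<le> heat y (\<rho> ^ 4)" unfolding heat_def r4 by (rule Phi_mono)
    then show ?thesis by simp
  qed
  have "\<bar>f z - killed_tail u s (\<rho> ^ 4)\<bar> \<le> 2 * indicator {u - \<rho>..u + \<rho>} s + 2 * (1 - Phi (1 / \<rho>))"
  proof -
    consider (window) "s \<in> {u - \<rho>..u + \<rho>}" | (above) "u + \<rho> < s" | (below) "s < u - \<rho>" by force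
    then show ?thesis
    proof cases
      case window
      then show ?thesis using f01 abs_killed_tail_le[of u s "\<rho> ^ 4"] Phi1 by (simp add: abs_le_iff)
    next
      case above
      then have "f z = 1" using f rn \<rho> s by (auto simp: tail_test_def)
      moreover have "1 - heat (s + u) (\<rho> ^ 4) \<le> 1 - Phi (1 / \<rho>)" "1 - heat (s - u) (\<rho> ^ 4) \<le> 1 - Phi (1 / \<rho>)"
        using above s u \<rho> by (intro far; simp)+
      ultimately show ?thesis
        using heat_01[of "s + u" "\<rho> ^ 4"] heat_01[of "s - u" "\<rho> ^ 4"] above
        by (simp add: killed_tail_def)
    next
      case below
      then have "f z = 0" using f rn \<rho> s by (auto simp: tail_test_def)
      moreover have "1 - heat (u - s) (\<rho> ^ 4) \<le> 1 - Phi (1 / \<rho>)"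
        using below by (intro far) simp
      moreover have "heat (s - u) (\<rho> ^ 4) = 1 - heat (u - s) (\<rho> ^ 4)"
        using heat_minus[of "u - s"] by simp
      moreover have "heat (u - s) (\<rho> ^ 4) \<le> heat (s + u) (\<rho> ^ 4)"
        using s \<rho> by (intro heat_mono) auto
      ultimately show ?thesis
        using heat_01[of "s + u" "\<rho> ^ 4"] Phi1 below
        by (simp add: killed_tail_def)
    qed
  qed
  then show ?thesis by (simp add: s_def)
qed

context moment_law
begin

text \<open>After at least half of the steps the smoothed window has spread to variance of order one, so its
  height is of order \<open>\<rho>\<close>, wherever the walk started.\<close>

lemma window_Tn:
  assumes \<rho>: "0 < \<rho>" "\<rho> \<le> 1" and n: "n > 0" and m: "m \<le> n" "n \<le> 2 * m"
  shows "(Phi 1 - 1 / 2) * Tn m (\<lambda>z. indicator {u - \<rho>..u + \<rho>} (z / sqrt n)) x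
    \<le> 4 * \<rho> + 2 * lindeberg_const (\<rho>\<^sup>2) * (real n * lindeberg_rate n)"
proof -
  let ?f = "\<lambda>b z. heat ((z + b) / sqrt n) (\<rho>\<^sup>2)"
  let ?I = "\<lambda>z. indicator {u - \<rho>..u + \<rho>} (z / sqrt n) :: real"
  let ?b = "(\<rho> - u) * sqrt n" and ?b' = "(- \<rho> - u) * sqrt n"
  let ?e = "lindeberg_const (\<rho>\<^sup>2) * lindeberg_rate n"
  let ?v = "\<rho>\<^sup>2 + real m / real n"
  have rn: "sqrt (real n) > 0" using n by simp
  have r2: "0 < \<rho>\<^sup>2" "\<rho>\<^sup>2 \<le> 1" using \<rho> by (auto intro: power_le_one)
  have I: "sq_growth ?I" by (rule sq_growth_bounded[of _ 1]) (auto simp: indicator_def)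
  have e0: "0 \<le> ?e" using lindeberg_const_nonneg by (simp add: lindeberg_rate_def)
  have Tn_diff: "Tn k (\<lambda>z. ?f b z - ?f b' z) y = Tn k (?f b) y - Tn k (?f b') y" for k b b' y
  proof (induction k arbitrary: y)
    case (Suc k)
    have "Tn (Suc k) (\<lambda>z. ?f b z - ?f b' z) y = T (\<lambda>z. Tn k (?f b) z - Tn k (?f b') z) y"
      by (simp add: Suc.IH[abs_def])
    then show ?case by (simp add: T_diff[OF sq_growth_Tn[OF sq_growth_heat] sq_growth_Tn[OF sq_growth_heat]])
  qed simp
  have "(Phi 1 - 1 / 2) * Tn m ?I x = Tn m (\<lambda>z. (Phi 1 - 1 / 2) * ?I z) x"
    using Tn_affine[OF I, of m "Phi 1 - 1 / 2" 0 x] by simp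
  also have "\<dots> \<le> Tn m (\<lambda>z. ?f ?b z - ?f ?b' z) x"
  proof (rule Tn_mono)
    show "sq_growth (\<lambda>z. (Phi 1 - 1 / 2) * ?I z)" by (rule sq_growth_cmult[OF I])
    show "sq_growth (\<lambda>z. ?f ?b z - ?f ?b' z)" by (rule sq_growth_diff[OF sq_growth_heat sq_growth_heat])
    fix z
    have "(z + ?b) / sqrt n = z / sqrt n - u + \<rho>" "(z + ?b') / sqrt n = z / sqrt n - u - \<rho>"
      using rn by (simp_all add: field_simps)
    then show "(Phi 1 - 1 / 2) * ?I z \<le> ?f ?b z - ?f ?b' z"
      using window_le_heat[OF \<rho>(1), of u "z / sqrt n"] by simp
  qed
  also have "\<dots> = Tn m (?f ?b) x - Tn m (?f ?b') x" by (rule Tn_diff)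
  also have "\<dots> \<le> (heat ((x + ?b) / sqrt n) ?v + m * ?e) - (heat ((x + ?b') / sqrt n) ?v - m * ?e)"
    using heat_Tn[OF r2 order_refl n, of m ?b x] heat_Tn[OF r2 order_refl n, of m ?b' x]
    unfolding abs_le_iff by linarith
  also have "\<dots> = (heat ((x + ?b) / sqrt n) ?v - heat ((x + ?b') / sqrt n) ?v) + 2 * (m * ?e)" by simp
  also have "\<dots> \<le> 2 * ((x + ?b) / sqrt n - (x + ?b') / sqrt n) + 2 * (n * ?e)"
  proof (intro add_mono mult_left_mono mult_right_mono heat_increment_le)
    have "1 / 2 \<le> real m / real n" using m n by (simp add: field_simps)
    then show "1 / 4 \<le> ?v" using r2 by linarith
    show "(x + ?b') / sqrt n \<le> (x + ?b) / sqrt n" using rn \<rho> by (intro divide_right_mono add_left_mono mult_right_mono) auto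
  qed (use m e0 in auto)
  also have "2 * ((x + ?b) / sqrt n - (x + ?b') / sqrt n) = 4 * \<rho>"
    using rn by (simp add: field_simps)
  finally show ?thesis by (simp add: mult_ac)
qed

text \<open>The first half of the time supplies the survival probability, the second half, without killing, the
  small factor.\<close>

lemma window_Kn:
  assumes \<rho>: "0 < \<rho>" "\<rho> \<le> 1" and n: "n > 0"
  shows "Kn n (\<lambda>z. indicator {u - \<rho>..u + \<rho>} (z / sqrt n)) x
    \<le> (4 * \<rho> + 2 * lindeberg_const (\<rho>\<^sup>2) * (real n * lindeberg_rate n)) / (Phi 1 - 1 / 2) * surv (n div 2) x"
proof -
  let ?I = "\<lambda>z. indicator {u - \<rho>..u + \<rho>} (z / sqrt n) :: real"
  let ?B = "(4 * \<rho> + 2 * lindeberg_const (\<rho>\<^sup>2) * (real n * lindeberg_rate n)) / (Phi 1 - 1 / 2)"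
  define m where "m = n - n div 2"
  have m: "m \<le> n" "n \<le> 2 * m" "n = n div 2 + m" unfolding m_def by auto
  have kap: "0 < Phi 1 - 1 / 2" using Phi_strict_mono[of 0 1] Phi_0 by simp
  have I: "sq_growth ?I" by (rule sq_growth_bounded[of _ 1]) (auto simp: indicator_def)
  have "Kn n ?I x = Kn (n div 2) (Kn m ?I) x"
    using Kn_plus[of "n div 2" m ?I] m(3) by simp
  also have "\<dots> \<le> ?B * surv (n div 2) x"
  proof (rule Kn_le_const[OF sq_growth_Kn[OF I]])
    fix z
    have "Kn m ?I z \<le> Tn m ?I z" by (intro Kn_le_Tn I) auto
    also have "\<dots> \<le> ?B"
      using window_Tn[OF \<rho> n m(1,2), of u z] kap by (simp add: pos_le_divide_eq mult.commute)
    finally show "Kn m ?I z \<le> ?B" .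
  qed
  finally show ?thesis .
qed

lemma smoothing_error:
  assumes eps: "0 < \<epsilon>"
  obtains v where "0 < v" "v \<le> 1" "v \<le> \<epsilon>"
    "\<forall>\<^sub>F n in sequentially. \<forall>x u f. 0 \<le> u \<longrightarrow> tail_test u n f \<longrightarrow>
       \<bar>Kn n f x - Kn n (\<lambda>z. killed_tail u (z / sqrt n) v) x\<bar> \<le> \<epsilon> * surv (n div 2) x"
proof -
  define \<kappa> where "\<kappa> = Phi 1 - 1 / 2"
  have kap: "0 < \<kappa>" using Phi_strict_mono[of 0 1] Phi_0 by (simp add: \<kappa>_def)
  have "((\<lambda>\<rho>. 8 / \<kappa> * \<rho> + 2 * (1 - Phi (1 / \<rho>))) \<longlongrightarrow> 8 / \<kappa> * 0 + 2 * (1 - 1)) (at_right 0)"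
  proof (intro tendsto_add tendsto_mult tendsto_const tendsto_diff tendsto_ident_at)
    show "((\<lambda>\<rho>. Phi (1 / \<rho>)) \<longlongrightarrow> 1) (at_right 0)"
      using filterlim_compose[OF std_normal.cdf_lim_at_top_prob filterlim_inverse_at_top_right]
      by (simp add: inverse_eq_divide)
  qed
  then have "\<forall>\<^sub>F \<rho> in at_right 0. 8 / \<kappa> * \<rho> + 2 * (1 - Phi (1 / \<rho>)) < \<epsilon> / 2"
    using eps by (intro order_tendstoD(2)) auto
  moreover have "\<forall>\<^sub>F \<rho> in at_right (0::real). 0 < \<rho> \<and> \<rho> < min 1 \<epsilon>"
    using eps unfolding eventually_at_right_field by (intro exI[of _ "min 1 \<epsilon>"]) auto
  ultimately have "\<forall>\<^sub>F \<rho> in at_right 0. 8 / \<kappa> * \<rho> + 2 * (1 - Phi (1 / \<rho>)) < \<epsilon> / 2 \<and> 0 < \<rho> \<and> \<rho> < min 1 \<epsilon>"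
    by eventually_elim auto
  then obtain \<rho> where \<rho>: "8 / \<kappa> * \<rho> + 2 * (1 - Phi (1 / \<rho>)) < \<epsilon> / 2" "0 < \<rho>" "\<rho> \<le> 1" "\<rho> \<le> \<epsilon>"
    using eventually_happens[of _ "at_right (0::real)"] by force
  have pow: "\<rho> ^ 4 \<le> \<rho>" using \<rho> power_decreasing[of 1 4 \<rho>] by simp
  let ?L = "lindeberg_const (\<rho>\<^sup>2)"
  have "(\<lambda>n. 4 * ?L / \<kappa> * (real n * lindeberg_rate n)) \<longlonglongrightarrow> 4 * ?L / \<kappa> * 0"
    by (intro tendsto_mult tendsto_const lindeberg_rate_tendsto)
  then have ev: "\<forall>\<^sub>F n in sequentially. 4 * ?L / \<kappa> * (real n * lindeberg_rate n) < \<epsilon> / 2"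
    using eps by (intro order_tendstoD(2)) auto
  show ?thesis
  proof (rule that[of "\<rho> ^ 4"])
    show "0 < \<rho> ^ 4" "\<rho> ^ 4 \<le> 1" "\<rho> ^ 4 \<le> \<epsilon>" using pow \<rho> by auto
    show "\<forall>\<^sub>F n in sequentially. \<forall>x u f. 0 \<le> u \<longrightarrow> tail_test u n f \<longrightarrow>
       \<bar>Kn n f x - Kn n (\<lambda>z. killed_tail u (z / sqrt n) (\<rho> ^ 4)) x\<bar> \<le> \<epsilon> * surv (n div 2) x"
      using ev eventually_gt_at_top[of 0]
    proof eventually_elim
      case (elim n)
      show ?case
      proof (intro allI impI)
        fix x u f assume u: "0 \<le> u" and f: "tail_test u n f"
        let ?I = "\<lambda>z. indicator {u - \<rho>..u + \<rho>} (z / sqrt n) :: real"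
        let ?k = "\<lambda>z. killed_tail u (z / sqrt n) (\<rho> ^ 4)"
        have I: "sq_growth ?I" by (rule sq_growth_bounded[of _ 1]) (auto simp: indicator_def)
        have fg: "sq_growth f" using f by (rule tail_test_growth)
        have kg: "sq_growth ?k"
          using sq_growth_kernel[OF elim(2), of u "\<rho> ^ 4" 0] by (simp add: killed_kernel_def[abs_def])
        have "\<bar>Kn n f x - Kn n ?k x\<bar> = \<bar>Kn n (\<lambda>z. f z - ?k z) x\<bar>"
          by (simp only: Kn_diff[OF fg kg])
        also have "\<dots> \<le> Kn n (\<lambda>z. \<bar>f z - ?k z\<bar>) x" by (rule Kn_abs[OF sq_growth_diff[OF fg kg]])
        also have "\<dots> \<le> Kn n (\<lambda>z. 2 * ?I z + 2 * (1 - Phi (1 / \<rho>))) x"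
          by (rule Kn_mono_half_line[OF sq_growth_abs[OF sq_growth_diff[OF fg kg]]
                sq_growth_add[OF sq_growth_cmult[OF I] sq_growth_const]
                tail_test_killed_tail[OF f elim(2) u _ \<rho>(2)] elim(2)])
        also have "\<dots> = 2 * Kn n ?I x + 2 * (1 - Phi (1 / \<rho>)) * surv n x"
          by (simp only: Kn_add[OF sq_growth_cmult[OF I] sq_growth_const] Kn_cmult Kn_const)
        also have "\<dots> \<le> 2 * ((4 * \<rho> + 2 * ?L * (real n * lindeberg_rate n)) / \<kappa> * surv (n div 2) x)
            + 2 * (1 - Phi (1 / \<rho>)) * surv (n div 2) x"
          unfolding \<kappa>_def using Phi_bounds
          by (intro add_mono mult_left_mono window_Kn \<rho> elim surv_antimono) auto
        also have "\<dots> = (8 / \<kappa> * \<rho> + 2 * (1 - Phi (1 / \<rho>)) + 4 * ?L / \<kappa> * (real n * lindeberg_rate n)) * surv (n div 2) x"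
          by (simp add: algebra_simps add_divide_distrib)
        also have "\<dots> \<le> \<epsilon> * surv (n div 2) x"
          using \<rho>(1) elim(1) by (intro mult_right_mono surv_nonneg) linarith
        finally show "\<bar>Kn n f x - Kn n ?k x\<bar> \<le> \<epsilon> * surv (n div 2) x" .
      qed
    qed
  qed
qed

end

section \<open>The conditional tail, uniformly in the starting point\<close>

lemma killed_tail_zero_start [simp]: "killed_tail u 0 v = 0"
  using killed_tail_minus[of u 0 v] by simp

lemma killed_tail_0_eq: "killed_tail 0 t 1 = 2 * Phi t - 1"
  by (simp add: killed_tail_def heat_def)

lemma killed_slope_0_eq: "killed_slope 0 1 = 2 * phi 0"
  by (simp add: killed_slope_def heat1_def)

lemma phi_antimono: "0 \<le> s \<Longrightarrow> s \<le> t \<Longrightarrow> phi t \<le> phi s"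
  unfolding std_normal_density_def by (intro mult_left_mono) (auto intro: power_mono)

lemma killed_tail_0_bounds:
  assumes "0 \<le> t" "t \<le> M"
  shows "2 * phi M * t \<le> killed_tail 0 t 1" "killed_tail 0 t 1 \<le> killed_slope 0 1 * t"
proof -
  have "2 * phi M * t \<le> killed_tail 0 t 1 \<and> killed_tail 0 t 1 \<le> killed_slope 0 1 * t"
  proof (cases "t = 0")
    case False
    with assms have t: "0 < t" by simp
    obtain s where s: "0 < s" "s < t" "Phi t - Phi 0 = (t - 0) * phi s"
      using MVT2[OF t, of Phi phi] DERIV_Phi by auto
    have "phi M \<le> phi s" "phi s \<le> phi 0" using s assms by (auto intro: phi_antimono)
    then have le: "phi M * t \<le> phi s * t" "phi s * t \<le> phi 0 * t" using t by (auto intro: mult_right_mono)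
    have eq: "killed_tail 0 t 1 = 2 * (phi s * t)"
      using s(3) unfolding killed_tail_0_eq Phi_0 by (simp add: mult.commute)
    show ?thesis unfolding eq killed_slope_0_eq mult.assoc using le by simp
  qed simp
  then show "2 * phi M * t \<le> killed_tail 0 t 1" "killed_tail 0 t 1 \<le> killed_slope 0 1 * t" by auto
qed

lemma killed_tail_0_tendsto: "((\<lambda>t. killed_tail 0 t 1) \<longlongrightarrow> 1) at_top"
proof -
  have "((\<lambda>t. 2 * Phi t - 1) \<longlongrightarrow> 2 * 1 - 1) at_top"
    by (intro tendsto_intros std_normal.cdf_lim_at_top_prob)
  then show ?thesis by (simp add: killed_tail_0_eq[abs_def])
qed

text \<open>The tail of the limit law: the position at time one of Brownian motion started at \<open>\<bar>t\<bar>\<close>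
  and conditioned to stay positive. At \<open>t = 0\<close> this is the Brownian meander.\<close>

definition meander_tail :: "real \<Rightarrow> real \<Rightarrow> real" where
  "meander_tail u t = (if t = 0 then killed_slope u 1 / killed_slope 0 1
     else killed_tail u t 1 / killed_tail 0 t 1)"

lemma killed_tail_0_abs_lower:
  assumes "\<bar>t\<bar> \<le> M"
  shows "2 * phi M * \<bar>t\<bar> \<le> \<bar>killed_tail 0 t 1\<bar>"
proof (cases "0 \<le> t")
  case True
  then show ?thesis using killed_tail_0_bounds(1)[of t M] assms by simp
next
  case False
  then show ?thesis using killed_tail_0_bounds(1)[of "- t" M] assms by (simp add: killed_tail_minus)
qed

lemma meander_tail_times: "meander_tail u t * killed_tail 0 t 1 = killed_tail u t 1"
proof (cases "t = 0")
  case False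
  have "0 < 2 * phi \<bar>t\<bar> * \<bar>t\<bar>" using False phi_pos by simp
  also have "\<dots> \<le> \<bar>killed_tail 0 t 1\<bar>" by (rule killed_tail_0_abs_lower) simp
  finally show ?thesis using False by (simp add: meander_tail_def)
qed simp

text \<open>Both \<open>killed_tail u t 1\<close> and \<open>killed_tail 0 t 1\<close> are linear in \<open>t\<close> up to a quadratic error, and the
  latter is bounded below by a multiple of \<open>\<bar>t\<bar>\<close>; so their ratio is Lipschitz at \<open>0\<close>, uniformly in \<open>u\<close>.\<close>

lemma meander_tail_bounds:
  assumes M: "\<bar>t\<bar> \<le> M"
  shows "\<bar>meander_tail u t\<bar> \<le> 2 / phi M"
    and "\<bar>killed_slope u 1 - meander_tail u t * killed_slope 0 1\<bar> \<le> 8 / phi M * \<bar>t\<bar>"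
proof -
  have pM: "0 < phi M" by (rule phi_pos)
  have "\<bar>meander_tail u t\<bar> \<le> 2 / phi M \<and>
    \<bar>killed_slope u 1 - meander_tail u t * killed_slope 0 1\<bar> \<le> 8 / phi M * \<bar>t\<bar>"
  proof (cases "t = 0")
    case True
    have p0: "phi M \<le> phi 0"
      using phi_antimono[of 0 "\<bar>M\<bar>"] by (cases "0 \<le> M") auto
    have "killed_slope u 1 / killed_slope 0 1 \<le> 4 / (2 * phi M)"
      unfolding killed_slope_0_eq using killed_slope_bounds[of 1 1 u] p0 pM by (intro frac_le) auto
    moreover have "0 \<le> killed_slope u 1 / killed_slope 0 1"
      using killed_slope_bounds(1)[of 1 1] by (intro divide_nonneg_nonneg) auto
    moreover have "killed_slope 0 1 \<noteq> 0" using phi_pos[of 0] by (simp add: killed_slope_0_eq)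
    ultimately show ?thesis using True by (simp add: meander_tail_def)
  next
    case False
    define k where "k = \<bar>killed_tail 0 t 1\<bar>"
    have k: "2 * phi M * \<bar>t\<bar> \<le> k" "0 < k"
    proof -
      show "2 * phi M * \<bar>t\<bar> \<le> k" unfolding k_def by (rule killed_tail_0_abs_lower[OF M])
      moreover have "0 < 2 * phi M * \<bar>t\<bar>" using False pM by simp
      ultimately show "0 < k" by linarith
    qed
    have lip: "\<bar>killed_tail u t 1\<bar> \<le> 4 * \<bar>t\<bar>" using killed_tail_lipschitz[of 1 1 u t] by simp
    have "\<bar>meander_tail u t\<bar> = \<bar>killed_tail u t 1\<bar> / k" using False by (simp add: meander_tail_def k_def)
    also have "\<dots> \<le> (4 * \<bar>t\<bar>) / (2 * phi M * \<bar>t\<bar>)"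
      using lip k False pM by (intro frac_le) auto
    also have "\<dots> = 2 / phi M" using False by simp
    finally have 1: "\<bar>meander_tail u t\<bar> \<le> 2 / phi M" .
    have sl: "\<bar>killed_slope u 1\<bar> \<le> 4" "\<bar>killed_slope 0 1\<bar> \<le> 4"
      using killed_slope_bounds[of 1 1 u] killed_slope_bounds[of 1 1 0] by auto
    have "killed_slope u 1 * killed_tail 0 t 1 - killed_tail u t 1 * killed_slope 0 1
        = killed_slope u 1 * (killed_tail 0 t 1 - t * killed_slope 0 1) - (killed_tail u t 1 - t * killed_slope u 1) * killed_slope 0 1"
      by (simp add: algebra_simps)
    then have "\<bar>killed_slope u 1 * killed_tail 0 t 1 - killed_tail u t 1 * killed_slope 0 1\<bar>
        \<le> \<bar>killed_slope u 1\<bar> * \<bar>killed_tail 0 t 1 - t * killed_slope 0 1\<bar>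
          + \<bar>killed_tail u t 1 - t * killed_slope u 1\<bar> * \<bar>killed_slope 0 1\<bar>"
      unfolding abs_mult[symmetric] by linarith
    also have "\<dots> \<le> 4 * (2 * t\<^sup>2) + (2 * t\<^sup>2) * 4"
      using killed_tail_linear_error[of 1 1 0 t] killed_tail_linear_error[of 1 1 u t] sl
      by (intro add_mono mult_mono) auto
    finally have num: "\<bar>killed_slope u 1 * killed_tail 0 t 1 - killed_tail u t 1 * killed_slope 0 1\<bar> \<le> 16 * t\<^sup>2" by simp
    have "killed_slope u 1 - meander_tail u t * killed_slope 0 1
        = (killed_slope u 1 * killed_tail 0 t 1 - killed_tail u t 1 * killed_slope 0 1) / killed_tail 0 t 1"
      using False k(2) by (simp add: meander_tail_def k_def field_simps)
    then have "\<bar>killed_slope u 1 - meander_tail u t * killed_slope 0 1\<bar>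
        = \<bar>killed_slope u 1 * killed_tail 0 t 1 - killed_tail u t 1 * killed_slope 0 1\<bar> / k"
      by (simp add: k_def)
    also have "\<dots> \<le> 16 * t\<^sup>2 / (2 * phi M * \<bar>t\<bar>)"
      using num k False pM by (intro frac_le) auto
    also have "\<dots> = 8 / phi M * \<bar>t\<bar>"
    proof -
      have "t\<^sup>2 = \<bar>t\<bar> * \<bar>t\<bar>" by (simp add: power2_eq_square)
      then show ?thesis using False pM by (simp add: field_simps)
    qed
    finally show ?thesis using 1 by simp
  qed
  then show "\<bar>meander_tail u t\<bar> \<le> 2 / phi M"
    "\<bar>killed_slope u 1 - meander_tail u t * killed_slope 0 1\<bar> \<le> 8 / phi M * \<bar>t\<bar>" by auto
qed

lemma abs_chain:
  fixes p b c d c' d' :: real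
  assumes "\<bar>p - b\<bar> \<le> e1" "\<bar>b - c - d\<bar> \<le> e2" "\<bar>c - c'\<bar> \<le> e3" "\<bar>d - d'\<bar> \<le> e4"
  shows "\<bar>p - (c' + d')\<bar> \<le> (e1 + e3 + e4) + e2"
  using assms unfolding abs_le_iff by auto

context started_law
begin

text \<open>The leading term: Brownian motion started at \<open>x / sqrt n\<close>, plus the contribution of the overshoots,
  which acts like a small additional starting height.\<close>

definition limit_tail :: "real \<Rightarrow> nat \<Rightarrow> real \<Rightarrow> real" where
  "limit_tail u n x = killed_tail u (x / sqrt n) 1 + killed_slope u 1 * mean_overshoot n x / sqrt n"

lemma surv_half_le:
  obtains C where "0 \<le> C" "\<And>x n. a \<le> x \<Longrightarrow> 2 \<le> n \<Longrightarrow> surv (n div 2) x \<le> C * V n x / sqrt n"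
proof -
  obtain C where C: "0 \<le> C"
    "\<And>x j n. a \<le> x \<Longrightarrow> 2 \<le> n \<Longrightarrow> j \<le> n \<Longrightarrow> surv j x \<le> C * V n x / sqrt (real (Suc j))"
    by (rule surv_bound) blast
  show ?thesis
  proof (rule that[of "2 * C"])
    fix x :: real and n :: nat assume xn: "a \<le> x" "2 \<le> n"
    have "sqrt (real n) \<le> sqrt (4 * real (Suc (n div 2)))"
    proof (rule real_sqrt_le_mono)
      have "n \<le> 4 * Suc (n div 2)" by simp
      then have "real n \<le> real (4 * Suc (n div 2))" by (rule of_nat_mono)
      then show "real n \<le> 4 * real (Suc (n div 2))" by simp
    qed
    also have "\<dots> = 2 * sqrt (real (Suc (n div 2)))" by (simp only: real_sqrt_mult real_sqrt_four)
    finally have r: "sqrt (real n) / 2 \<le> sqrt (real (Suc (n div 2)))" by simp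
    have "surv (n div 2) x \<le> C * V n x / sqrt (real (Suc (n div 2)))" by (rule C(2)[OF xn]) simp
    also have "\<dots> \<le> C * V n x / (sqrt (real n) / 2)"
      using r C(1) V_pos[OF xn] xn by (intro divide_left_mono mult_pos_pos) auto
    finally show "surv (n div 2) x \<le> 2 * C * V n x / sqrt n" by (simp add: mult_ac)
  qed (use C in simp)
qed

text \<open>Smooth the tail, apply \<open>kernel_asymptotics\<close>, and undo the additional variance \<open>v\<close> in the limit;
  all three errors are relative to \<open>V n x / sqrt n\<close>.\<close>

theorem tail_asymptotics_near:
  assumes eps: "0 < \<epsilon>"
  shows "\<forall>\<^sub>F n in sequentially. \<forall>x u f. a \<le> x \<longrightarrow> 0 \<le> u \<longrightarrow> tail_test u n f \<longrightarrow>
    \<bar>Kn n f x - limit_tail u n x\<bar> \<le> \<epsilon> * V n x / sqrt n"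
proof -
  obtain C where C: "0 \<le> C" "\<And>x n. a \<le> x \<Longrightarrow> 2 \<le> n \<Longrightarrow> surv (n div 2) x \<le> C * V n x / sqrt n"
    by (rule surv_half_le) blast
  \<comment> \<open>\<open>C\<close> from smoothing, \<open>2 * start_const\<close> and \<open>4 * start_const\<close> from changing the variance in value and slope.\<close>
  define D where "D = C + 6 * start_const"
  have D: "0 < D" using C start_const_ge_1 by (simp add: D_def)
  define e where "e = \<epsilon> / (2 * D)"
  have e: "0 < e" "e * D = \<epsilon> / 2" using eps D by (auto simp: e_def)
  obtain v where v: "0 < v" "v \<le> 1" "v \<le> e"
    and ev: "\<forall>\<^sub>F n in sequentially. \<forall>x u f. 0 \<le> u \<longrightarrow> tail_test u n f \<longrightarrow>
       \<bar>Kn n f x - Kn n (\<lambda>z. killed_tail u (z / sqrt n) v) x\<bar> \<le> e * surv (n div 2) x"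
    by (rule smoothing_error[OF e(1)]) blast
  have "\<forall>\<^sub>F n in sequentially. \<forall>x\<ge>a. \<forall>u.
    \<bar>Kn n (\<lambda>z. killed_tail u (z / sqrt n) v) x - killed_tail u (x / sqrt n) (v + 1)
       - killed_slope u (v + 1) * mean_overshoot n x / sqrt n\<bar> \<le> \<epsilon> / 2 * V n x / sqrt n"
    using eps by (intro kernel_asymptotics v) auto
  with ev show ?thesis
    using eventually_ge_at_top[of 2]
  proof eventually_elim
    case (elim n)
    show ?case
    proof (intro allI impI)
      fix x u f assume x: "a \<le> x" and u: "0 \<le> u" and f: "tail_test u n f"
      define r where "r = V n x / sqrt n"
      have r: "0 < r" using V_pos[OF x elim(3)] elim(3) by (simp add: r_def)
      have rn: "sqrt (real n) > 0" using elim(3) by simp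
      define A where "A = Kn n (\<lambda>z. killed_tail u (z / sqrt n) v) x"
      have 1: "\<bar>Kn n f x - A\<bar> \<le> e * C * r"
      proof -
        have "\<bar>Kn n f x - A\<bar> \<le> e * surv (n div 2) x" unfolding A_def using elim(1) u f by blast
        also have "\<dots> \<le> e * (C * V n x / sqrt n)" using e by (intro mult_left_mono C x elim) auto
        finally show ?thesis by (simp add: r_def)
      qed
      have 2: "\<bar>A - killed_tail u (x / sqrt n) (v + 1) - killed_slope u (v + 1) * mean_overshoot n x / sqrt n\<bar> \<le> \<epsilon> / 2 * r"
        using elim(2) x by (simp add: A_def r_def)
      have 3: "\<bar>killed_tail u (x / sqrt n) (v + 1) - killed_tail u (x / sqrt n) 1\<bar> \<le> 2 * start_const * e * r"
      proof -
        have "\<bar>killed_tail u (x / sqrt n) (v + 1) - killed_tail u (x / sqrt n) 1\<bar> \<le> 2 / 1\<^sup>2 * \<bar>x / sqrt n\<bar> * \<bar>v + 1 - 1\<bar>"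
          using v by (intro killed_tail_time) auto
        also have "\<dots> = 2 * v * (\<bar>x\<bar> / sqrt n)" using v rn by simp
        also have "\<dots> \<le> 2 * e * (start_const * V n x / sqrt n)"
          using v e rn by (intro mult_mono divide_right_mono abs_le_V x elim) auto
        finally show ?thesis by (simp add: r_def mult_ac)
      qed
      have 4: "\<bar>killed_slope u (v + 1) * mean_overshoot n x / sqrt n - killed_slope u 1 * mean_overshoot n x / sqrt n\<bar>
          \<le> 4 * start_const * e * r"
      proof -
        have "killed_slope u (v + 1) * mean_overshoot n x / sqrt n - killed_slope u 1 * mean_overshoot n x / sqrt n
            = (killed_slope u (v + 1) - killed_slope u 1) * (mean_overshoot n x / sqrt n)"
          by (simp add: left_diff_distrib diff_divide_distrib)
        then have "\<bar>killed_slope u (v + 1) * mean_overshoot n x / sqrt n - killed_slope u 1 * mean_overshoot n x / sqrt n\<bar>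
            = \<bar>killed_slope u (v + 1) - killed_slope u 1\<bar> * (mean_overshoot n x / sqrt n)"
          using mean_overshoot_nonneg[of n x] rn by (simp add: abs_mult)
        also have "\<dots> \<le> (2 / 1\<^sup>2 * \<bar>v + 1 - 1\<bar>) * (2 * start_const * V n x / sqrt n)"
          using v rn mean_overshoot_nonneg[of n x]
          by (intro mult_mono divide_right_mono mean_overshoot_le_V killed_slope_time x elim) auto
        also have "\<dots> = v * (4 * start_const * r)" using v by (simp add: r_def)
        also have "\<dots> \<le> e * (4 * start_const * r)"
          using v r start_const_ge_1 by (intro mult_right_mono) auto
        finally show ?thesis by (simp add: mult_ac)
      qed
      have "e * C * r + 2 * start_const * e * r + 4 * start_const * e * r = (e * D) * r"
        by (simp add: D_def algebra_simps)
      then have "e * C * r + 2 * start_const * e * r + 4 * start_const * e * r = \<epsilon> / 2 * r"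
        unfolding e(2) .
      then have "\<bar>Kn n f x - limit_tail u n x\<bar> \<le> \<epsilon> * r"
        using abs_chain[OF 1 2 3 4] unfolding limit_tail_def by simp
      then show "\<bar>Kn n f x - limit_tail u n x\<bar> \<le> \<epsilon> * V n x / sqrt n" by (simp add: r_def)
    qed
  qed
qed

text \<open>For \<open>t \<ge> 0\<close> by concavity of the normal distribution function. For \<open>t < 0\<close> the negative first term
  is at most linear, and the overshoot compensates because \<open>V\<close> is nonnegative.\<close>

lemma limit_tail_0_lower:
  assumes x: "\<bar>x / sqrt n\<bar> \<le> M" and n: "n > 0" and V: "0 \<le> V n x"
  shows "2 * phi M * (V n x / sqrt n) \<le> limit_tail 0 n x"
proof -
  define t where "t = x / sqrt n"
  define m where "m = mean_overshoot n x / sqrt n"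
  have m: "0 \<le> m" using mean_overshoot_nonneg[of n x] by (simp add: m_def)
  have Vt: "V n x / sqrt n = t + m" by (simp add: V_eq t_def m_def add_divide_distrib)
  have M0: "0 \<le> M" using x by linarith
  have slope: "2 * phi M \<le> killed_slope 0 1"
    using phi_antimono[of 0 M] M0 by (simp add: killed_slope_0_eq)
  have lt: "limit_tail 0 n x = killed_tail 0 t 1 + killed_slope 0 1 * m"
    by (simp add: limit_tail_def t_def m_def)
  show ?thesis
  proof (cases "0 \<le> t")
    case True
    have "2 * phi M * t \<le> killed_tail 0 t 1"
      using True x unfolding t_def[symmetric] by (intro killed_tail_0_bounds) linarith+
    moreover have "2 * phi M * m \<le> killed_slope 0 1 * m" using slope m by (rule mult_right_mono)
    ultimately show ?thesis unfolding Vt lt by (simp add: distrib_left)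
  next
    case False
    have "killed_tail 0 (- t) 1 \<le> killed_slope 0 1 * (- t)"
      using False x unfolding t_def[symmetric] by (intro killed_tail_0_bounds(2)[of _ M]) linarith+
    then have "killed_slope 0 1 * (t + m) \<le> limit_tail 0 n x"
      unfolding lt by (simp add: killed_tail_minus distrib_left)
    moreover have "0 \<le> t + m" using V n Vt[symmetric] by simp
    then have "2 * phi M * (t + m) \<le> killed_slope 0 1 * (t + m)"
      by (intro mult_right_mono slope)
    ultimately show ?thesis unfolding Vt by simp
  qed
qed

text \<open>By monotonicity of survival in the starting point, starting beyond \<open>M * sqrt n\<close> makes killing
  unlikely once it is unlikely from \<open>M * sqrt n\<close>, and there \<open>tail_asymptotics_near\<close> applies. Without
  killing the Lindeberg errors sum to \<open>o(1)\<close>, uniformly in \<open>x\<close>.\<close>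

theorem tail_asymptotics_far:
  assumes eps: "0 < \<epsilon>"
  obtains M where "1 \<le> M"
    "\<forall>\<^sub>F n in sequentially. \<forall>x u f. M * sqrt n \<le> x \<longrightarrow> 0 \<le> u \<longrightarrow> tail_test u n f \<longrightarrow>
       1 - surv n x \<le> \<epsilon> \<and> \<bar>Kn n f x - killed_tail u (x / sqrt n) 1\<bar> \<le> \<epsilon>"
proof -
  have "\<forall>\<^sub>F M in at_top. 1 - \<epsilon> / 8 < killed_tail 0 M 1"
    using eps by (intro order_tendstoD(1)[OF killed_tail_0_tendsto]) auto
  then have "\<forall>\<^sub>F M in at_top. 1 - \<epsilon> / 8 < killed_tail 0 M 1 \<and> M \<ge> 1 \<and> M \<ge> \<bar>a\<bar>"
    using eventually_ge_at_top[of 1] eventually_ge_at_top[of "\<bar>a\<bar>"] by eventually_elim auto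
  then obtain M where M: "1 - \<epsilon> / 8 < killed_tail 0 M 1" "1 \<le> M" "\<bar>a\<bar> \<le> M"
    using eventually_happens[of _ "at_top :: real filter"] by force
  obtain C1 where C1: "0 \<le> C1" "\<And>z. a \<le> z \<Longrightarrow> lyap z \<le> 1 * \<bar>z\<bar> + C1"
    by (rule lyap_sublinear_start[of 1]) auto
  \<comment> \<open>\<open>B\<close> bounds \<open>V n y / sqrt n\<close> at \<open>y = M * sqrt n\<close>.\<close>
  define B where "B = 2 * M + C1"
  have B: "0 < B" using M C1 by (simp add: B_def)
  have near: "\<forall>\<^sub>F n in sequentially. \<forall>x u f. a \<le> x \<longrightarrow> 0 \<le> u \<longrightarrow> tail_test u n f \<longrightarrow>
    \<bar>Kn n f x - limit_tail u n x\<bar> \<le> \<epsilon> / (8 * B) * V n x / sqrt n"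
    using eps B by (intro tail_asymptotics_near) auto
  obtain v where v: "0 < v" "v \<le> 1" "v \<le> \<epsilon> / 8"
    and smooth: "\<forall>\<^sub>F n in sequentially. \<forall>x u f. 0 \<le> u \<longrightarrow> tail_test u n f \<longrightarrow>
       \<bar>Kn n f x - Kn n (\<lambda>z. killed_tail u (z / sqrt n) v) x\<bar> \<le> \<epsilon> / 8 * surv (n div 2) x"
    using smoothing_error[of "\<epsilon> / 8"] eps by auto
  have "(\<lambda>n. 2 * lindeberg_const v * (real n * lindeberg_rate n)) \<longlonglongrightarrow> 2 * lindeberg_const v * 0"
    by (intro tendsto_mult tendsto_const lindeberg_rate_tendsto)
  then have lind: "\<forall>\<^sub>F n in sequentially. 2 * lindeberg_const v * (real n * lindeberg_rate n) < \<epsilon> / 8"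
    using eps by (intro order_tendstoD(2)) auto
  show ?thesis
  proof (rule that[OF M(2)])
    show "\<forall>\<^sub>F n in sequentially. \<forall>x u f. M * sqrt n \<le> x \<longrightarrow> 0 \<le> u \<longrightarrow> tail_test u n f \<longrightarrow>
       1 - surv n x \<le> \<epsilon> \<and> \<bar>Kn n f x - killed_tail u (x / sqrt n) 1\<bar> \<le> \<epsilon>"
      using near smooth lind eventually_ge_at_top[of 2]
    proof eventually_elim
      case (elim n)
      have rn: "1 \<le> sqrt (real n)" using elim(4) by simp
      define y where "y = M * sqrt n"
      have "M * 1 \<le> y" unfolding y_def using M rn by (intro mult_left_mono) auto
      then have y: "a \<le> y" "0 \<le> y" using M by auto
      have yn: "y / sqrt n = M" using rn by (auto simp: y_def)
      have Vy: "V n y / sqrt n \<le> B"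
      proof -
        have "V n y \<le> y + lyap y" using mean_overshoot_le_lyap[of n y] by (simp add: V_eq)
        also have "\<dots> \<le> 2 * y + C1" using C1(2)[OF y(1)] y by simp
        also have "\<dots> \<le> 2 * M * sqrt n + C1 * sqrt n"
          using mult_left_mono[OF rn C1(1)] by (simp add: y_def)
        also have "\<dots> = B * sqrt n" by (simp add: B_def algebra_simps)
        finally show ?thesis using rn by (simp add: pos_divide_le_eq)
      qed
      have surv_y: "1 - surv n y \<le> \<epsilon> / 4"
      proof -
        have "\<bar>surv n y - limit_tail 0 n y\<bar> \<le> \<epsilon> / (8 * B) * V n y / sqrt n"
          using elim(1) y tail_test_one[of n] unfolding surv_def by blast
        also have "\<dots> = \<epsilon> / (8 * B) * (V n y / sqrt n)" by simp
        also have "\<dots> \<le> \<epsilon> / (8 * B) * B" using Vy eps B by (intro mult_left_mono) auto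
        also have "\<dots> = \<epsilon> / 8" using B by simp
        finally have "limit_tail 0 n y - \<epsilon> / 8 \<le> surv n y" by linarith
        moreover have "killed_tail 0 M 1 \<le> limit_tail 0 n y"
          using mean_overshoot_nonneg[of n y] killed_slope_bounds(1)[of 1 1 0]
          by (simp add: limit_tail_def yn)
        ultimately show ?thesis using M(1) by linarith
      qed
      show ?case
      proof (intro allI impI conjI)
        fix x u f assume x: "M * sqrt n \<le> x" and u: "0 \<le> u" and f: "tail_test u n f"
        have sx: "1 - surv n x \<le> \<epsilon> / 4"
          using surv_mono[of y x n] x surv_y by (simp add: y_def)
        then show "1 - surv n x \<le> \<epsilon>" using eps by linarith
        define A where "A = Kn n (\<lambda>z. killed_tail u (z / sqrt n) v) x"
        have "\<bar>Kn n f x - A\<bar> \<le> \<epsilon> / 8 * surv (n div 2) x"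
          unfolding A_def using elim(2) u f by blast
        also have "\<dots> \<le> \<epsilon> / 8 * 1" using eps by (intro mult_left_mono surv_le_1) auto
        finally have 1: "\<bar>Kn n f x - A\<bar> \<le> \<epsilon> / 8" by simp
        have 2: "\<bar>A - killed_tail u (x / sqrt n) (v + 1)\<bar> \<le> \<epsilon> / 8 + \<epsilon> / 4"
          using kernel_Kn_far[OF v(1,2), of n u x] elim(3,4) sx
          by (simp add: A_def killed_kernel_def[abs_def])
        have "\<bar>killed_tail u (x / sqrt n) (v + 1) - killed_tail u (x / sqrt n) 1\<bar> \<le> 2 / 1\<^sup>2 * \<bar>v + 1 - 1\<bar>"
          using v by (intro killed_tail_time(2)) auto
        then have 3: "\<bar>killed_tail u (x / sqrt n) (v + 1) - killed_tail u (x / sqrt n) 1\<bar> \<le> \<epsilon> / 4"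
          using v by simp
        show "\<bar>Kn n f x - killed_tail u (x / sqrt n) 1\<bar> \<le> \<epsilon>" using 1 2 3 eps by linarith
      qed
    qed
  qed
qed

lemma ratio_far:
  fixes p s k l \<epsilon> :: real
  assumes "\<bar>p - k\<bar> \<le> \<epsilon>" "\<bar>s - l\<bar> \<le> \<epsilon>" "1 - s \<le> \<epsilon>" "\<epsilon> \<le> 1 / 4" "\<bar>k\<bar> \<le> 1"
  shows "0 < s" "\<bar>p / s - k / l\<bar> \<le> 8 * \<epsilon>"
proof -
  have e0: "0 \<le> \<epsilon>" using assms(1) by linarith
  have s: "3 / 4 \<le> s" and l: "1 / 2 \<le> l" using assms by linarith+
  then show "0 < s" by simp
  have "p / s - k / l = (p - k) / s + k * ((l - s) / (s * l))"
    using s l by (simp add: field_simps)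
  then have "\<bar>p / s - k / l\<bar> \<le> \<bar>p - k\<bar> / s + \<bar>k\<bar> * (\<bar>l - s\<bar> / (s * l))"
    using s l abs_triangle_ineq[of "(p - k) / s" "k * ((l - s) / (s * l))"] by (simp add: abs_mult)
  also have "\<dots> \<le> \<epsilon> / (1 / 2) + 1 * (\<epsilon> / (1 / 2 * (1 / 2)))"
    using assms s l e0 by (intro add_mono mult_mono frac_le) auto
  also have "\<dots> \<le> 8 * \<epsilon>" using e0 by simp
  finally show "\<bar>p / s - k / l\<bar> \<le> 8 * \<epsilon>" .
qed

lemma ratio_near:
  fixes p s D0 Du lam r c e1 e2 :: real
  assumes "\<bar>p - Du\<bar> \<le> e1 * r" "\<bar>s - D0\<bar> \<le> e1 * r" "c * r \<le> D0" "\<bar>lam\<bar> \<le> L" "0 < r"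
    and "\<bar>Du - lam * D0\<bar> \<le> e2 * r" "e1 \<le> c / 2" "0 < c"
  shows "0 < s" "\<bar>p / s - lam\<bar> \<le> 2 / c * (e1 * (1 + L) + e2)"
proof -
  have "e1 * r \<le> c / 2 * r" using assms by (intro mult_right_mono) auto
  then have s: "c / 2 * r \<le> s" using assms(2,3) by linarith
  have cr: "0 < c / 2 * r" using assms by simp
  then show s0: "0 < s" using s by linarith
  have e1r: "0 \<le> e1 * r" using assms(1) by linarith
  have "p - lam * s = (p - Du) + (Du - lam * D0) - lam * (s - D0)" by (simp add: algebra_simps)
  then have "\<bar>p - lam * s\<bar> \<le> \<bar>p - Du\<bar> + \<bar>Du - lam * D0\<bar> + \<bar>lam\<bar> * \<bar>s - D0\<bar>"
    unfolding abs_mult[symmetric] by linarith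
  also have "\<dots> \<le> e1 * r + e2 * r + L * (e1 * r)"
    using assms e1r by (intro add_mono mult_mono) auto
  finally have num: "\<bar>p - lam * s\<bar> \<le> (e1 * (1 + L) + e2) * r" by (simp add: algebra_simps)
  have n0: "0 \<le> (e1 * (1 + L) + e2) * r" using num by linarith
  have "\<bar>p / s - lam\<bar> = \<bar>p - lam * s\<bar> / s" using s0 by (simp add: diff_divide_distrib[symmetric] abs_divide field_simps)
  also have "\<dots> \<le> (e1 * (1 + L) + e2) * r / (c / 2 * r)"
    using num s cr n0 by (intro frac_le) auto
  also have "\<dots> = 2 / c * (e1 * (1 + L) + e2)" using assms by (simp add: field_simps)
  finally show "\<bar>p / s - lam\<bar> \<le> 2 / c * (e1 * (1 + L) + e2)" .
qed

text \<open>The ratio of the leading terms is a mediant of \<open>meander_tail u t\<close>, from Brownian motion, and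
  \<open>meander_tail u 0\<close>, from the overshoots, where \<open>t = x / sqrt n\<close>. If \<open>t\<close> is small, the two agree; if \<open>t\<close>
  is of order one, the mean overshoot is negligible against \<open>x\<close> by sublinearity. Both cases
  follow from the smallness of \<open>\<bar>t\<bar>\<close> times the mean overshoot. For large \<open>t\<close> killing disappears.\<close>

theorem conditional_tail_limit:
  assumes eps: "0 < \<epsilon>"
  shows "\<forall>\<^sub>F n in sequentially. \<forall>x u f. a \<le> x \<longrightarrow> 0 \<le> u \<longrightarrow> tail_test u n f \<longrightarrow>
    0 < surv n x \<and> \<bar>Kn n f x / surv n x - meander_tail u (x / sqrt n)\<bar> \<le> \<epsilon>"
proof -
  define e where "e = min (\<epsilon> / 8) (1 / 4)"
  have e: "0 < e" "e \<le> 1 / 4" "8 * e \<le> \<epsilon>" using eps by (auto simp: e_def)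
  obtain M where M: "1 \<le> M"
    and far: "\<forall>\<^sub>F n in sequentially. \<forall>x u f. M * sqrt n \<le> x \<longrightarrow> 0 \<le> u \<longrightarrow> tail_test u n f \<longrightarrow>
       1 - surv n x \<le> e \<and> \<bar>Kn n f x - killed_tail u (x / sqrt n) 1\<bar> \<le> e"
    by (rule tail_asymptotics_far[OF e(1)]) blast
  define c where "c = 2 * phi M"
  define L where "L = 2 / phi M"
  have c: "0 < c" "0 \<le> L" using phi_pos[of M] by (auto simp: c_def L_def)
  define e1 where "e1 = min (c / 2) (\<epsilon> * c / (4 * (1 + L)))"
  have e1: "0 < e1" "e1 \<le> c / 2" "2 / c * (e1 * (1 + L)) \<le> \<epsilon> / 2"
  proof -
    show "0 < e1" using c eps by (auto simp: e1_def)
    show "e1 \<le> c / 2" unfolding e1_def by (rule min.cobounded1)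
    have "e1 \<le> \<epsilon> * c / (4 * (1 + L))" unfolding e1_def by (rule min.cobounded2)
    then have "e1 * (4 * (1 + L)) \<le> \<epsilon> * c" using c by (subst (asm) pos_le_divide_eq) auto
    then have "e1 * (1 + L) \<le> \<epsilon> * c / 4" by (simp add: algebra_simps)
    then have "2 / c * (e1 * (1 + L)) \<le> 2 / c * (\<epsilon> * c / 4)" using c by (intro mult_left_mono) auto
    then show "2 / c * (e1 * (1 + L)) \<le> \<epsilon> / 2" using c by simp
  qed
  have near: "\<forall>\<^sub>F n in sequentially. \<forall>x u f. a \<le> x \<longrightarrow> 0 \<le> u \<longrightarrow> tail_test u n f \<longrightarrow>
    \<bar>Kn n f x - limit_tail u n x\<bar> \<le> e1 * V n x / sqrt n"
    by (rule tail_asymptotics_near[OF e1(1)])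
  \<comment> \<open>The error of the mediant is at most \<open>G\<close> times \<open>V n x / sqrt n\<close> times the scaled mean overshoot.\<close>
  define G where "G = 8 / phi M * start_const"
  have G: "0 < G" using phi_pos[of M] start_const_ge_1 by (simp add: G_def)
  \<comment> \<open>The linear part of the mean overshoot bound must stay below a quarter of \<open>\<epsilon>\<close> after division by \<open>c / 2\<close>.\<close>
  define \<theta> where "\<theta> = \<epsilon> * c / (8 * G * M)"
  have th: "0 < \<theta>" "2 / c * (G * (\<theta> * M)) \<le> \<epsilon> / 4"
    using eps c G M by (auto simp: \<theta>_def)
  obtain C1 where C1: "0 \<le> C1" "\<And>z. a \<le> z \<Longrightarrow> lyap z \<le> \<theta> * \<bar>z\<bar> + C1"
    by (rule lyap_sublinear_start[OF th(1)]) auto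
  have "(\<lambda>n. 2 / c * G * C1 * (1 / sqrt (real n))) \<longlonglongrightarrow> 2 / c * G * C1 * 0"
    by (intro tendsto_intros tendsto_divide_0[OF tendsto_const]
        filterlim_compose[OF filterlim_at_top_imp_at_infinity[OF sqrt_at_top]] filterlim_real_sequentially)
  then have small: "\<forall>\<^sub>F n in sequentially. 2 / c * G * C1 * (1 / sqrt (real n)) < \<epsilon> / 4"
    using eps by (intro order_tendstoD(2)) auto
  have "\<forall>\<^sub>F n in sequentially. (nat \<lceil>a\<^sup>2\<rceil>) \<le> n" by (rule eventually_ge_at_top)
  with far near small show ?thesis
    using eventually_ge_at_top[of 2]
  proof eventually_elim
    case (elim n)
    have rn: "0 < sqrt (real n)" using elim(5) by simp
    have an: "\<bar>a\<bar> \<le> M * sqrt n"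
    proof -
      have "a\<^sup>2 \<le> real n" using elim(4) by linarith
      then have "\<bar>a\<bar> \<le> sqrt n" by (intro real_le_rsqrt) simp
      also have "\<dots> \<le> M * sqrt n" using mult_right_mono[OF M, of "sqrt n"] by simp
      finally show ?thesis .
    qed
    show ?case
    proof (intro allI impI)
      fix x u f assume x: "a \<le> x" and u: "0 \<le> u" and f: "tail_test u n f"
      define t where "t = x / sqrt n"
      show "0 < surv n x \<and> \<bar>Kn n f x / surv n x - meander_tail u (x / sqrt n)\<bar> \<le> \<epsilon>"
      proof (cases "M * sqrt n \<le> x")
        case True
        have s: "1 - surv n x \<le> e" "\<bar>Kn n f x - killed_tail u t 1\<bar> \<le> e"
          using elim(1) True u f unfolding t_def by blast+
        have s0: "\<bar>surv n x - killed_tail 0 t 1\<bar> \<le> e"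
          using elim(1) True tail_test_one[of n] unfolding t_def surv_def by blast
        have "0 < M * sqrt n" using M rn by simp
        then have "t \<noteq> 0" using True rn by (auto simp: t_def)
        then have mt: "meander_tail u t = killed_tail u t 1 / killed_tail 0 t 1" by (simp add: meander_tail_def)
        note r = ratio_far[OF s(2) s0 s(1) e(2) abs_killed_tail_le]
        show ?thesis using r e(3) unfolding t_def[symmetric] mt by linarith
      next
        case False
        define r where "r = V n x / sqrt n"
        have r: "0 < r" using V_pos[OF x elim(5)] rn by (simp add: r_def)
        have "\<bar>x\<bar> \<le> M * sqrt n" using False x an by linarith
        then have t: "\<bar>t\<bar> \<le> M" using rn by (simp add: t_def pos_divide_le_eq)
        have p: "\<bar>Kn n f x - limit_tail u n x\<bar> \<le> e1 * r"
          using elim(2) x u f unfolding r_def times_divide_eq_right by blast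
        have s: "\<bar>surv n x - limit_tail 0 n x\<bar> \<le> e1 * r"
          using elim(2) x tail_test_one[of n] unfolding r_def times_divide_eq_right surv_def by blast
        have low: "c * r \<le> limit_tail 0 n x"
          unfolding c_def r_def using t elim(5) V_pos[OF x elim(5)]
          by (intro limit_tail_0_lower) (auto simp: t_def)
        have xr: "\<bar>t\<bar> \<le> start_const * r"
          using divide_right_mono[OF abs_le_V[OF x elim(5)], of "sqrt n"] rn by (simp add: t_def r_def)
        define m where "m = mean_overshoot n x / sqrt n"
        have m: "0 \<le> m" "m \<le> \<theta> * M + C1 / sqrt n"
        proof -
          show "0 \<le> m" using mean_overshoot_nonneg by (simp add: m_def)
          have "mean_overshoot n x \<le> \<theta> * \<bar>x\<bar> + C1"
            using mean_overshoot_le_lyap[of n x] C1(2)[OF x] by linarith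
          then have "m \<le> (\<theta> * \<bar>x\<bar> + C1) / sqrt n" unfolding m_def by (rule divide_right_mono) simp
          also have "\<dots> = \<theta> * \<bar>t\<bar> + C1 / sqrt n" by (simp add: t_def add_divide_distrib)
          also have "\<dots> \<le> \<theta> * M + C1 / sqrt n" using t th by (intro add_right_mono mult_left_mono) auto
          finally show "m \<le> \<theta> * M + C1 / sqrt n" .
        qed
        have "limit_tail u n x - meander_tail u t * limit_tail 0 n x
            = (killed_slope u 1 - meander_tail u t * killed_slope 0 1) * m"
          using meander_tail_times[of u t]
          by (simp add: limit_tail_def t_def[symmetric] m_def algebra_simps)
        then have "\<bar>limit_tail u n x - meander_tail u t * limit_tail 0 n x\<bar>
            = \<bar>killed_slope u 1 - meander_tail u t * killed_slope 0 1\<bar> * m"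
          using m by (simp add: abs_mult)
        also have "\<dots> \<le> (8 / phi M * \<bar>t\<bar>) * m"
          by (intro mult_right_mono meander_tail_bounds t m)
        also have "\<dots> \<le> (8 / phi M * (start_const * r)) * (\<theta> * M + C1 / sqrt n)"
          using xr m phi_pos[of M] r start_const_ge_1 by (intro mult_mono mult_left_mono) auto
        also have "\<dots> = (G * (\<theta> * M + C1 / sqrt n)) * r" by (simp add: G_def)
        finally have d: "\<bar>limit_tail u n x - meander_tail u t * limit_tail 0 n x\<bar> \<le> (G * (\<theta> * M + C1 / sqrt n)) * r" .
        have lam: "\<bar>meander_tail u t\<bar> \<le> L" unfolding L_def by (rule meander_tail_bounds[OF t])
        note R = ratio_near[OF p s low lam r d e1(2) c(1)]
        have "2 / c * (e1 * (1 + L) + G * (\<theta> * M + C1 / sqrt n))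
            = 2 / c * (e1 * (1 + L)) + 2 / c * (G * (\<theta> * M)) + 2 / c * G * C1 * (1 / sqrt n)"
          by (simp add: distrib_left)
        also have "\<dots> \<le> \<epsilon>" using e1(3) th(2) elim(3) eps by linarith
        finally show ?thesis using R unfolding t_def[symmetric] by linarith
      qed
    qed
  qed
qed

end

section \<open>The walk on its probability space\<close>

text \<open>In \<open>y\<close>, the function \<open>psi t y\<close> has the antiderivative \<open>- Phi (t - y) - Phi (t + y)\<close>.\<close>

lemma integral_ell_H:
  assumes u: "0 \<le> u"
  shows "(LBINT y:{0..u}. ell_H t y) = 1 - meander_tail u t"
proof (cases "t = 0")
  case True
  have "(LBINT y:{0..u}. ell_H t y) = (\<integral>y. (y * exp (- y\<^sup>2 / 2)) * indicator {0..u} y \<partial>lborel)"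
    unfolding set_lebesgue_integral_def ell_H_def using True
    by (intro Bochner_Integration.integral_cong) auto
  also have "\<dots> = (- exp (- u\<^sup>2 / 2)) - (- exp (- 0\<^sup>2 / 2))"
    by (rule integral_FTC_Icc_real[OF u]) (auto intro!: derivative_eq_intros continuous_intros)
  also have "\<dots> = 1 - exp (- u\<^sup>2 / 2)" by simp
  also have "exp (- u\<^sup>2 / 2) = meander_tail u t"
    using True by (simp add: meander_tail_def killed_slope_def heat1_def std_normal_density_def)
  finally show ?thesis .
next
  case False
  have H: "H t = killed_tail 0 t 1" by (simp add: H_def killed_tail_0_eq)
  have "0 < 2 * phi \<bar>t\<bar> * \<bar>t\<bar>" using False phi_pos by simp
  also have "\<dots> \<le> \<bar>killed_tail 0 t 1\<bar>" by (rule killed_tail_0_abs_lower) simp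
  finally have H0: "H t \<noteq> 0" unfolding H by auto
  have "(LBINT y:{0..u}. ell_H t y) = (\<integral>y. (psi t y / H t) * indicator {0..u} y \<partial>lborel)"
    unfolding set_lebesgue_integral_def ell_H_def using False
    by (intro Bochner_Integration.integral_cong) auto
  also have "\<dots> = (- Phi (t - u) - Phi (t + u)) / H t - (- Phi (t - 0) - Phi (t + 0)) / H t"
  proof (rule integral_FTC_Icc_real[OF u])
    fix y
    show "((\<lambda>y. (- Phi (t - y) - Phi (t + y)) / H t) has_real_derivative psi t y / H t) (at y)"
      unfolding psi_def using H0 by (auto intro!: derivative_eq_intros)
    show "isCont (\<lambda>y. psi t y / H t) y"
      unfolding psi_def std_normal_density_def using H0 by (auto intro!: continuous_intros)
  qed
  also have "\<dots> = (H t - killed_tail u t 1) / H t"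
  proof -
    have "(- Phi (t - u) - Phi (t + u)) - (- Phi (t - 0) - Phi (t + 0)) = H t - killed_tail u t 1"
      by (simp add: H_def killed_tail_def heat_def)
    then show ?thesis by (simp only: diff_divide_distrib[symmetric])
  qed
  also have "\<dots> = 1 - meander_tail u t"
    using False H0 by (simp add: meander_tail_def H diff_divide_distrib)
  finally show ?thesis .
qed

definition alive :: "(nat \<Rightarrow> 'a \<Rightarrow> real) \<Rightarrow> real \<Rightarrow> nat \<Rightarrow> 'a \<Rightarrow> bool" where
  "alive X x n \<omega> \<longleftrightarrow> (\<forall>k\<in>{1..n}. 0 \<le> x + walk X k \<omega>)"

lemma alive_0 [simp]: "alive X x 0 \<omega>"
  by (simp add: alive_def)

lemma alive_Suc: "alive X x (Suc n) \<omega> \<longleftrightarrow> alive X x n \<omega> \<and> 0 \<le> x + walk X (Suc n) \<omega>"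
  by (auto simp: alive_def le_Suc_eq)

lemma exit_time_gt_iff: "enat n < exit_time X x \<omega> \<longleftrightarrow> alive X x n \<omega>"
proof
  assume gt: "enat n < exit_time X x \<omega>"
  show "alive X x n \<omega>"
    unfolding alive_def
  proof (intro ballI leI notI)
    fix k assume k: "k \<in> {1..n}" "x + walk X k \<omega> < 0"
    then have "exit_time X x \<omega> \<le> enat k" unfolding exit_time_def by (intro Inf_lower) auto
    also have "\<dots> \<le> enat n" using k by simp
    finally show False using gt by simp
  qed
next
  assume al: "alive X x n \<omega>"
  have "enat (Suc n) \<le> exit_time X x \<omega>"
    unfolding exit_time_def
  proof (rule Inf_greatest)
    fix t assume "t \<in> {enat k |k. 1 \<le> k \<and> x + walk X k \<omega> < 0}"
    then obtain k where k: "t = enat k" "1 \<le> k" "x + walk X k \<omega> < 0" by auto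
    have "n < k"
    proof (rule ccontr)
      assume "\<not> n < k"
      then have "0 \<le> x + walk X k \<omega>" using al k by (auto simp: alive_def)
      with k show False by simp
    qed
    then show "enat (Suc n) \<le> t" using k by simp
  qed
  then show "enat n < exit_time X x \<omega>" by (metis enat_ord_simps(2) lessI less_le_trans)
qed

locale iid_walk = prob_space M for M :: "'a measure" +
  fixes X :: "nat \<Rightarrow> 'a \<Rightarrow> real" and \<sigma> \<delta> :: real
  assumes indep: "indep_vars (\<lambda>_. borel) X {1..}"
    and ident: "\<And>i. i \<ge> 1 \<Longrightarrow> distr M borel (X i) = distr M borel (X 1)"
    and integrable_X: "integrable M (X 1)" and mean_X: "(LINT \<omega>|M. X 1 \<omega>) = 0"
    and integrable_X2: "integrable M (\<lambda>\<omega>. (X 1 \<omega>)\<^sup>2)" and var_X: "(LINT \<omega>|M. (X 1 \<omega>)\<^sup>2) = \<sigma>\<^sup>2"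
    and sigma: "\<sigma> > 0" and delta_pos: "\<delta> > 0"
    and moment_X: "integrable M (\<lambda>\<omega>. \<bar>X 1 \<omega>\<bar> powr (2 + \<delta>))"
begin

lemma measurable_X [measurable]: "1 \<le> i \<Longrightarrow> X i \<in> borel_measurable M"
  using indep by (auto simp: indep_vars_def)

lemma measurable_walk [measurable]: "walk X n \<in> borel_measurable M"
  unfolding walk_def[abs_def] by (intro borel_measurable_sum) auto

lemma measurable_alive [measurable]: "Measurable.pred M (alive X x n)"
  unfolding alive_def[abs_def] by measurable

lemma measurable_walk_at_exit [measurable]: "walk_at_exit X x \<in> borel_measurable M"
proof -
  have eq_iff: "exit_time X x \<omega> = t \<longleftrightarrow> (\<forall>n. alive X x n \<omega> \<longleftrightarrow> enat n < t)" for t \<omega>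
    unfolding exit_time_gt_iff[symmetric]
  proof
    assume eq: "\<forall>n. enat n < exit_time X x \<omega> \<longleftrightarrow> enat n < t"
    show "exit_time X x \<omega> = t"
    proof (rule antisym)
      show "exit_time X x \<omega> \<le> t"
      proof (cases t)
        case (enat m)
        then show ?thesis using eq[rule_format, of m] by simp
      qed simp
      show "t \<le> exit_time X x \<omega>"
      proof (cases "exit_time X x \<omega>")
        case (enat m)
        then show ?thesis using eq[rule_format, of m] by simp
      qed simp
    qed
  qed simp
  have "t \<in> insert \<infinity> (range enat)" for t by (cases t) auto
  then have "(UNIV :: enat set) = insert \<infinity> (range enat)" by blast
  moreover have "countable (insert \<infinity> (range enat))" by (intro countable_insert countable_image) simp
  ultimately have cnt: "countable (UNIV :: enat set)" by (simp only:)
  have "(\<lambda>\<omega>. exit_time X x \<omega>) \<in> measurable M (count_space UNIV)"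
    unfolding measurable_count_space_eq_countable[OF cnt]
  proof safe
    fix t
    have "(\<lambda>\<omega>. exit_time X x \<omega>) -` {t} \<inter> space M = {\<omega> \<in> space M. \<forall>n. alive X x n \<omega> \<longleftrightarrow> enat n < t}"
      using eq_iff by auto
    also have "\<dots> \<in> sets M" by measurable
    finally show "(\<lambda>\<omega>. exit_time X x \<omega>) -` {t} \<inter> space M \<in> sets M" .
  qed simp
  then have "(\<lambda>\<omega>. (\<lambda>t. case t of enat k \<Rightarrow> walk X k \<omega> | \<infinity> \<Rightarrow> 0) (exit_time X x \<omega>)) \<in> borel_measurable M"
    by (rule measurable_compose_countable'[OF _ _ cnt, rotated]) (simp split: enat.split)
  then show ?thesis by (simp add: walk_at_exit_def[abs_def])
qed

definition law :: "real measure" where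
  "law = distr M borel (\<lambda>\<omega>. X 1 \<omega> / \<sigma>)"

text \<open>Higher moments imply lower ones, so the exponent may be capped at three, the order of the Taylor
  expansion.\<close>

sublocale law: moment_law law "min \<delta> 1"
proof -
  have [measurable]: "X 1 \<in> borel_measurable M" by simp
  have powr_le: "\<bar>y\<bar> powr (2 + min \<delta> 1) \<le> 1 + \<bar>y\<bar> powr (2 + \<delta>)" for y :: real
  proof (cases "\<bar>y\<bar> \<le> 1")
    case True
    then have "\<bar>y\<bar> powr (2 + min \<delta> 1) \<le> 1" using delta_pos by (intro powr_le1) auto
    then show ?thesis by (simp add: add_increasing2)
  next
    case False
    then have "\<bar>y\<bar> powr (2 + min \<delta> 1) \<le> \<bar>y\<bar> powr (2 + \<delta>)" by (intro powr_mono) auto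
    then show ?thesis by simp
  qed
  have int_moment: "integrable M (\<lambda>\<omega>. \<bar>X 1 \<omega>\<bar> powr (2 + min \<delta> 1))"
  proof (rule Bochner_Integration.integrable_bound)
    show "integrable M (\<lambda>\<omega>. 1 + \<bar>X 1 \<omega>\<bar> powr (2 + \<delta>))" using moment_X by auto
    show "AE \<omega> in M. norm (\<bar>X 1 \<omega>\<bar> powr (2 + min \<delta> 1)) \<le> norm (1 + \<bar>X 1 \<omega>\<bar> powr (2 + \<delta>))"
      using powr_le by (intro AE_I2) (auto intro: order_trans)
  qed measurable
  interpret L: prob_space law unfolding law_def by (rule prob_space_distr) simp
  show "moment_law law (min \<delta> 1)"
  proof
    show "sets law = sets borel" by (simp add: law_def)
    show "integrable law (\<lambda>y. y)"
      unfolding law_def using integrable_X by (subst integrable_distr_eq) auto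
    show "integrable law (\<lambda>y. y\<^sup>2)"
      unfolding law_def using integrable_X2 by (subst integrable_distr_eq) (auto simp: power_divide)
    show "integral\<^sup>L law (\<lambda>y. y) = 0"
      unfolding law_def using mean_X by (subst integral_distr) auto
    show "0 < min \<delta> 1" "min \<delta> 1 \<le> 1" using delta_pos by auto
    show "integral\<^sup>L law (\<lambda>y. y\<^sup>2) = 1"
      unfolding law_def using var_X sigma by (subst integral_distr) (auto simp: power_divide)
    show "integrable law (\<lambda>y. \<bar>y\<bar> powr (2 + min \<delta> 1))"
      unfolding law_def using int_moment sigma
      by (subst integrable_distr_eq) (auto simp: powr_divide)
  qed
qed

lemma nn_integral_law:
  assumes [measurable]: "f \<in> borel_measurable borel" and i: "1 \<le> i"
  shows "(\<integral>\<^sup>+y. f (y / \<sigma>) \<partial>distr M borel (X i)) = (\<integral>\<^sup>+y. f y \<partial>law)"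
  unfolding ident[OF i] law_def
  by (subst (1 2) nn_integral_distr) auto

text \<open>The next step is independent of the path so far, so it can be integrated out (Fubini).\<close>

lemma nn_integral_one_step:
  assumes g: "sq_growth g" and g0: "\<And>z. 0 \<le> g z"
  shows "(\<integral>\<^sup>+\<omega>. indicator {\<omega>. alive X x n \<omega>} \<omega> * ennreal (g ((x + walk X (Suc n) \<omega>) / \<sigma>)) \<partial>M)
    = (\<integral>\<^sup>+\<omega>. indicator {\<omega>. alive X x n \<omega>} \<omega> * ennreal (law.T g ((x + walk X n \<omega>) / \<sigma>)) \<partial>M)"
proof -
  have [measurable]: "g \<in> borel_measurable borel" using g by (rule sq_growth_measurable)
  define P where "P = (\<Pi>\<^sub>M i\<in>{1..n}. (borel :: real measure))"
  define Z where "Z = (\<lambda>\<omega>. restrict (\<lambda>i. X i \<omega>) {1..n})"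
  define s where "s k z = x + (\<Sum>i=1..k. z i)" for k :: nat and z :: "nat \<Rightarrow> real"
  define I where "I z = (if \<forall>k\<in>{1..n}. 0 \<le> s k z then 1 else 0 :: ennreal)" for z
  have s_meas: "s k \<in> borel_measurable P" if "k \<le> n" for k
    unfolding s_def[abs_def] P_def using that
    by (intro borel_measurable_add borel_measurable_const borel_measurable_sum measurable_component_singleton) auto
  have sn_meas [measurable]: "s n \<in> borel_measurable P" by (rule s_meas) simp
  have I_meas [measurable]: "I \<in> borel_measurable P"
    unfolding I_def[abs_def]
  proof (rule measurable_If)
    show "{z \<in> space P. \<forall>k\<in>{1..n}. 0 \<le> s k z} \<in> sets P"
      by (intro sets.sets_Collect_finite_All borel_measurable_le s_meas borel_measurable_const) auto
  qed auto
  have s_Z: "s k (Z \<omega>) = x + walk X k \<omega>" if "k \<le> n" for k \<omega>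
    using that by (auto simp: s_def Z_def walk_def intro!: sum.cong)
  have I_Z: "I (Z \<omega>) = indicator {\<omega>. alive X x n \<omega>} \<omega>" for \<omega>
    using s_Z by (auto simp: I_def alive_def indicator_def)
  have Z_meas [measurable]: "Z \<in> measurable M P"
    unfolding Z_def P_def by (rule measurable_restrict) auto
  define Q where "Q = (\<Pi>\<^sub>M i\<in>{Suc n}. (borel :: real measure))"
  define W where "W = (\<lambda>\<omega>. restrict (\<lambda>i. X i \<omega>) {Suc n})"
  have W_meas [measurable]: "W \<in> measurable M Q"
    unfolding W_def Q_def by (rule measurable_restrict) auto
  have last_meas [measurable]: "(\<lambda>y. y (Suc n)) \<in> borel_measurable Q"
    unfolding Q_def by (rule measurable_component_singleton) simp
  have W_last: "W \<omega> (Suc n) = X (Suc n) \<omega>" for \<omega> by (simp add: W_def)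
  have ind: "indep_var P Z Q W"
    unfolding P_def Z_def Q_def W_def by (rule indep_var_restrict[OF indep]) auto
  define F where "F = (\<lambda>(z, y). I z * ennreal (g (s n z / \<sigma> + y (Suc n) / \<sigma>)))"
  have F_meas [measurable]: "F \<in> borel_measurable (P \<Otimes>\<^sub>M Q)"
    unfolding F_def by measurable
  interpret Y: prob_space "distr M Q W" by (rule prob_space_distr) measurable
  have joint: "distr M P Z \<Otimes>\<^sub>M distr M Q W = distr M (P \<Otimes>\<^sub>M Q) (\<lambda>\<omega>. (Z \<omega>, W \<omega>))"
    using ind unfolding indep_var_distribution_eq by blast
  have walk_Suc: "(x + walk X (Suc n) \<omega>) / \<sigma> = (x + walk X n \<omega>) / \<sigma> + X (Suc n) \<omega> / \<sigma>" for \<omega>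
    by (simp add: walk_def add_divide_distrib)
  have "(\<integral>\<^sup>+\<omega>. indicator {\<omega>. alive X x n \<omega>} \<omega> * ennreal (g ((x + walk X (Suc n) \<omega>) / \<sigma>)) \<partial>M)
      = (\<integral>\<^sup>+\<omega>. F (Z \<omega>, W \<omega>) \<partial>M)"
    by (intro nn_integral_cong) (simp add: F_def I_Z s_Z walk_Suc W_last)
  also have "\<dots> = (\<integral>\<^sup>+zy. F zy \<partial>distr M (P \<Otimes>\<^sub>M Q) (\<lambda>\<omega>. (Z \<omega>, W \<omega>)))"
    by (rule nn_integral_distr[symmetric]) measurable
  also have "\<dots> = (\<integral>\<^sup>+z. \<integral>\<^sup>+y. F (z, y) \<partial>distr M Q W \<partial>distr M P Z)"
    unfolding joint[symmetric] by (rule Y.nn_integral_fst[symmetric]) (simp cong: measurable_cong_sets)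
  also have "\<dots> = (\<integral>\<^sup>+z. I z * ennreal (law.T g (s n z / \<sigma>)) \<partial>distr M P Z)"
  proof (rule nn_integral_cong)
    fix z
    have "(\<integral>\<^sup>+y. F (z, y) \<partial>distr M Q W)
        = I z * (\<integral>\<^sup>+y. ennreal (g (s n z / \<sigma> + y (Suc n) / \<sigma>)) \<partial>distr M Q W)"
      unfolding F_def prod.case by (rule nn_integral_cmult) measurable
    also have "(\<integral>\<^sup>+y. ennreal (g (s n z / \<sigma> + y (Suc n) / \<sigma>)) \<partial>distr M Q W)
        = (\<integral>\<^sup>+\<omega>. ennreal (g (s n z / \<sigma> + X (Suc n) \<omega> / \<sigma>)) \<partial>M)"
      by (subst nn_integral_distr) (auto simp: W_last)
    also have "\<dots> = (\<integral>\<^sup>+y. ennreal (g (s n z / \<sigma> + y / \<sigma>)) \<partial>distr M borel (X (Suc n)))"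
      by (subst nn_integral_distr) auto
    also have "\<dots> = (\<integral>\<^sup>+y. ennreal (g (s n z / \<sigma> + y)) \<partial>law)"
      by (rule nn_integral_law) auto
    also have "\<dots> = ennreal (law.T g (s n z / \<sigma>))"
      unfolding law.T_def by (rule nn_integral_eq_integral[OF law.integrable_shift[OF g]]) (simp add: g0)
    finally show "(\<integral>\<^sup>+y. F (z, y) \<partial>distr M Q W) = I z * ennreal (law.T g (s n z / \<sigma>))" .
  qed
  also have "\<dots> = (\<integral>\<^sup>+\<omega>. I (Z \<omega>) * ennreal (law.T g (s n (Z \<omega>) / \<sigma>)) \<partial>M)"
  proof -
    have [measurable]: "law.T g \<in> borel_measurable borel"
      by (rule sq_growth_measurable[OF law.sq_growth_T[OF g]])
    show ?thesis by (rule nn_integral_distr) measurable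
  qed
  finally show ?thesis by (simp add: I_Z s_Z)
qed

lemma nn_integral_Kn:
  assumes "sq_growth f" "\<And>z. 0 \<le> f z"
  shows "(\<integral>\<^sup>+\<omega>. indicator {\<omega>. alive X x n \<omega>} \<omega> * ennreal (f ((x + walk X n \<omega>) / \<sigma>)) \<partial>M)
    = ennreal (law.Kn n f (x / \<sigma>))"
  using assms
proof (induction n arbitrary: f)
  case 0
  then show ?case by (simp add: walk_def emeasure_space_1)
next
  case (Suc n)
  let ?g = "\<lambda>z. indicator {0..} z * f z"
  have g: "sq_growth ?g" "\<And>z. 0 \<le> ?g z"
    using Suc.prems by (auto intro: sq_growth_indicator)
  have "(\<integral>\<^sup>+\<omega>. indicator {\<omega>. alive X x (Suc n) \<omega>} \<omega> * ennreal (f ((x + walk X (Suc n) \<omega>) / \<sigma>)) \<partial>M)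
      = (\<integral>\<^sup>+\<omega>. indicator {\<omega>. alive X x n \<omega>} \<omega> * ennreal (?g ((x + walk X (Suc n) \<omega>) / \<sigma>)) \<partial>M)"
    using sigma by (intro nn_integral_cong) (auto simp: alive_Suc indicator_def zero_le_divide_iff)
  also have "\<dots> = (\<integral>\<^sup>+\<omega>. indicator {\<omega>. alive X x n \<omega>} \<omega> * ennreal (law.K f ((x + walk X n \<omega>) / \<sigma>)) \<partial>M)"
    unfolding law.K_def by (rule nn_integral_one_step[OF g])
  also have "\<dots> = ennreal (law.Kn n (law.K f) (x / \<sigma>))"
    using Suc.prems by (intro Suc.IH law.sq_growth_K law.K_nonneg)
  finally show ?case by (simp only: funpow_Suc_right o_def)
qed

lemma prob_alive:
  assumes "A \<in> sets borel"
  shows "\<P>(\<omega> in M. alive X x n \<omega> \<and> (x + walk X n \<omega>) / \<sigma> \<in> A) = law.Kn n (indicator A) (x / \<sigma>)"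
proof -
  have [measurable]: "A \<in> sets borel" by fact
  have f: "sq_growth (indicator A :: real \<Rightarrow> real)"
    by (rule sq_growth_bounded[of _ 1]) (auto simp: indicator_def)
  let ?E = "{\<omega> \<in> space M. alive X x n \<omega> \<and> (x + walk X n \<omega>) / \<sigma> \<in> A}"
  have "emeasure M ?E = (\<integral>\<^sup>+\<omega>. indicator ?E \<omega> \<partial>M)" by (rule nn_integral_indicator[symmetric]) measurable
  also have "\<dots> = (\<integral>\<^sup>+\<omega>. indicator {\<omega>. alive X x n \<omega>} \<omega> * ennreal (indicator A ((x + walk X n \<omega>) / \<sigma>)) \<partial>M)"
    by (intro nn_integral_cong) (auto simp: indicator_def)
  also have "\<dots> = ennreal (law.Kn n (indicator A) (x / \<sigma>))" by (rule nn_integral_Kn[OF f]) simp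
  finally show ?thesis
    by (simp add: measure_def law.Kn_nonneg)
qed

lemma prob_exit_time_gt: "\<P>(\<omega> in M. exit_time X x \<omega> > enat n) = law.surv n (x / \<sigma>)"
proof -
  have "law.surv n = law.Kn n (indicator UNIV)"
    unfolding law.surv_def by (rule arg_cong[where f = "law.Kn n"]) auto
  then show ?thesis using prob_alive[of UNIV x n] by (simp add: exit_time_gt_iff)
qed

lemma conditional_prob_eq:
  assumes n: "n > 0" and pos: "0 < law.surv n (x / \<sigma>)"
  shows "\<P>(\<omega> in M. (x + walk X n \<omega>) / (\<sigma> * sqrt n) \<le> u \<bar> exit_time X x \<omega> > enat n)
    = 1 - law.Kn n (indicator {u * sqrt n<..}) (x / \<sigma>) / law.surv n (x / \<sigma>)"
proof -
  let ?f = "indicator {u * sqrt n<..} :: real \<Rightarrow> real"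
  have f: "sq_growth ?f" by (rule sq_growth_bounded[of _ 1]) (auto simp: indicator_def)
  have iff: "(x + walk X n \<omega>) / (\<sigma> * sqrt n) \<le> u \<longleftrightarrow> (x + walk X n \<omega>) / \<sigma> \<in> {..u * sqrt n}" for \<omega>
    using n sigma by (simp add: field_simps)
  have "law.Kn n (indicator {..u * sqrt n}) (x / \<sigma>) = law.Kn n (\<lambda>z. 1 - ?f z) (x / \<sigma>)"
    by (rule arg_cong[where f = "\<lambda>f. law.Kn n f (x / \<sigma>)"]) (auto simp: indicator_def)
  also have "\<dots> = law.surv n (x / \<sigma>) - law.Kn n ?f (x / \<sigma>)"
    unfolding law.surv_def by (rule law.Kn_diff[OF sq_growth_const f])
  finally have "\<P>(\<omega> in M. (x + walk X n \<omega>) / (\<sigma> * sqrt n) \<le> u \<and> exit_time X x \<omega> > enat n)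
      = law.surv n (x / \<sigma>) - law.Kn n ?f (x / \<sigma>)"
    using prob_alive[of "{..u * sqrt n}" x n] by (simp add: iff exit_time_gt_iff conj_commute)
  then show ?thesis
    using pos by (simp add: cond_prob_def prob_exit_time_gt diff_divide_distrib)
qed

text \<open>The walk started at \<open>x\<close> with steps \<open>X\<close> corresponds to the one started at \<open>x / \<sigma>\<close> with normalised
  steps, and \<open>x \<ge> a\<close> to \<open>x / \<sigma> \<ge> a / \<sigma>\<close>.\<close>

lemma sup_error_tendsto:
  assumes start: "0 < law.prob {y. 0 \<le> a / \<sigma> + y}"
  shows "sup_error M X \<sigma> a \<longlonglongrightarrow> 0"
proof -
  interpret start: started_law law "min \<delta> 1" "a / \<sigma>"
    by unfold_locales (rule start)
  have nonneg: "0 \<le> sup_error M X \<sigma> a n" for n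
    unfolding sup_error_def by (rule SUP_upper2[of a]) (auto intro!: SUP_upper2[of 0])
  have small: "\<forall>\<^sub>F n in sequentially. sup_error M X \<sigma> a n \<le> ereal \<epsilon>" if "0 < \<epsilon>" for \<epsilon>
    using start.conditional_tail_limit[OF that] eventually_gt_at_top[of 0]
  proof eventually_elim
    case (elim n)
    show ?case
      unfolding sup_error_def
    proof (intro SUP_least)
      fix x u :: real assume "x \<in> {a..}" "u \<in> {0..}"
      then have xu: "a / \<sigma> \<le> x / \<sigma>" "0 \<le> u" using sigma by (auto intro: divide_right_mono)
      have test: "tail_test u n (indicator {u * sqrt n<..})"
        by (auto simp: tail_test_def indicator_def)
      have lim: "0 < law.surv n (x / \<sigma>)"
        "\<bar>law.Kn n (indicator {u * sqrt n<..}) (x / \<sigma>) / law.surv n (x / \<sigma>) - meander_tail u (x / \<sigma> / sqrt n)\<bar> \<le> \<epsilon>"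
        using elim(1) xu test by blast+
      have "(LBINT y:{0..u}. ell_H (x / (\<sigma> * sqrt n)) y) = 1 - meander_tail u (x / \<sigma> / sqrt n)"
        using integral_ell_H[OF xu(2), of "x / (\<sigma> * sqrt n)"] by simp
      then show "ereal \<bar>\<P>(\<omega> in M. (x + walk X n \<omega>) / (\<sigma> * sqrt n) \<le> u \<bar> exit_time X x \<omega> > enat n)
          - (LBINT y:{0..u}. ell_H (x / (\<sigma> * sqrt n)) y)\<bar> \<le> ereal \<epsilon>"
        unfolding conditional_prob_eq[OF elim(2) lim(1)] using lim(2) by (simp add: abs_minus_commute)
    qed
  qed
  show ?thesis
  proof (rule order_tendstoI)
    fix b :: ereal assume "b < 0"
    then show "\<forall>\<^sub>F n in sequentially. b < sup_error M X \<sigma> a n"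
      using nonneg by (intro always_eventually allI) (rule less_le_trans)
  next
    fix b :: ereal assume "0 < b"
    then obtain e where e: "0 < ereal e" "ereal e < b" using ereal_dense2 by blast
    then have "0 < e" by simp
    from small[OF this] show "\<forall>\<^sub>F n in sequentially. sup_error M X \<sigma> a n < b"
      by eventually_elim (use e in \<open>auto intro: le_less_trans\<close>)
  qed
qed

lemma exit_time_attained:
  assumes "exit_time X x \<omega> = enat m"
  shows "1 \<le> m" "x + walk X m \<omega> < 0"
proof -
  let ?A = "{enat k |k. 1 \<le> k \<and> x + walk X k \<omega> < 0}"
  have "?A \<noteq> {}"
  proof
    assume e: "?A = {}"
    have "exit_time X x \<omega> = \<infinity>" unfolding exit_time_def e by (simp add: top_enat_def)
    then show False using assms by simp
  qed
  then have "Inf ?A \<in> ?A" unfolding Inf_enat_def by (auto intro: LeastI)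
  then show "1 \<le> m" "x + walk X m \<omega> < 0" using assms by (auto simp: exit_time_def)
qed

text \<open>Splitting according to the exit time turns \<open>V 0\<close> into the series of mean overshoots at each time.
  It converges because its partial sums are bounded by \<open>lyap 0\<close>, so the stopped walk is
  integrable; its first term is positive.\<close>

lemma harmonic_V_0_pos: "0 < harmonic_V M X 0"
proof -
  define Y where "Y k \<omega> = indicator {\<omega>. alive X 0 k \<omega>} \<omega> * ennreal (max 0 (- (walk X (Suc k) \<omega> / \<sigma>)))" for k \<omega>
  have exit_eq: "0 \<le> - walk_at_exit X 0 \<omega> / \<sigma> \<and> ennreal (- walk_at_exit X 0 \<omega> / \<sigma>) = (\<Sum>k. Y k \<omega>)" for \<omega>
  proof (cases "exit_time X 0 \<omega>")
    case (enat m)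
    note att = exit_time_attained[OF enat]
    obtain j where j: "m = Suc j" using att(1) by (cases m) auto
    have al: "alive X 0 k \<omega> \<longleftrightarrow> k \<le> j" for k
      using exit_time_gt_iff[of k X 0 \<omega>] by (auto simp: enat j)
    have zero: "Y k \<omega> = 0" if "k \<notin> {j}" for k
    proof (cases "k < j")
      case True
      then have "alive X 0 (Suc k) \<omega>" by (simp add: al)
      then have "0 \<le> walk X (Suc k) \<omega>" by (simp add: alive_Suc)
      then show ?thesis using sigma by (simp add: Y_def)
    qed (use that in \<open>simp add: Y_def al\<close>)
    have "(\<Sum>k. Y k \<omega>) = (\<Sum>k\<in>{j}. Y k \<omega>)" using zero by (intro suminf_finite) auto
    also have "\<dots> = ennreal (- walk X m \<omega> / \<sigma>)"
    proof -
      have "walk X (Suc j) \<omega> / \<sigma> \<le> 0" using att(2) sigma by (simp add: j divide_nonpos_pos)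
      then show ?thesis by (simp add: Y_def al j max_def)
    qed
    finally show ?thesis
      using att(2) sigma by (simp add: walk_at_exit_def enat divide_nonpos_pos)
  next
    case infinity
    have "alive X 0 (Suc k) \<omega>" for k using exit_time_gt_iff[of "Suc k" X 0 \<omega>] infinity by simp
    then have "0 \<le> walk X (Suc k) \<omega>" for k by (simp add: alive_Suc)
    then have "Y k \<omega> = 0" for k using sigma by (simp add: Y_def)
    then show ?thesis by (simp add: walk_at_exit_def infinity)
  qed
  have Y_meas [measurable]: "Y k \<in> borel_measurable M" for k
    unfolding Y_def[abs_def] by measurable
  have meas: "(\<lambda>\<omega>. - walk_at_exit X 0 \<omega> / \<sigma>) \<in> borel_measurable M" by measurable
  define c where "c k = law.Kn k law.overshoot 0" for k
  have c0: "0 \<le> c k" for k unfolding c_def by (intro law.Kn_nonneg law.overshoot_nonneg)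
  have c_sum: "summable c"
    using c0 law.mean_overshoot_le_lyap[of _ 0] unfolding law.mean_overshoot_def
    by (intro summableI_nonneg_bounded[of c "law.lyap 0"]) (auto simp: c_def)
  have Y_int: "(\<integral>\<^sup>+\<omega>. Y k \<omega> \<partial>M) = ennreal (c k)" for k
    using nn_integral_one_step[of "\<lambda>z. max 0 (- z)" 0 k] nn_integral_Kn[of law.overshoot 0 k] law.overshoot_nonneg
    by (simp add: Y_def c_def law.overshoot_def[symmetric])
  have "(\<integral>\<^sup>+\<omega>. ennreal (- walk_at_exit X 0 \<omega> / \<sigma>) \<partial>M) = (\<integral>\<^sup>+\<omega>. (\<Sum>k. Y k \<omega>) \<partial>M)"
    using exit_eq by (intro nn_integral_cong) blast
  also have "\<dots> = (\<Sum>k. ennreal (c k))" by (simp add: nn_integral_suminf Y_int)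
  also have "\<dots> = ennreal (suminf c)" by (rule suminf_ennreal2[OF c0 c_sum])
  finally have "(LINT \<omega>|M. - walk_at_exit X 0 \<omega> / \<sigma>) = suminf c"
    using integral_eq_nn_integral[OF meas] exit_eq c0 c_sum by (simp add: suminf_nonneg)
  moreover have "0 < suminf c"
    using law.overshoot_0_pos by (intro suminf_pos2[OF c_sum c0, of 0]) (simp add: c_def)
  moreover have "harmonic_V M X 0 = \<sigma> * (LINT \<omega>|M. - walk_at_exit X 0 \<omega> / \<sigma>)"
    unfolding harmonic_V_def using sigma by simp
  ultimately show ?thesis using sigma by simp
qed

text \<open>If the walk started at \<open>a\<close> exits at once almost surely, the stopped walk is just the first
  step, and its mean is \<open>0\<close>.\<close>

lemma supp_V_start:
  assumes "a \<in> supp_V M X"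
  shows "0 < law.prob {y. 0 \<le> a / \<sigma> + y}"
proof (rule ccontr)
  assume "\<not> 0 < law.prob {y. 0 \<le> a / \<sigma> + y}"
  then have "law.prob {y. 0 \<le> a / \<sigma> + y} = 0" using measure_nonneg[of law] by (simp add: not_less order.antisym)
  then have "prob ((\<lambda>\<omega>. X 1 \<omega> / \<sigma>) -` {y. 0 \<le> a / \<sigma> + y} \<inter> space M) = 0"
    unfolding law_def by (subst (asm) measure_distr) auto
  then have "AE \<omega> in M. \<omega> \<notin> (\<lambda>\<omega>. X 1 \<omega> / \<sigma>) -` {y. 0 \<le> a / \<sigma> + y} \<inter> space M"
    by (intro AE_not_in) (simp add: null_sets_def emeasure_eq_measure)
  then have "AE \<omega> in M. walk_at_exit X a \<omega> = X 1 \<omega>"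
    using AE_space
  proof eventually_elim
    case (elim \<omega>)
    then have "(a + X 1 \<omega>) / \<sigma> < 0" by (simp add: add_divide_distrib)
    then have neg: "a + walk X 1 \<omega> < 0" using sigma by (simp add: walk_def divide_less_0_iff)
    have "exit_time X a \<omega> = enat 1"
    proof (rule antisym)
      show "exit_time X a \<omega> \<le> enat 1" unfolding exit_time_def using neg by (intro Inf_lower) auto
      show "enat 1 \<le> exit_time X a \<omega>" unfolding exit_time_def by (intro Inf_greatest) auto
    qed
    then show ?case by (simp add: walk_at_exit_def walk_def)
  qed
  then have "(LINT \<omega>|M. walk_at_exit X a \<omega>) = (LINT \<omega>|M. X 1 \<omega>)"
    by (intro integral_cong_AE) auto
  then show False using assms mean_X by (simp add: supp_V_def harmonic_V_def)
qed

end

theorem corollary1p5: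
  fixes M :: "'a measure" and X :: "nat \<Rightarrow> 'a \<Rightarrow> real" and \<sigma> \<delta> :: real
  assumes "prob_space M"
    and "prob_space.indep_vars M (\<lambda>_. borel) X {1..}"
    and "\<And>i. i \<ge> 1 \<Longrightarrow> distr M borel (X i) = distr M borel (X 1)"
    and "integrable M (X 1)" and "(LINT \<omega>|M. X 1 \<omega>) = 0"
    and "integrable M (\<lambda>\<omega>. (X 1 \<omega>)\<^sup>2)" and "(LINT \<omega>|M. (X 1 \<omega>)\<^sup>2) = \<sigma>\<^sup>2"
    and "\<sigma> > 0"
    and "\<delta> > 0" and "integrable M (\<lambda>\<omega>. \<bar>X 1 \<omega>\<bar> powr (2 + \<delta>))"
  shows "(\<forall>a \<in> supp_V M X. sup_error M X \<sigma> a \<longlonglongrightarrow> 0)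
       \<and> harmonic_V M X 0 > 0 \<and> sup_error M X \<sigma> 0 \<longlonglongrightarrow> 0"
proof -
  interpret iid_walk M X \<sigma> \<delta>
    using assms by (intro iid_walk.intro iid_walk_axioms.intro)
  have "0 \<in> supp_V M X" using harmonic_V_0_pos by (simp add: supp_V_def)
  then show ?thesis using sup_error_tendsto supp_V_start harmonic_V_0_pos by blast
qed

end
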